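(* For every odd integer $n\geq 1$, there exists a sharply 2-transitive group $G$ that has a normal subgroup $N$ of index $n$ such that $N$ is a simple group.
   Context: An action of a group $G$ on a set $X$ with $|X|\geq 2$ is called sharply 2-transitive if for any two pairs $(x_1,x_2)$ and $(y_1,y_2)$ of elements of $X$ with $x_1\neq x_2$ and $y_1\neq y_2$ there exists a unique $g\in G$ such that $g\cdot x_1=y_1$ and $g\cdot x_2=y_2$. A group is called sharply 2-transitive if it acts sharply 2-transitively on some set $X$ with $|X|\geq 2$. *)

theory Defs
  imports "HOL-Algebra.Group_Action" "HOL-Algebra.SimpleGroups"
begin

definition sharply_2_transitive_action ::
    "('a, 'c) monoid_scheme \<Rightarrow> 'b set \<Rightarrow> ('a \<Rightarrow> 'b \<Rightarrow> 'b) \<Rightarrow> bool" where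
  "sharply_2_transitive_action G X \<phi> \<longleftrightarrow>
     group_action G X \<phi> \<and>
     (\<exists>x\<in>X. \<exists>y\<in>X. x \<noteq> y) \<and>
     (\<forall>x1\<in>X. \<forall>x2\<in>X. \<forall>y1\<in>X. \<forall>y2\<in>X. x1 \<noteq> x2 \<longrightarrow> y1 \<noteq> y2 \<longrightarrow>
        (\<exists>!g. g \<in> carrier G \<and> \<phi> g x1 = y1 \<and> \<phi> g x2 = y2))"

text \<open>
  HOL cannot quantify existentially over the type of the points, so they are taken from the
  element type of the group. Nothing is lost: any orbit map sends the group onto the set acted
  on, so that set embeds into the group (see \<open>sharply_2_transitive_groupI\<close> below).
\<close>

definition sharply_2_transitive_group :: "('a, 'c) monoid_scheme \<Rightarrow> bool" where
  "sharply_2_transitive_group G \<longleftrightarrow>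
     (\<exists>(X :: 'a set) \<phi>. sharply_2_transitive_action G X \<phi>)"

text \<open>
  The locale \<open>simple_group\<close> of HOL-Algebra demands \<open>order G > 1\<close>; since \<open>order\<close> is \<open>0\<close> on
  infinite groups, it only covers finite ones. The following is the notion for arbitrary groups.
\<close>

definition is_simple :: "('a, 'c) monoid_scheme \<Rightarrow> bool" where
  "is_simple G \<longleftrightarrow>
     group G \<and> carrier G \<noteq> {\<one>\<^bsub>G\<^esub>} \<and>
     (\<forall>H. H \<lhd> G \<longrightarrow> H = carrier G \<or> H = {\<one>\<^bsub>G\<^esub>})"

lemma is_simple_iff_simple_group:
  assumes "finite (carrier G)"
  shows "is_simple G \<longleftrightarrow> simple_group G"
proof
  assume s: "is_simple G"
  then interpret group G by (simp add: is_simple_def)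
  have "carrier G \<noteq> {\<one>\<^bsub>G\<^esub>}" using s by (simp add: is_simple_def)
  then have "{\<one>\<^bsub>G\<^esub>} \<subset> carrier G" by auto
  then have "card {\<one>\<^bsub>G\<^esub>} < card (carrier G)" by (rule psubset_card_mono[OF assms])
  then have "order G > 1" by (simp add: order_def)
  then show "simple_group G"
    using s by unfold_locales (auto simp: is_simple_def)
next
  assume "simple_group G"
  then interpret simple_group G .
  show "is_simple G"
    using simple_not_triv no_real_normal_subgroup is_group by (auto simp: is_simple_def)
qed

lemma sharply_2_transitive_groupI:
  fixes G :: "('a, 'c) monoid_scheme" and X :: "'b set"
  assumes s2t: "sharply_2_transitive_action G X \<phi>"
  shows "sharply_2_transitive_group G"
proof -
  from s2t interpret group_action G X \<phi> by (simp add: sharply_2_transitive_action_def)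
  interpret hom: group_hom G "BijGroup X" \<phi> by (rule group_hom)
  from s2t obtain a b where ab: "a \<in> X" "b \<in> X" "a \<noteq> b"
    by (auto simp: sharply_2_transitive_action_def)
  have ex1: "\<exists>!g. g \<in> carrier G \<and> \<phi> g x1 = y1 \<and> \<phi> g x2 = y2"
    if "x1 \<in> X" "x2 \<in> X" "y1 \<in> X" "y2 \<in> X" "x1 \<noteq> x2" "y1 \<noteq> y2" for x1 x2 y1 y2
    using s2t that by (simp add: sharply_2_transitive_action_def)
  have surj: "X \<subseteq> (\<lambda>g. \<phi> g a) ` carrier G"
  proof
    fix x assume x: "x \<in> X"
    obtain y where "y \<in> X" "y \<noteq> x" using ab by metis
    then show "x \<in> (\<lambda>g. \<phi> g a) ` carrier G"
      using ex1[of a b x y] ab x by blast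
  qed
  define k where "k = (\<lambda>g. \<phi> g a)"
  define f where "f = inv_into (carrier G) (\<lambda>g. \<phi> g a)"
  have kf: "k (f x) = x" if "x \<in> X" for x
    unfolding f_def k_def by (rule f_inv_into_f) (use surj that in auto)
  define Y where "Y = f ` X"
  define \<psi> where "\<psi> = (\<lambda>g. \<lambda>y\<in>Y. f (\<phi> g (k y)))"
  have fY: "f x \<in> Y" if "x \<in> X" for x using that by (simp add: Y_def)
  have act: "\<phi> g x \<in> X" if "g \<in> carrier G" "x \<in> X" for g x
    using element_image[OF that] by simp
  have \<psi>f: "\<psi> g (f x) = f (\<phi> g x)" if "x \<in> X" for g x
    using that by (simp add: \<psi>_def fY kf)
  have finj: "f x = f y \<longleftrightarrow> x = y" if "x \<in> X" "y \<in> X" for x y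
    using kf that by metis
  have bij: "\<psi> g \<in> Bij Y" if g: "g \<in> carrier G" for g
  proof -
    have "inj_on (\<psi> g) Y"
      using inj_prop[OF g] by (auto simp: inj_on_def Y_def \<psi>f finj act g)
    moreover have "\<psi> g ` Y = Y"
    proof -
      have "\<psi> g ` Y = f ` (\<phi> g ` X)"
        by (auto simp: Y_def \<psi>f image_image)
      then show ?thesis by (simp add: surj_prop[OF g] Y_def)
    qed
    ultimately show ?thesis
      by (auto simp: Bij_def bij_betw_def \<psi>_def)
  qed
  have "\<psi> (g \<otimes>\<^bsub>G\<^esub> h) = \<psi> g \<otimes>\<^bsub>BijGroup Y\<^esub> \<psi> h"
    if gh: "g \<in> carrier G" "h \<in> carrier G" for g h
  proof
    fix y
    show "\<psi> (g \<otimes>\<^bsub>G\<^esub> h) y = (\<psi> g \<otimes>\<^bsub>BijGroup Y\<^esub> \<psi> h) y"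
    proof (cases "y \<in> Y")
      case True
      then obtain x where x: "x \<in> X" "y = f x" by (auto simp: Y_def)
      show ?thesis
        using gh bij True bij_prop0
        by (simp add: BijGroup_def compose_def x \<psi>f act composition_rule)
    next
      case False
      then show ?thesis using gh bij by (simp add: BijGroup_def compose_def \<psi>_def)
    qed
  qed
  then have "group_hom G (BijGroup Y) \<psi>"
    using bij group_BijGroup hom.G.is_group
    by (auto simp: group_hom_def group_hom_axioms_def hom_def BijGroup_def)
  moreover have "\<exists>x\<in>Y. \<exists>y\<in>Y. x \<noteq> y"
    using ab fY[of a] fY[of b] finj[of a b] by auto
  moreover have "\<exists>!g. g \<in> carrier G \<and> \<psi> g x1 = y1 \<and> \<psi> g x2 = y2"
    if Y: "x1 \<in> Y" "x2 \<in> Y" "y1 \<in> Y" "y2 \<in> Y" "x1 \<noteq> x2" "y1 \<noteq> y2" for x1 x2 y1 y2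
  proof -
    obtain u1 u2 v1 v2 where u: "u1 \<in> X" "u2 \<in> X" "v1 \<in> X" "v2 \<in> X"
      "x1 = f u1" "x2 = f u2" "y1 = f v1" "y2 = f v2"
      using Y(1-4) by (auto simp: Y_def)
    have eq: "(g \<in> carrier G \<and> \<psi> g x1 = y1 \<and> \<psi> g x2 = y2) \<longleftrightarrow>
        (g \<in> carrier G \<and> \<phi> g u1 = v1 \<and> \<phi> g u2 = v2)" for g
      using u by (simp add: \<psi>f finj act cong: conj_cong)
    have "u1 \<noteq> u2" "v1 \<noteq> v2" using u Y(5,6) by blast+
    then show ?thesis
      unfolding eq using ex1[of u1 u2 v1 v2] u(1-4) by blast
  qed
  ultimately have "sharply_2_transitive_action G Y \<psi>"
    by (auto simp: sharply_2_transitive_action_def group_action_def)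
  then show ?thesis by (auto simp: sharply_2_transitive_group_def)
qed

end

theory Submission
  imports Defs "HOL-Algebra.Elementary_Groups" "HOL-Algebra.Weak_Morphisms" "HOL-Library.Countable_Set"
begin

text \<open>
  Let \<open>A\<close> be a subgroup of a group \<open>G\<close> and \<open>t\<close> an involution outside \<open>A\<close>. If \<open>A\<close> is
  malnormal, that is, if it meets its conjugates by elements outside \<open>A\<close> trivially, then
  only the unit fixes two left cosets of \<open>A\<close>; if moreover \<open>G = A \<union> A t A\<close>, then the action
  of \<open>G\<close> on these cosets is sharply 2-transitive. Let \<open>p\<close> be a homomorphism of \<open>G\<close> onto
  the cyclic group of order \<open>n\<close>. Its kernel has index \<open>n\<close>, and it is simple if it is
  nontrivial and each of its elements lies in the normal closure, within the kernel, of
  each of its nontrivial elements. A group with all these properties is obtained as the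
  union of a chain, in the manner of the construction by Rips, Segev and Tent of sharply
  2-transitive groups without abelian normal subgroups.

  The chain starts with the direct product of the cyclic group of order \<open>n\<close> and a group
  \<open>{1, t}\<close>, with \<open>A\<close> trivial. Letters are adjoined, by HNN extensions, for two purposes.
  To bring \<open>v\<close> into \<open>A t A\<close>, a letter is added to \<open>A\<close> that maps the coset of \<open>v\<close> to that
  of \<open>t\<close>; if an involution \<open>s\<close> swaps \<open>A\<close> and \<open>v A\<close>, the letter also has to conjugate \<open>s\<close>
  to \<open>t\<close> (\<open>double_coset_extension\<close>). To bring \<open>g\<close> into the normal closure of \<open>h\<close>, a free
  letter \<open>b\<close> is added and then a letter that conjugates the commutator \<open>u\<close> of \<open>h\<close> and \<open>b\<close>
  to \<open>g u\<close> (\<open>normal_closure_extension\<close>). All new letters are sent to the unit by \<open>p\<close>. Here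
  the oddness of \<open>n\<close> is used: it makes \<open>p\<close> trivial on all involutions, so the relation
  between \<open>s\<close> and \<open>t\<close> is compatible with it.

  What has to be preserved is that only the unit fixes two cosets and that no involution
  fixes a coset. Both follow from a single analysis of an HNN extension acting on normal
  forms (\<open>perms_two_fixed\<close>, \<open>perms_involution\<close>), which also shows that the commutators
  used for simplicity act freely enough to be conjugated (\<open>cyclically_reduced_free\<close>).
  Since everything is countable, all stages can be realised on sets of natural numbers
  (\<open>letter_extension\<close>), and a bookkeeping along the natural numbers performs all the steps
  (\<open>closed_extension\<close>).
\<close>

section \<open>Representatives of left cosets\<close>

text \<open>
  Left cosets of a subgroup are handled through representatives, so that the set of cosets
  is a set of group elements and normal forms become words in group elements. The coset of
  \<open>\<one>\<close> is represented by \<open>\<one>\<close>; normal forms rely on this to recognise cancellation.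
\<close>

definition (in group) coset_rep :: "'a set \<Rightarrow> 'a \<Rightarrow> 'a" where
  "coset_rep D k = (if k \<in> D then \<one> else SOME r. r \<in> k <# D)"

context group
begin

lemma mult_inv_cancel [simp]:
  assumes "a \<in> carrier G" "b \<in> carrier G"
  shows "a \<otimes> (inv a \<otimes> b) = b" "inv a \<otimes> (a \<otimes> b) = b"
  using assms by (simp_all add: m_assoc[symmetric])

lemma l_coset_eqI:
  assumes "subgroup D G" "k \<in> carrier G" "d \<in> D"
  shows "(k \<otimes> d) <# D = k <# D"
  using assms by (metis coset_join3 lcos_m_assoc subgroup.mem_carrier subgroup.subset)

lemma coset_rep_props:
  assumes D: "subgroup D G" and k: "k \<in> carrier G"
  shows coset_rep_closed: "coset_rep D k \<in> carrier G"
    and inv_coset_rep_mult: "inv (coset_rep D k) \<otimes> k \<in> D"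
    and inv_mult_coset_rep: "inv k \<otimes> coset_rep D k \<in> D"
proof -
  have *: "coset_rep D k \<in> k <# D \<or> (k \<in> D \<and> coset_rep D k = \<one>)"
  proof (cases "k \<in> D")
    case False
    have "k \<in> k <# D"
      using D k by (auto simp: l_coset_def intro!: bexI[of _ \<one>] subgroup.one_closed)
    then show ?thesis using False by (auto simp: coset_rep_def intro: someI)
  qed (simp add: coset_rep_def)
  then show c: "coset_rep D k \<in> carrier G"
    using D k subgroup.mem_carrier[OF D] by (auto simp: l_coset_def)
  show d: "inv k \<otimes> coset_rep D k \<in> D"
    using * D k by (auto simp: l_coset_def m_assoc[symmetric] subgroup.mem_carrier
        intro: subgroup.m_inv_closed)
  have "inv (inv k \<otimes> coset_rep D k) \<in> D" using D d by (rule subgroup.m_inv_closed)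
  then show "inv (coset_rep D k) \<otimes> k \<in> D" using k c by (simp add: inv_mult_group)
qed

lemma coset_rep_eq_one_iff:
  assumes D: "subgroup D G" and k: "k \<in> carrier G"
  shows "coset_rep D k = \<one> \<longleftrightarrow> k \<in> D"
proof
  assume "coset_rep D k = \<one>"
  then show "k \<in> D" using inv_coset_rep_mult[OF assms] k by simp
qed (simp add: coset_rep_def)

lemma coset_rep_mult_right:
  assumes D: "subgroup D G" and k: "k \<in> carrier G" and d: "d \<in> D"
  shows "coset_rep D (k \<otimes> d) = coset_rep D k"
proof -
  have dG: "d \<in> carrier G" using D d by (rule subgroup.mem_carrier)
  have "k \<otimes> d \<in> D \<longleftrightarrow> k \<in> D"
  proof
    assume "k \<otimes> d \<in> D"
    then have "(k \<otimes> d) \<otimes> inv d \<in> D" using D d by (simp add: subgroup.m_closed subgroup.m_inv_closed)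
    then show "k \<in> D" using k dG by (simp add: m_assoc)
  qed (use D d in \<open>simp add: subgroup.m_closed\<close>)
  then show ?thesis by (simp add: coset_rep_def l_coset_eqI[OF assms])
qed

lemma coset_rep_eq_iff:
  assumes D: "subgroup D G" and k: "k \<in> carrier G" "l \<in> carrier G"
  shows "coset_rep D k = coset_rep D l \<longleftrightarrow> inv k \<otimes> l \<in> D"
proof
  assume "coset_rep D k = coset_rep D l"
  then have "inv k \<otimes> coset_rep D k \<in> D" "inv (coset_rep D k) \<otimes> l \<in> D"
    using inv_mult_coset_rep[OF D k(1)] inv_coset_rep_mult[OF D k(2)] by auto
  then have "(inv k \<otimes> coset_rep D k) \<otimes> (inv (coset_rep D k) \<otimes> l) \<in> D" by (rule subgroup.m_closed[OF D])
  then show "inv k \<otimes> l \<in> D" using k coset_rep_closed[OF D k(1)] by (simp add: m_assoc)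
next
  assume "inv k \<otimes> l \<in> D"
  then have "coset_rep D (k \<otimes> (inv k \<otimes> l)) = coset_rep D k" by (rule coset_rep_mult_right[OF D k(1)])
  then show "coset_rep D k = coset_rep D l" using k by (simp add: m_assoc[symmetric])
qed

lemma coset_rep_mult_coset_rep:
  assumes D: "subgroup D G" and k: "k \<in> carrier G" "l \<in> carrier G"
  shows "coset_rep D (k \<otimes> coset_rep D l) = coset_rep D (k \<otimes> l)"
proof -
  have "k \<otimes> coset_rep D l = k \<otimes> l \<otimes> (inv l \<otimes> coset_rep D l)"
    using k coset_rep_closed[OF D k(2)] by (simp add: m_assoc)
  then show ?thesis using coset_rep_mult_right[OF D _ inv_mult_coset_rep[OF D k(2)]] k by simp
qed

lemma coset_rep_coset_rep:
  assumes "subgroup D G" "k \<in> carrier G"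
  shows "coset_rep D (coset_rep D k) = coset_rep D k"
  using coset_rep_mult_coset_rep[OF assms(1) one_closed assms(2)] assms coset_rep_closed by simp

end

section \<open>Normal forms for a new letter that acts partially\<close>

text \<open>
  A group \<open>K\<close> acts on \<open>X\<close>, and a letter \<open>f\<close> is to be adjoined, together with new points,
  so that the old points on which \<open>f\<close> is prescribed are moved as prescribed and everything
  else is free. The Boolean \<open>True\<close> stands for \<open>f\<close> and \<open>False\<close> for its inverse: \<open>f\<close>
  conjugates the subgroup \<open>dom True\<close> onto \<open>dom False\<close> through \<open>th True\<close>, and it maps the
  points of \<open>S True\<close> onto those of \<open>S False\<close> through \<open>ph True\<close>. The group so obtained is
  the HNN extension of \<open>K\<close> with associated subgroups \<open>dom True\<close> and \<open>dom False\<close>.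

  In the Bass-Serre tree of the extension every vertex carries a copy of \<open>X\<close>, and the
  copies at the two ends of an edge overlap in a copy of \<open>S True\<close>, glued along \<open>ph True\<close>.
  By \<open>S_cross\<close> and \<open>S_stab\<close> two distinct points of one copy of \<open>X\<close> lie together in at most
  one overlap with prescription \<open>S True\<close>, and then in none with prescription \<open>S False\<close>;
  this keeps an element with two fixed points from moving along the tree.
\<close>

locale partial_letter = group K for K (structure) +
  fixes X :: "'x set" and act :: "'a \<Rightarrow> 'x \<Rightarrow> 'x"
    and dom :: "bool \<Rightarrow> 'a set" and th :: "bool \<Rightarrow> 'a \<Rightarrow> 'a"
    and S :: "bool \<Rightarrow> 'x set" and ph :: "bool \<Rightarrow> 'x \<Rightarrow> 'x"
  assumes act_closed: "k \<in> carrier K \<Longrightarrow> x \<in> X \<Longrightarrow> act k x \<in> X"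
    and act_one: "x \<in> X \<Longrightarrow> act \<one> x = x"
    and act_mult: "k \<in> carrier K \<Longrightarrow> l \<in> carrier K \<Longrightarrow> x \<in> X \<Longrightarrow> act (k \<otimes> l) x = act k (act l x)"
    and two_fixed: "k \<in> carrier K \<Longrightarrow> x \<in> X \<Longrightarrow> y \<in> X \<Longrightarrow> x \<noteq> y \<Longrightarrow>
      act k x = x \<Longrightarrow> act k y = y \<Longrightarrow> k = \<one>"
    and two_points: "\<exists>x\<in>X. \<exists>y\<in>X. x \<noteq> y"
    and dom_subgroup: "subgroup (dom e) K"
    and th_closed: "c \<in> dom e \<Longrightarrow> th e c \<in> dom (\<not> e)"
    and th_mult: "c \<in> dom e \<Longrightarrow> d \<in> dom e \<Longrightarrow> th e (c \<otimes> d) = th e c \<otimes> th e d"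
    and th_th: "c \<in> dom e \<Longrightarrow> th (\<not> e) (th e c) = c"
    and dom_free: "c \<in> dom e \<Longrightarrow> x \<in> X \<Longrightarrow> act c x = x \<Longrightarrow> c = \<one>"
    and S_sub: "S e \<subseteq> X"
    and S_act: "c \<in> dom e \<Longrightarrow> x \<in> S e \<Longrightarrow> act c x \<in> S e"
    and ph_closed: "x \<in> S e \<Longrightarrow> ph e x \<in> S (\<not> e)"
    and ph_ph: "x \<in> S e \<Longrightarrow> ph (\<not> e) (ph e x) = x"
    and ph_act: "c \<in> dom e \<Longrightarrow> x \<in> S e \<Longrightarrow> ph e (act c x) = act (th e c) (ph e x)"
    and S_proper: "\<exists>x\<in>X. x \<notin> S e"
    and S_cross: "k \<in> carrier K \<Longrightarrow> x \<in> S True \<Longrightarrow> y \<in> S True \<Longrightarrow> x \<noteq> y \<Longrightarrow>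
      act k x \<in> S False \<Longrightarrow> act k y \<notin> S False"
    and S_stab: "k \<in> carrier K \<Longrightarrow> x \<in> S True \<Longrightarrow> y \<in> S True \<Longrightarrow> x \<noteq> y \<Longrightarrow>
      act k x \<in> S True \<Longrightarrow> act k y \<in> S True \<Longrightarrow> k \<in> dom True"
begin

lemma dom_carrier: "c \<in> dom e \<Longrightarrow> c \<in> carrier K"
  using dom_subgroup by (rule subgroup.mem_carrier)

lemma one_dom [simp]: "\<one> \<in> dom e"
  using dom_subgroup by (rule subgroup.one_closed)

lemma dom_mult_iff:
  assumes "c \<in> dom e" "k \<in> carrier K"
  shows "c \<otimes> k \<in> dom e \<longleftrightarrow> k \<in> dom e"
proof
  assume "c \<otimes> k \<in> dom e"
  then have "inv c \<otimes> (c \<otimes> k) \<in> dom e"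
    using assms dom_subgroup by (simp add: subgroup.m_closed subgroup.m_inv_closed)
  then show "k \<in> dom e" using assms dom_carrier by (simp add: m_assoc[symmetric])
qed (use assms dom_subgroup in \<open>simp add: subgroup.m_closed\<close>)

lemma th_one [simp]: "th e \<one> = \<one>"
proof -
  have "th e \<one> \<otimes> th e \<one> = th e \<one>" using th_mult[of \<one> e \<one>] by simp
  moreover have "th e \<one> \<in> carrier K" using th_closed[of \<one> e] dom_carrier by auto
  ultimately show ?thesis by simp
qed

lemma act_cancel:
  assumes "k \<in> carrier K" "x \<in> X"
  shows "act (inv k) (act k x) = x" "act k (act (inv k) x) = x"
  using act_mult[of "inv k" k x] act_mult[of k "inv k" x] assms by (simp_all add: act_one)

lemma act_eq_iff:
  assumes "k \<in> carrier K" "x \<in> X" "y \<in> X"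
  shows "act k x = act k y \<longleftrightarrow> x = y"
  using act_cancel(1) assms by metis

lemma S_X: "x \<in> S e \<Longrightarrow> x \<in> X" using S_sub by auto

lemma S_act_iff:
  assumes "c \<in> dom e" "x \<in> X"
  shows "act c x \<in> S e \<longleftrightarrow> x \<in> S e"
proof
  assume "act c x \<in> S e"
  then have "act (inv c) (act c x) \<in> S e"
    using assms dom_subgroup by (simp add: S_act subgroup.m_inv_closed)
  then show "x \<in> S e" using assms by (simp add: act_cancel dom_carrier)
qed (use assms in \<open>simp add: S_act\<close>)

lemma faithful:
  assumes "k \<in> carrier K" "\<And>x. x \<in> X \<Longrightarrow> act k x = x"
  shows "k = \<one>"
  using two_points two_fixed assms by metis

text \<open>
  Points of the extended set are written \<open>r\<^sub>1 f\<^bsup>e\<^sub>1\<^esup> \<dots> r\<^sub>m f\<^bsup>e\<^sub>m\<^esup> x\<close> with \<open>x\<close> in \<open>X\<close> and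
  each \<open>r\<^sub>i\<close> a coset representative, since \<open>r d f\<^bsup>e\<^esup> = r f\<^bsup>e\<^esup> d'\<close> lets any factor from
  \<open>dom (\<not> e)\<close> pass through the letter to the right. A point absorbs \<open>f\<^bsup>e\<^esup>\<close> when applying
  \<open>f\<^bsup>e\<^esup>\<close> does not lengthen its expression; normal forms are those in which no letter is
  absorbed by what follows it.
\<close>

fun absorbs :: "bool \<Rightarrow> ('a \<times> bool) list \<times> 'x \<Rightarrow> bool" where
  "absorbs e ([], x) \<longleftrightarrow> x \<in> S e"
| "absorbs e ((r, e') # w, x) \<longleftrightarrow> r = \<one> \<and> e' = (\<not> e)"

fun normal_pt :: "('a \<times> bool) list \<Rightarrow> 'x \<Rightarrow> bool" where
  "normal_pt [] x \<longleftrightarrow> x \<in> X"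
| "normal_pt ((r, e) # w) x \<longleftrightarrow>
     r \<in> carrier K \<and> coset_rep (dom (\<not> e)) r = r \<and> normal_pt w x \<and> \<not> absorbs e (w, x)"

definition points :: "(('a \<times> bool) list \<times> 'x) set" where
  "points = {(w, x). normal_pt w x}"

fun elem_move :: "'a \<Rightarrow> ('a \<times> bool) list \<Rightarrow> 'x \<Rightarrow> ('a \<times> bool) list \<times> 'x" where
  "elem_move k [] x = ([], act k x)"
| "elem_move k ((r, e) # w) x =
     (let r' = coset_rep (dom (\<not> e)) (k \<otimes> r); y = elem_move (th (\<not> e) (inv r' \<otimes> k \<otimes> r)) w x
      in ((r', e) # fst y, snd y))"

fun letter_move :: "bool \<Rightarrow> ('a \<times> bool) list \<Rightarrow> 'x \<Rightarrow> ('a \<times> bool) list \<times> 'x" where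
  "letter_move e w x = (if \<not> absorbs e (w, x) then ((\<one>, e) # w, x)
     else if w = [] then ([], ph e x) else (tl w, x))"

lemma coset_remainder:
  assumes "k \<in> carrier K" "r \<in> carrier K"
  shows "inv (coset_rep (dom e) (k \<otimes> r)) \<otimes> k \<otimes> r \<in> dom e"
  using inv_coset_rep_mult[OF dom_subgroup, of "k \<otimes> r" e]
    coset_rep_closed[OF dom_subgroup, of "k \<otimes> r" e] assms
  by (simp add: m_assoc)

lemma th_dom: "c \<in> dom (\<not> e) \<Longrightarrow> th (\<not> e) c \<in> dom e"
  using th_closed[of c "\<not> e"] by simp

text \<open>
  The elements of \<open>dom e\<close> are exactly those that may be carried through \<open>f\<^bsup>e\<^esup>\<close>, so they
  cannot influence whether \<open>f\<^bsup>e\<^esup>\<close> cancels.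
\<close>

lemma absorbs_elem_move:
  assumes "normal_pt w x" "c \<in> dom e"
  shows "absorbs e (elem_move c w x) \<longleftrightarrow> absorbs e (w, x)"
proof (cases w)
  case Nil
  then show ?thesis using assms S_act_iff by simp
next
  case (Cons a w')
  obtain r e' where a: "a = (r, e')" by (cases a)
  have r: "r \<in> carrier K" "coset_rep (dom (\<not> e')) r = r" using assms(1) Cons a by auto
  have "e' = (\<not> e) \<Longrightarrow> coset_rep (dom (\<not> e')) (c \<otimes> r) = \<one> \<longleftrightarrow> coset_rep (dom (\<not> e')) r = \<one>"
    using assms r(1) by (simp add: coset_rep_eq_one_iff dom_subgroup dom_carrier dom_mult_iff)
  then show ?thesis using Cons a r by (auto simp: Let_def)
qed

lemma normal_pt_elem_move:
  assumes "normal_pt w x" "k \<in> carrier K"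
  shows "elem_move k w x \<in> points"
  using assms
proof (induction w arbitrary: k)
  case Nil
  then show ?case by (simp add: points_def act_closed)
next
  case (Cons a w)
  obtain r e where a: "a = (r, e)" by (cases a)
  define d where "d = th (\<not> e) (inv (coset_rep (dom (\<not> e)) (k \<otimes> r)) \<otimes> k \<otimes> r)"
  have r: "r \<in> carrier K" and w: "normal_pt w x" "\<not> absorbs e (w, x)" using Cons.prems(1) a by auto
  have d: "d \<in> dom e" unfolding d_def by (rule th_dom) (rule coset_remainder[OF Cons.prems(2) r])
  have "elem_move d w x \<in> points" using Cons.IH[OF w(1)] d dom_carrier by blast
  moreover have "\<not> absorbs e (elem_move d w x)" using absorbs_elem_move w d by simp
  ultimately show ?case using r Cons.prems(2)
    by (auto simp: a Let_def d_def[symmetric] points_def coset_rep_closed coset_rep_coset_rep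
      dom_subgroup split: prod.splits)
qed

lemma elem_move_one: "normal_pt w x \<Longrightarrow> elem_move \<one> w x = (w, x)"
proof (induction w)
  case (Cons a w)
  then show ?case by (cases a) (auto simp: Let_def)
qed (simp add: act_one)

lemma elem_move_mult:
  assumes "normal_pt w x" "k \<in> carrier K" "l \<in> carrier K"
  shows "elem_move (k \<otimes> l) w x = elem_move k (fst (elem_move l w x)) (snd (elem_move l w x))"
  using assms
proof (induction w arbitrary: k l)
  case Nil
  then show ?case by (simp add: act_mult)
next
  case (Cons a w)
  obtain r e where a: "a = (r, e)" by (cases a)
  let ?D = "dom (\<not> e)"
  have r: "r \<in> carrier K" and w: "normal_pt w x" using Cons.prems(1) a by auto
  define r1 where "r1 = coset_rep ?D (l \<otimes> r)"
  define r2 where "r2 = coset_rep ?D (k \<otimes> r1)"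
  define d1 where "d1 = inv r1 \<otimes> l \<otimes> r"
  define d2 where "d2 = inv r2 \<otimes> k \<otimes> r1"
  have kl: "k \<in> carrier K" "l \<in> carrier K" using Cons.prems by auto
  have r1: "r1 \<in> carrier K" unfolding r1_def using kl r dom_subgroup by (simp add: coset_rep_closed)
  have r2: "r2 \<in> carrier K" unfolding r2_def using kl r1 dom_subgroup by (simp add: coset_rep_closed)
  have d: "d1 \<in> ?D" "d2 \<in> ?D"
    unfolding d1_def d2_def r1_def r2_def using coset_remainder kl r r1 r1_def by auto
  have r2': "coset_rep ?D (k \<otimes> l \<otimes> r) = r2"
    unfolding r2_def r1_def using kl r dom_subgroup by (simp add: coset_rep_mult_coset_rep m_assoc)
  have "d2 \<otimes> d1 = inv r2 \<otimes> (k \<otimes> l) \<otimes> r"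
    unfolding d1_def d2_def using kl r r1 r2 by (simp add: m_assoc)
  then have e: "th (\<not> e) (inv r2 \<otimes> (k \<otimes> l) \<otimes> r) = th (\<not> e) d2 \<otimes> th (\<not> e) d1"
    using th_mult d by metis
  have t: "th (\<not> e) d1 \<in> carrier K" "th (\<not> e) d2 \<in> carrier K"
    using d th_dom dom_carrier by blast+
  show ?case using Cons.IH[OF w t(2,1)]
    by (simp add: a Let_def r1_def[symmetric] r2_def[symmetric] r2' d1_def[symmetric] d2_def[symmetric]
      e)
qed

lemma normal_pt_letter_move:
  assumes "normal_pt w x"
  shows "letter_move e w x \<in> points \<and> (case letter_move e w x of (v, z) \<Rightarrow> letter_move (\<not> e) v z) =
    (w, x)"
proof (cases w)
  case Nil
  then show ?thesis
    using assms ph_closed[of x e] S_X[of "ph e x" "\<not> e"] ph_ph[of x e]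
    by (auto simp: points_def coset_rep_eq_one_iff[OF dom_subgroup])
next
  case (Cons a w')
  obtain r e' where a: "a = (r, e')" by (cases a)
  show ?thesis using assms unfolding Cons a
    by (cases e; cases e'; cases w') (auto simp: points_def coset_rep_eq_one_iff[OF dom_subgroup])
qed

text \<open>
  This is the defining relation \<open>f c = th c f\<close> of the extension, checked on normal forms.
\<close>

lemma letter_move_elem_move:
  assumes "normal_pt w x" "c \<in> dom e"
  shows "(case elem_move c w x of (v, z) \<Rightarrow> letter_move e v z) =
    (case letter_move e w x of (v, z) \<Rightarrow> elem_move (th e c) v z)"
proof (cases "absorbs e (w, x)")
  case False
  have th: "th e c \<in> dom (\<not> e)" using assms(2) by (rule th_closed)
  have r1: "coset_rep (dom (\<not> e)) (th e c) = \<one>"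
    using th coset_rep_eq_one_iff[OF dom_subgroup dom_carrier[OF th]] by simp
  have "\<not> absorbs e (elem_move c w x)" using False absorbs_elem_move assms by simp
  then show ?thesis using False th dom_carrier[OF th] assms(2)
    by (auto simp: Let_def r1 th_th split: prod.splits)
next
  case True
  then have T2: "absorbs e (elem_move c w x)" using absorbs_elem_move assms by simp
  show ?thesis
  proof (cases w)
    case Nil
    then show ?thesis using True T2 assms(2) by (simp add: ph_act)
  next
    case (Cons a w')
    then have a: "a = (\<one>, \<not> e)" using True by (cases a) auto
    have r1: "coset_rep (dom e) c = \<one>" using assms(2) coset_rep_eq_one_iff[OF dom_subgroup dom_carrier]
      by blast
    show ?thesis using True T2 Cons a assms(2) dom_carrier[OF assms(2)]
      by (auto simp: Let_def r1 split: prod.splits)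
  qed
qed

end

lemma comp_inverse: "h \<circ> g = id \<Longrightarrow> k' \<circ> k = id \<Longrightarrow> (h \<circ> k') \<circ> (k \<circ> g) = id"
  by (metis comp_assoc comp_id)

section \<open>The group generated by the old elements and the letter\<close>

text \<open>
  The group carries a homomorphism \<open>p\<close> to a fixed group \<open>H\<close>, which is to be extended by
  sending the new letter to the unit; this is possible because \<open>p\<close> does not distinguish an
  element of an associated subgroup from its conjugate by the letter.
\<close>

locale partial_letter_over = partial_letter K X act dom th S ph + H: group H
  for K :: "('a, 'b) monoid_scheme" (structure)
    and X :: "'x set" and act dom th S ph and H :: "('h, 'i) monoid_scheme" +
  fixes p :: "'a \<Rightarrow> 'h"
  assumes p_hom: "p \<in> hom K H"
    and p_th: "c \<in> dom e \<Longrightarrow> p (th e c) = p c"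
begin

declare letter_move.simps [simp del]

text \<open>
  The moves are extended by the identity outside the set of normal forms. They become
  permutations of a whole type, so the new group can be taken with plain composition and
  \<open>id\<close>.
\<close>

definition elem_perm :: "'a \<Rightarrow> ('a \<times> bool) list \<times> 'x \<Rightarrow> ('a \<times> bool) list \<times> 'x" where
  "elem_perm k y = (if y \<in> points then elem_move k (fst y) (snd y) else y)"

definition letter_perm :: "bool \<Rightarrow> ('a \<times> bool) list \<times> 'x \<Rightarrow> ('a \<times> bool) list \<times> 'x" where
  "letter_perm e y = (if y \<in> points then letter_move e (fst y) (snd y) else y)"

lemma p_closed: "k \<in> carrier K \<Longrightarrow> p k \<in> carrier H"
  using p_hom by (auto simp: hom_def)

lemma p_mult: "k \<in> carrier K \<Longrightarrow> l \<in> carrier K \<Longrightarrow> p (k \<otimes> l) = p k \<otimes>\<^bsub>H\<^esub> p l"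
  using p_hom by (auto simp: hom_def)

lemma p_one [simp]: "p \<one> = \<one>\<^bsub>H\<^esub>"
  using p_mult[of \<one> \<one>] p_closed[of \<one>] by simp

lemma p_inv: "k \<in> carrier K \<Longrightarrow> p (inv k) = inv\<^bsub>H\<^esub> (p k)"
  using p_mult[of "inv k" k] p_closed by (simp add: H.inv_equality)

lemma base_points: "x \<in> X \<Longrightarrow> ([], x) \<in> points" by (simp add: points_def)

lemma elem_perm_base: "x \<in> X \<Longrightarrow> elem_perm k ([], x) = ([], act k x)"
  by (simp add: elem_perm_def points_def)

lemma letter_perm_base: "x \<in> S e \<Longrightarrow> letter_perm e ([], x) = ([], ph e x)"
  using S_X[of x e] by (simp add: letter_perm_def points_def letter_move.simps)

lemma elem_perm_closed: "k \<in> carrier K \<Longrightarrow> elem_perm k y \<in> points \<longleftrightarrow> y \<in> points"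
  using normal_pt_elem_move[of "fst y" "snd y" k] by (auto simp: elem_perm_def points_def)

lemma letter_perm_closed: "letter_perm e y \<in> points \<longleftrightarrow> y \<in> points"
  using normal_pt_letter_move[of "fst y" "snd y" e] by (auto simp: letter_perm_def points_def)

lemma elem_perm_one: "elem_perm \<one> = id"
  using elem_move_one by (force simp: elem_perm_def points_def)

lemma elem_perm_mult:
  assumes "k \<in> carrier K" "l \<in> carrier K"
  shows "elem_perm (k \<otimes> l) = elem_perm k \<circ> elem_perm l"
proof
  fix y
  show "elem_perm (k \<otimes> l) y = (elem_perm k \<circ> elem_perm l) y"
  proof (cases "y \<in> points")
    case True
    then have "elem_move l (fst y) (snd y) \<in> points"
      using normal_pt_elem_move[of "fst y" "snd y" l] assms by (auto simp: points_def)
    then show ?thesis using True elem_move_mult[of "fst y" "snd y" k l] assms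
      by (auto simp: elem_perm_def points_def)
  qed (simp add: elem_perm_def)
qed

lemma elem_perm_inv:
  assumes "k \<in> carrier K"
  shows "elem_perm k \<circ> elem_perm (inv k) = id" "elem_perm (inv k) \<circ> elem_perm k = id"
  using elem_perm_mult[of k "inv k"] elem_perm_mult[of "inv k" k] assms by (simp_all add: elem_perm_one)

lemma letter_perm_inv: "letter_perm (\<not> e) \<circ> letter_perm e = id"
proof
  fix y
  show "(letter_perm (\<not> e) \<circ> letter_perm e) y = id y"
  proof (cases "y \<in> points")
    case True
    then have "normal_pt (fst y) (snd y)" by (auto simp: points_def)
    from normal_pt_letter_move[OF this, of e] show ?thesis using True
      by (auto simp: letter_perm_def split: prod.splits)
  qed (simp add: letter_perm_def)
qed

lemma letter_perm_inv': "letter_perm e \<circ> letter_perm (\<not> e) = id"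
  using letter_perm_inv[of "\<not> e"] by simp

lemma letter_perm_elem_perm:
  assumes "c \<in> dom e"
  shows "letter_perm e \<circ> elem_perm c = elem_perm (th e c) \<circ> letter_perm e"
proof
  fix y
  show "(letter_perm e \<circ> elem_perm c) y = (elem_perm (th e c) \<circ> letter_perm e) y"
  proof (cases "y \<in> points")
    case True
    then have o: "normal_pt (fst y) (snd y)" by (auto simp: points_def)
    show ?thesis using True letter_move_elem_move[OF o assms]
      normal_pt_elem_move[OF o dom_carrier[OF assms]] normal_pt_letter_move[OF o, of e]
      by (auto simp: letter_perm_def elem_perm_def split: prod.splits)
  qed (simp add: letter_perm_def elem_perm_def)
qed

text \<open>
  A word is a list of pairs \<open>(k, e)\<close>, standing for the product of the factors \<open>k f\<^bsup>e\<^esup>\<close>; an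
  element of the extension is such a word times one last element of \<open>K\<close>.
\<close>

fun word_perm :: "('a \<times> bool) list \<Rightarrow> ('a \<times> bool) list \<times> 'x \<Rightarrow> ('a \<times> bool) list \<times> 'x" where
  "word_perm [] = id"
| "word_perm ((k, e) # W) = elem_perm k \<circ> letter_perm e \<circ> word_perm W"

lemma word_perm_append: "word_perm (V @ W) = word_perm V \<circ> word_perm W"
  by (induction V) (auto simp: comp_assoc)

fun pinch :: "bool \<Rightarrow> ('a \<times> bool) list \<Rightarrow> bool" where
  "pinch e [] \<longleftrightarrow> False"
| "pinch e ((k, e') # W) \<longleftrightarrow> e' = (\<not> e) \<and> k \<in> dom e"

fun reduced :: "('a \<times> bool) list \<Rightarrow> bool" where
  "reduced [] \<longleftrightarrow> True"
| "reduced ((k, e) # W) \<longleftrightarrow> k \<in> carrier K \<and> reduced W \<and> \<not> pinch e W"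

lemma pinch_append: "pinch e (V @ W) \<longleftrightarrow> (if V = [] then pinch e W else pinch e V)"
  by (cases V) auto

lemma reduced_append:
  "reduced (V @ W) \<longleftrightarrow> reduced V \<and> reduced W \<and> (V \<noteq> [] \<longrightarrow> \<not> pinch (snd (last V)) W)"
  by (induction V) (auto simp: pinch_append)

lemma length_elem_move: "length (fst (elem_move k w x)) = length w"
  by (induction k w x rule: elem_move.induct) (auto simp: Let_def)

lemma length_elem_perm: "length (fst (elem_perm k y)) = length (fst y)"
  by (simp add: elem_perm_def length_elem_move)

text \<open>
  The counterpart of Britton's lemma: if a reduced word is applied to a point of \<open>X\<close> on
  which its rightmost letter is not prescribed, no letter is absorbed, so each one adds
  one to the length of the normal form.
\<close>

lemma reduced_length:
  assumes "reduced W" "x \<in> X" "W \<noteq> [] \<Longrightarrow> x \<notin> S (snd (last W))"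
  shows "word_perm W ([], x) \<in> points \<and> length (fst (word_perm W ([], x))) = length W \<and>
    (W \<noteq> [] \<longrightarrow> (\<forall>e. absorbs e (word_perm W ([], x)) \<longleftrightarrow> pinch e W))"
  using assms
proof (induction W)
  case Nil
  then show ?case by (simp add: base_points)
next
  case (Cons a W)
  obtain k e where a: "a = (k, e)" by (cases a)
  have k: "k \<in> carrier K" and W: "reduced W" "\<not> pinch e W" using Cons.prems(1) a by auto
  have "W \<noteq> [] \<Longrightarrow> x \<notin> S (snd (last W))" using Cons.prems(3) by simp
  note IH0 = Cons.IH[OF W(1) Cons.prems(2) this]
  have IH: "word_perm W ([], x) \<in> points" "length (fst (word_perm W ([], x))) = length W"
    "W \<noteq> [] \<Longrightarrow> absorbs e (word_perm W ([], x)) \<longleftrightarrow> pinch e W"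
    using IH0 by auto
  obtain w z where y: "word_perm W ([], x) = (w, z)" by fastforce
  have na: "\<not> absorbs e (w, z)"
  proof (cases "W = []")
    case True
    then show ?thesis using y Cons.prems(3) a by auto
  qed (use IH(3) y W in simp)
  have f: "letter_perm e (w, z) = ((\<one>, e) # w, z)" using na IH(1) y
    by (simp add: letter_perm_def letter_move.simps)
  then have fP: "((\<one>, e) # w, z) \<in> points" using letter_perm_closed IH(1) y by metis
  have s: "word_perm (a # W) ([], x) = elem_perm k ((\<one>, e) # w, z)" using y f a by simp
  have "absorbs e' (word_perm (a # W) ([], x)) \<longleftrightarrow> pinch e' (a # W)" for e'
    unfolding s using fP k
    by (auto simp: a elem_perm_def Let_def coset_rep_eq_one_iff[OF dom_subgroup])
  moreover have "length (fst (word_perm (a # W) ([], x))) = length (a # W)"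
    using s IH(2) y by (simp add: length_elem_perm)
  moreover have "word_perm (a # W) ([], x) \<in> points" using s fP k elem_perm_closed by simp
  ultimately show ?case by simp
qed

lemma word_perm_normal:
  assumes "normal_pt w x"
  shows "word_perm w ([], x) = (w, x) \<and> reduced w \<and> (\<forall>e. pinch e w \<longrightarrow> absorbs e (w, x)) \<and>
    (w \<noteq> [] \<longrightarrow> x \<notin> S (snd (last w))) \<and> x \<in> X"
  using assms
proof (induction w)
  case Nil
  then show ?case by simp
next
  case (Cons a w)
  obtain r e where a: "a = (r, e)" by (cases a)
  have r: "r \<in> carrier K" "coset_rep (dom (\<not> e)) r = r" and w: "normal_pt w x" "\<not> absorbs e (w, x)"
    using Cons.prems a by auto
  have wP: "(w, x) \<in> points" using w by (simp add: points_def)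
  have f: "letter_perm e (w, x) = ((\<one>, e) # w, x)" using w wP
    by (simp add: letter_perm_def letter_move.simps)
  then have fP: "((\<one>, e) # w, x) \<in> points" using letter_perm_closed wP by metis
  have "elem_perm r ((\<one>, e) # w, x) = ((r, e) # w, x)"
    using fP r w by (simp add: elem_perm_def Let_def elem_move_one)
  moreover have "r = \<one>" if "r \<in> dom (\<not> e)"
    using that r coset_rep_eq_one_iff[OF dom_subgroup r(1), of "\<not> e"] by simp
  ultimately show ?case
    using Cons.IH[OF w(1)] f r(1) w unfolding a by auto
qed

text \<open>
  That a permutation is the product of a word in the generators, together with the value
  which the extension of \<open>p\<close> must take on that word. A relation is used because the value
  is known to depend on the permutation alone only after the analysis of reduced words.
\<close>

inductive evaluates_to :: "(('a \<times> bool) list \<times> 'x \<Rightarrow> ('a \<times> bool) list \<times> 'x) \<Rightarrow> 'h \<Rightarrow> bool" where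
  evaluates_to_base: "k \<in> carrier K \<Longrightarrow> evaluates_to (elem_perm k) (p k)"
| evaluates_to_elem_perm: "k \<in> carrier K \<Longrightarrow> evaluates_to g z \<Longrightarrow>
  evaluates_to (elem_perm k \<circ> g) (p k \<otimes>\<^bsub>H\<^esub> z)"
| evaluates_to_letter_perm: "evaluates_to g z \<Longrightarrow> evaluates_to (letter_perm e \<circ> g) z"

definition perms where "perms = {g. \<exists>z. evaluates_to g z}"

lemma evaluates_to_carrier: "evaluates_to g z \<Longrightarrow> z \<in> carrier H"
  by (induction rule: evaluates_to.induct) (auto simp: p_closed)

lemma evaluates_to_id: "evaluates_to id \<one>\<^bsub>H\<^esub>"
  using evaluates_to_base[of \<one>] by (simp add: elem_perm_one)

lemma evaluates_to_letter: "evaluates_to (letter_perm e) \<one>\<^bsub>H\<^esub>"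
  using evaluates_to_letter_perm[OF evaluates_to_id] by simp

lemma evaluates_to_comp: "evaluates_to g z \<Longrightarrow> evaluates_to h y \<Longrightarrow> evaluates_to (g \<circ> h) (z \<otimes>\<^bsub>H\<^esub> y)"
proof (induction rule: evaluates_to.induct)
  case (evaluates_to_base k)
  then show ?case by (intro evaluates_to_elem_perm)
next
  case (evaluates_to_elem_perm k g z)
  have "p k \<otimes>\<^bsub>H\<^esub> z \<otimes>\<^bsub>H\<^esub> y = p k \<otimes>\<^bsub>H\<^esub> (z \<otimes>\<^bsub>H\<^esub> y)"
    using evaluates_to_elem_perm(1,2,4) evaluates_to_carrier p_closed by (simp add: H.m_assoc)
  then show ?case using evaluates_to.evaluates_to_elem_perm[OF evaluates_to_elem_perm(1)
    evaluates_to_elem_perm(3)[OF evaluates_to_elem_perm(4)]]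
    by (simp only: comp_assoc)
next
  case (evaluates_to_letter_perm g z e)
  then show ?case using evaluates_to.evaluates_to_letter_perm[of "g \<circ> h"] by (simp only: comp_assoc)
qed

lemma evaluates_to_inverse: "evaluates_to g z \<Longrightarrow> \<exists>h. evaluates_to h (inv\<^bsub>H\<^esub> z) \<and> h \<circ> g = id \<and> g \<circ> h = id"
proof (induction rule: evaluates_to.induct)
  case (evaluates_to_base k)
  then have "evaluates_to (elem_perm (inv k)) (inv\<^bsub>H\<^esub> p k)"
    using evaluates_to.evaluates_to_base[of "inv k"] by (simp add: p_inv)
  then show ?case using elem_perm_inv[OF evaluates_to_base] by blast
next
  case (evaluates_to_elem_perm k g z)
  then obtain h where h: "evaluates_to h (inv\<^bsub>H\<^esub> z)" "h \<circ> g = id" "g \<circ> h = id" by blast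
  have "evaluates_to (h \<circ> elem_perm (inv k)) (inv\<^bsub>H\<^esub> z \<otimes>\<^bsub>H\<^esub> p (inv k))"
    using evaluates_to_comp[OF h(1) evaluates_to.evaluates_to_base] evaluates_to_elem_perm by simp
  moreover have "(h \<circ> elem_perm (inv k)) \<circ> (elem_perm k \<circ> g) = id" "(elem_perm k \<circ> g) \<circ>
    (h \<circ> elem_perm (inv k)) = id"
    using h elem_perm_inv[OF evaluates_to_elem_perm(1)] comp_inverse by blast+
  moreover have "inv\<^bsub>H\<^esub> z \<otimes>\<^bsub>H\<^esub> p (inv k) = inv\<^bsub>H\<^esub> (p k \<otimes>\<^bsub>H\<^esub> z)"
    using evaluates_to_elem_perm(1,2) evaluates_to_carrier p_closed
      by (simp add: H.inv_mult_group p_inv)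
  ultimately show ?case by metis
next
  case (evaluates_to_letter_perm g z e)
  then obtain h where h: "evaluates_to h (inv\<^bsub>H\<^esub> z)" "h \<circ> g = id" "g \<circ> h = id" by blast
  have "evaluates_to (h \<circ> letter_perm (\<not> e)) (inv\<^bsub>H\<^esub> z)"
    using evaluates_to_comp[OF h(1) evaluates_to_letter[of "\<not> e"]] evaluates_to_carrier[OF h(1)] by simp
  moreover have "(h \<circ> letter_perm (\<not> e)) \<circ> (letter_perm e \<circ> g) = id" "(letter_perm e \<circ> g) \<circ>
    (h \<circ> letter_perm (\<not> e)) = id"
    using h letter_perm_inv[of e] letter_perm_inv'[of e] comp_inverse by blast+
  ultimately show ?case by blast
qed

lemma perms_comp: "g \<in> perms \<Longrightarrow> h \<in> perms \<Longrightarrow> g \<circ> h \<in> perms"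
  unfolding perms_def using evaluates_to_comp by blast

lemma perms_inverse: "g \<in> perms \<Longrightarrow> \<exists>h\<in>perms. h \<circ> g = id \<and> g \<circ> h = id"
  unfolding perms_def using evaluates_to_inverse by blast

lemma perms_elem_perm: "k \<in> carrier K \<Longrightarrow> elem_perm k \<in> perms" using evaluates_to_base
  by (auto simp: perms_def)
lemma perms_letter_perm: "letter_perm e \<in> perms" using evaluates_to_letter by (auto simp: perms_def)
lemma perms_id: "id \<in> perms" using evaluates_to_id by (auto simp: perms_def)

lemma perms_points: "g \<in> perms \<Longrightarrow> g y \<in> points \<longleftrightarrow> y \<in> points"
proof -
  have "evaluates_to g z \<Longrightarrow> g y \<in> points \<longleftrightarrow> y \<in> points" for z
    by (induction rule: evaluates_to.induct) (auto simp: elem_perm_closed letter_perm_closed)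
  then show "g \<in> perms \<Longrightarrow> g y \<in> points \<longleftrightarrow> y \<in> points" by (auto simp: perms_def)
qed

lemma perms_word_perm: "reduced W \<Longrightarrow> word_perm W \<in> perms"
  by (induction W) (auto simp: perms_id intro!: perms_comp perms_elem_perm perms_letter_perm)

fun word_hom :: "('a \<times> bool) list \<Rightarrow> 'h" where
  "word_hom [] = \<one>\<^bsub>H\<^esub>"
| "word_hom ((k, e) # W) = p k \<otimes>\<^bsub>H\<^esub> word_hom W"

lemma word_hom_closed: "reduced W \<Longrightarrow> word_hom W \<in> carrier H"
  by (induction W) (auto simp: p_closed)

text \<open>
  Whenever a pinch \<open>f\<^bsup>e\<^esup> c f\<^bsup>-e\<^esup>\<close> with \<open>c\<close> in \<open>dom e\<close> occurs it is replaced by \<open>th e c\<close>,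
  which changes neither the permutation nor, by the assumption on \<open>p\<close>, the value.
\<close>

lemma reduced_word:
  "evaluates_to g z \<Longrightarrow> \<exists>W k. reduced W \<and> k \<in> carrier K \<and> g = word_perm W \<circ> elem_perm k \<and>
    z = word_hom W \<otimes>\<^bsub>H\<^esub> p k"
proof (induction rule: evaluates_to.induct)
  case (evaluates_to_base k)
  then show ?case by (intro exI[of _ "[]"] exI[of _ k]) (simp add: p_closed)
next
  case (evaluates_to_elem_perm k g z)
  then obtain W l where W: "reduced W" "l \<in> carrier K" "g = word_perm W \<circ> elem_perm l" "z = word_hom W
    \<otimes>\<^bsub>H\<^esub> p l" by blast
  show ?case
  proof (cases W)
    case Nil
    then show ?thesis using W evaluates_to_elem_perm(1)
      by (intro exI[of _ "[]"] exI[of _ "k \<otimes> l"]) (simp add: elem_perm_mult p_mult p_closed)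
  next
    case (Cons a V)
    obtain m e where a: "a = (m, e)" by (cases a)
    show ?thesis using W evaluates_to_elem_perm(1) Cons a word_hom_closed[of V]
      by (intro exI[of _ "(k \<otimes> m, e) # V"] exI[of _ l])
        (simp add: elem_perm_mult p_mult p_closed comp_assoc H.m_assoc)
  qed
next
  case (evaluates_to_letter_perm g z e)
  then obtain W l where W: "reduced W" "l \<in> carrier K" "g = word_perm W \<circ> elem_perm l" "z = word_hom W
    \<otimes>\<^bsub>H\<^esub> p l" by blast
  show ?case
  proof (cases "pinch e W")
    case False
    then show ?thesis using W word_hom_closed[of W] 
      by (intro exI[of _ "(\<one>, e) # W"] exI[of _ l]) (simp add: elem_perm_one p_closed comp_assoc)
  next
    case True
    then obtain c V where V: "W = (c, \<not> e) # V" and c: "c \<in> dom e"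
      by (cases "(e, W)" rule: pinch.cases) auto
    have t: "th e c \<in> carrier K" using th_closed[OF c] dom_carrier by blast
    have "letter_perm e \<circ> g = (letter_perm e \<circ> elem_perm c) \<circ> letter_perm (\<not> e) \<circ> word_perm V \<circ>
      elem_perm l"
      using W(3) V by (simp add: comp_assoc)
    also have "\<dots> = elem_perm (th e c) \<circ> (letter_perm e \<circ> letter_perm (\<not> e)) \<circ> word_perm V \<circ> elem_perm l"
      by (simp only: letter_perm_elem_perm[OF c]) (simp add: comp_assoc)
    finally have g: "letter_perm e \<circ> g = elem_perm (th e c) \<circ> word_perm V \<circ> elem_perm l"
      by (simp add: letter_perm_inv')
    show ?thesis
    proof (cases V)
      case Nil
      then show ?thesis using W V g t p_th[OF c] c dom_carrier[OF c]
        by (intro exI[of _ "[]"] exI[of _ "th e c \<otimes> l"]) (simp add: elem_perm_mult p_mult p_closed)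
    next
      case (Cons a U)
      obtain m e' where a: "a = (m, e')" by (cases a)
      show ?thesis using W V g t p_th[OF c] dom_carrier[OF c] Cons a word_hom_closed[of U]
        by (intro exI[of _ "(th e c \<otimes> m, e') # U"] exI[of _ l])
          (simp add: elem_perm_mult p_mult p_closed comp_assoc H.m_assoc)
    qed
  qed
qed

lemma perms_reduced_word:
  assumes "g \<in> perms"
  obtains W k where "reduced W" "k \<in> carrier K" "g = word_perm W \<circ> elem_perm k"
  using reduced_word assms unfolding perms_def by blast

text \<open>
  If a reduced word returns a point of \<open>X\<close> to \<open>X\<close>, then the point never leaves \<open>X\<close> on the
  way: otherwise its length would grow with every later letter.
\<close>

lemma fixes_base:
  assumes "reduced W" "k \<in> carrier K" "x \<in> X" "(word_perm W \<circ> elem_perm k) ([], x) = ([], y)" "W \<noteq> []"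
  shows "act k x \<in> S (snd (last W))"
proof (rule ccontr)
  assume "act k x \<notin> S (snd (last W))"
  then have "length (fst (word_perm W ([], act k x))) = length W"
    using reduced_length[OF assms(1), of "act k x"] assms(2,3) act_closed by simp
  then show False using assms by (simp add: elem_perm_base)
qed

lemma elem_perm_eq_id:
  assumes "k \<in> carrier K" "x \<in> X" "y \<in> X" "x \<noteq> y" "elem_perm k ([], x) = ([], x)" "elem_perm k ([], y) =
    ([], y)"
  shows "elem_perm k = id"
  using two_fixed[of k x y] assms by (simp add: elem_perm_base elem_perm_one)

lemma elem_perm_inj: 
  assumes "k \<in> carrier K" "elem_perm k = id"
  shows "k = \<one>"
  using faithful[OF assms(1)] elem_perm_base[of _ k] assms(2) by auto

text \<open>
  A nonempty reduced word lengthens any point of \<open>X\<close> on which its rightmost letter is not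
  prescribed, and such points exist because neither \<open>f\<close> nor its inverse is prescribed on
  all of \<open>X\<close>.
\<close>

lemma reduced_not_id:
  assumes "reduced W" "W \<noteq> []" "k \<in> carrier K"
  shows "word_perm W \<circ> elem_perm k \<noteq> id"
proof
  assume *: "word_perm W \<circ> elem_perm k = id"
  obtain x where x: "x \<in> X" "x \<notin> S (snd (last W))" using S_proper by blast
  then have "act (inv k) x \<in> X" using assms(3) act_closed by simp
  from fixes_base[OF assms(1,3) this] * assms act_cancel(2)[OF assms(3) x(1)] x show False by simp
qed

lemma evaluates_to_unique: "evaluates_to g z \<Longrightarrow> evaluates_to g z' \<Longrightarrow> z = z'"
proof -
  assume g: "evaluates_to g z" "evaluates_to g z'"
  obtain h where h: "evaluates_to h (inv\<^bsub>H\<^esub> z')" "g \<circ> h = id" using evaluates_to_inverse[OF g(2)]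
    by blast
  have "evaluates_to id (z \<otimes>\<^bsub>H\<^esub> inv\<^bsub>H\<^esub> z')" using evaluates_to_comp[OF g(1) h(1)] h(2) by simp
  from reduced_word[OF this] obtain W k where W: "reduced W" "k \<in> carrier K" "id = word_perm W \<circ>
    elem_perm k"
    "z \<otimes>\<^bsub>H\<^esub> inv\<^bsub>H\<^esub> z' = word_hom W \<otimes>\<^bsub>H\<^esub> p k" by blast
  have "W = []" using reduced_not_id W by metis
  then have "z \<otimes>\<^bsub>H\<^esub> inv\<^bsub>H\<^esub> z' = \<one>\<^bsub>H\<^esub>" using W elem_perm_inj[of k] by simp
  then show "z = z'" using evaluates_to_carrier g H.inv_equality H.inv_inv H.inv_closed by metis
qed

section \<open>Fixed points in the extended action\<close>

lemma conj_id:
  assumes "h \<circ> g \<circ> h' = id" "h' \<circ> h = id" "h \<circ> h' = id"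
  shows "g = id"
proof -
  have "g = (h' \<circ> h) \<circ> g \<circ> (h' \<circ> h)" using assms by simp
  also have "\<dots> = h' \<circ> (h \<circ> g \<circ> h') \<circ> h" by (simp only: comp_assoc)
  finally show ?thesis using assms by simp
qed

text \<open>
  Suppose a reduced word fixes two points of \<open>X\<close>. Both stay in \<open>X\<close> while the letters act,
  so the pair travels through the sets \<open>S True\<close> and \<open>S False\<close>. Since no element of \<open>K\<close>
  carries two points of one of these sets into the other, there is not just one letter and
  consecutive letters have opposite signs. Since only \<open>dom True\<close> preserves two points of
  \<open>S True\<close>, an occurrence of \<open>f k f\<^bsup>-1\<^esup>\<close> would be a pinch. What is left are words without
  letters, which \<open>two_fixed\<close> settles, and words of the form \<open>k\<^sub>2 f\<^bsup>-1\<^esup> k\<^sub>1 f k\<close>, which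
  turn out to be conjugate to an element of \<open>K\<close>.
\<close>

lemma two_fixed_base:
  assumes W: "reduced W" and k: "k \<in> carrier K" and g: "g = word_perm W \<circ> elem_perm k"
    and x: "x \<in> X" "y \<in> X" "x \<noteq> y" and fxd: "g ([], x) = ([], x)" "g ([], y) = ([], y)"
  shows "g = id"
proof (cases W rule: rev_cases)
  case Nil
  then show ?thesis using elem_perm_eq_id[OF k x] fxd g by simp
next
  case (snoc V a)
  obtain k1 e where a: "a = (k1, e)" by (cases a)
  define x1 y1 where "x1 = act k x" and "y1 = act k y"
  have V: "W = V @ [(k1, e)]" using snoc a by simp
  have 1: "x1 \<in> S e" "y1 \<in> S e" "x1 \<noteq> y1"
    using fixes_base[OF W k x(1)] fixes_base[OF W k x(2)] fxd g V act_eq_iff[OF k] x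
    by (auto simp: x1_def y1_def)
  define x2 y2 where "x2 = ph e x1" and "y2 = ph e y1"
  have 2: "x2 \<in> S (\<not> e)" "y2 \<in> S (\<not> e)" "x2 \<noteq> y2" "x2 \<in> X" "y2 \<in> X"
    using 1 ph_closed ph_ph[of x1 e] ph_ph[of y1 e] S_X unfolding x2_def y2_def
      by (blast, blast, metis, blast+)
  have k1: "k1 \<in> carrier K" using W V by (auto simp: reduced_append)
  have ev: "word_perm V (elem_perm k1 ([], x2)) = ([], x)" "word_perm V (elem_perm k1 ([], y2)) =
    ([], y)"
    using fxd g V x 1 by (simp_all add: word_perm_append elem_perm_base letter_perm_base x1_def y1_def
      x2_def y2_def)
  show ?thesis
  proof (cases V rule: rev_cases)
    case Nil
    then have "act k1 x2 = x" "act k1 y2 = y" using ev 2 by (simp_all add: elem_perm_base)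
    then have "act (k \<otimes> k1) x2 = x1" "act (k \<otimes> k1) y2 = y1"
      using act_mult k k1 2 by (simp_all add: x1_def y1_def)
    then have *: "act (k \<otimes> k1) x2 \<in> S e" "act (k \<otimes> k1) y2 \<in> S e"
       "act (inv (k \<otimes> k1)) x1 = x2" "act (inv (k \<otimes> k1)) y1 = y2"
      using 1 2 k k1 act_cancel(1)[of "k \<otimes> k1"] by auto
    have False
    proof (cases e)
      case True
      then show ?thesis using * 1 2 S_cross[of "inv (k \<otimes> k1)" x1 y1] k k1 by auto
    next
      case False
      then show ?thesis using * 1 2 S_cross[of "k \<otimes> k1" x2 y2] k k1 by auto
    qed
    then show ?thesis ..
  next
    case (snoc V' b)
    obtain k2 e2 where b: "b = (k2, e2)" by (cases b)
    have V': "V = V' @ [(k2, e2)]" using snoc b by simp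
    have redV: "reduced V" and np: "\<not> (e = (\<not> e2) \<and> k1 \<in> dom e2)"
      using W V V' by (auto simp: reduced_append)
    have k2: "k2 \<in> carrier K" using redV V' by (auto simp: reduced_append)
    have 3: "act k1 x2 \<in> S e2" "act k1 y2 \<in> S e2"
      using fixes_base[OF redV k1 2(4)] fixes_base[OF redV k1 2(5)] ev V' by auto
    have e: "e" "\<not> e2"
    proof -
      have "\<not> (e2 \<and> e)" using 3 2 S_cross[of "inv k1" "act k1 x2" "act k1 y2"] k1 act_cancel(1)[OF k1]
          act_eq_iff[OF k1] by auto
      moreover have "\<not> (\<not> e2 \<and> \<not> e)" using 3 2 S_cross[of k1 x2 y2] k1 by (cases e; cases e2) auto
      moreover have "\<not> (e2 \<and> \<not> e)" using 3 2 S_stab[of k1 x2 y2] k1 np by (cases e) auto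
      ultimately show "e" "\<not> e2" by auto
    qed
    define x3 y3 where "x3 = ph False (act k1 x2)" and "y3 = ph False (act k1 y2)"
    have 3: "act k1 x2 \<in> S False" "act k1 y2 \<in> S False" using 3 e by simp_all
    have "act k1 x2 \<noteq> act k1 y2" using 2 act_eq_iff[OF k1] by simp
    then have 4: "x3 \<in> S True" "y3 \<in> S True" "x3 \<noteq> y3" "x3 \<in> X" "y3 \<in> X"
      using ph_closed[OF 3(1)] ph_closed[OF 3(2)] ph_ph[OF 3(1)] ph_ph[OF 3(2)] S_X
      unfolding x3_def y3_def by (simp, simp, metis, auto)
    have ev': "word_perm V' (elem_perm k2 ([], x3)) = ([], x)" "word_perm V' (elem_perm k2 ([], y3)) =
      ([], y)"
      using ev V' e 2 3 by (simp_all add: word_perm_append elem_perm_base letter_perm_base x3_def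
        y3_def)
    show ?thesis
    proof (cases V' rule: rev_cases)
      case Nil
      then have "act k2 x3 = x" "act k2 y3 = y" using ev' 4 by (simp_all add: elem_perm_base)
      then have a: "act (k \<otimes> k2) x3 = x1" "act (k \<otimes> k2) y3 = y1"
        using act_mult k k2 4 by (simp_all add: x1_def y1_def)
      define c where "c = k \<otimes> k2"
      have c: "c \<in> dom True" using S_stab[of c x3 y3] a 4 1 e k k2 by (simp add: c_def)
      have t: "th True c \<in> dom False" using th_closed[OF c] by simp
      \<comment> \<open>Here \<open>k k\<^sub>2\<close> preserves two points of \<open>S True\<close>, hence it can be carried through \<open>f\<^bsup>-1\<^esup>\<close>, and
        \<open>g\<close> is a conjugate of \<open>m\<close>.\<close>
      have gW: "g = elem_perm k2 \<circ> letter_perm False \<circ> elem_perm k1 \<circ> letter_perm True \<circ> elem_perm k"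
        using g V V' Nil e by (simp add: word_perm_append comp_assoc)
      define m where "m = th True c \<otimes> k1"
      have m: "m \<in> carrier K" using t dom_carrier k1 by (simp add: m_def)
      have "elem_perm c \<circ> letter_perm False = letter_perm False \<circ> elem_perm (th True c)"
        using letter_perm_elem_perm[OF t] th_th[OF c] by simp
      then have "elem_perm k \<circ> elem_perm k2 \<circ> letter_perm False = letter_perm False \<circ> elem_perm
        (th True c)"
        using elem_perm_mult k k2 by (simp add: c_def)
      then have "(elem_perm k \<circ> elem_perm k2 \<circ> letter_perm False) \<circ> (elem_perm k1 \<circ> letter_perm True) =
        (letter_perm False \<circ> elem_perm (th True c)) \<circ> (elem_perm k1 \<circ> letter_perm True)"
        by simp
      then have key: "elem_perm k \<circ> elem_perm k2 \<circ> letter_perm False \<circ> elem_perm k1 \<circ> letter_perm True =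
        letter_perm False \<circ> elem_perm m \<circ> letter_perm True"
        using elem_perm_mult[of "th True c" k1] dom_carrier[OF t] k1 by (simp add: m_def comp_assoc)
      have kg: "elem_perm k \<circ> g \<circ> elem_perm (inv k) = letter_perm False \<circ> elem_perm m \<circ> letter_perm
        True"
      proof -
        have "elem_perm k \<circ> g \<circ> elem_perm (inv k) =
          (elem_perm k \<circ> elem_perm k2 \<circ> letter_perm False \<circ> elem_perm k1 \<circ> letter_perm True) \<circ>
          (elem_perm k \<circ> elem_perm (inv k))"
          by (simp only: gW comp_assoc)
        then show ?thesis using key elem_perm_inv[OF k] by simp
      qed
      have inv: "letter_perm True \<circ> letter_perm False = id" "letter_perm False \<circ> letter_perm True = id"
        using letter_perm_inv[of False] letter_perm_inv[of True] by simp_all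
      have fx: "(elem_perm k \<circ> g \<circ> elem_perm (inv k)) ([], act k z) = ([], act k z)"
        if "z \<in> X" "g ([], z) = ([], z)" for z
        using that k act_closed by (simp add: elem_perm_base act_cancel)
      have fm: "elem_perm m ([], ph True z) = ([], ph True z)"
        if "z \<in> S True" "(letter_perm False \<circ> elem_perm m \<circ> letter_perm True) ([], z) = ([], z)" for z
      proof -
        have "(letter_perm True \<circ> letter_perm False) (elem_perm m (letter_perm True ([], z))) =
          letter_perm True ([], z)"
          using that by simp
        then show ?thesis using inv that by (simp add: letter_perm_base)
      qed
      have "elem_perm m ([], x2) = ([], x2)" "elem_perm m ([], y2) = ([], y2)"
        using fm[of x1] fm[of y1] fx[of x] fx[of y] x fxd 1 e unfolding kg x1_def y1_def x2_def y2_def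
          by auto
      then have "elem_perm m = id" using elem_perm_eq_id[OF m] 2 by blast
      then have "elem_perm k \<circ> g \<circ> elem_perm (inv k) = id" using kg inv by simp
      then show "g = id" using conj_id elem_perm_inv[OF k] by blast
    next
      case (snoc V'' d)
      obtain k3 e3 where d: "d = (k3, e3)" by (cases d)
      have V'': "V' = V'' @ [(k3, e3)]" using snoc d by simp
      have redV': "reduced V'" and np': "\<not> (e2 = (\<not> e3) \<and> k2 \<in> dom e3)"
        using redV V' V'' by (auto simp: reduced_append)
      have "act k2 x3 \<in> S e3" "act k2 y3 \<in> S e3"
        using fixes_base[OF redV' k2 4(4)] fixes_base[OF redV' k2 4(5)] ev' V'' by auto
      then have False using 4 S_cross[of k2 x3 y3] S_stab[of k2 x3 y3] k2 np' e
        by (cases e3) auto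
      then show ?thesis ..
    qed
  qed
qed

text \<open>
  The induction shortens the distance in the Bass-Serre tree between a point of \<open>X\<close> and
  another fixed point. If the point of \<open>X\<close> also lies in the next copy of \<open>X\<close> towards the
  other point, passing to that copy brings the two points closer. Otherwise a fixing
  element without letters lies in a conjugate of an associated subgroup and fixes a point
  of \<open>X\<close>, so it is trivial; and a fixing element with letters would lengthen the other
  point.
\<close>

lemma two_fixed_base_left:
  assumes "g \<in> perms" "x \<in> X" "y \<in> points" "y \<noteq> ([], x)" "g ([], x) = ([], x)" "g y = y"
  shows "g = id"
  using assms
proof (induction "length (fst y)" arbitrary: g x y)
  case 0
  then obtain z where z: "y = ([], z)" "z \<in> X" by (cases y) (auto simp: points_def)
  obtain W k where "reduced W" "k \<in> carrier K" "g = word_perm W \<circ> elem_perm k"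
    using perms_reduced_word[OF 0(2)] by blast
  from two_fixed_base[OF this 0(3) z(2)] show ?case using 0 z by auto
next
  case (Suc m)
  obtain r e w z where y: "y = ((r, e) # w, z)" using Suc(2) by (cases y; cases "fst y") auto
  have r: "r \<in> carrier K" "coset_rep (dom (\<not> e)) r = r" and w: "normal_pt w z" "\<not> absorbs e (w, z)"
    using Suc.prems(3) y by (auto simp: points_def)
  have oky: "normal_pt ((r, e) # w) z" using Suc.prems(3) y by (simp add: points_def)
  have yP: "elem_perm r (letter_perm e (w, z)) = y"
    using word_perm_normal[OF oky] word_perm_normal[OF w(1)] y by simp
  show ?case
  proof (cases "act (inv r) x \<in> S (\<not> e)")
    case True
    define h h' where "h = letter_perm (\<not> e) \<circ> elem_perm (inv r)" and "h' = elem_perm r \<circ> letter_perm e"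
    have hE: "h \<in> perms" "h' \<in> perms" unfolding h_def h'_def using r
      by (auto intro: perms_comp perms_elem_perm perms_letter_perm)
    have hh: "h \<circ> h' = id" "h' \<circ> h = id"
      unfolding h_def h'_def using comp_inverse letter_perm_inv letter_perm_inv' elem_perm_inv[OF r(1)]
        by blast+
    have hy: "h y = (w, z)"
      using fun_cong[OF hh(1), of "(w, z)"] yP by (simp add: h'_def)
    have hx: "h ([], x) = ([], ph (\<not> e) (act (inv r) x))"
      using True Suc.prems(2) by (simp add: h_def elem_perm_base letter_perm_base)
    have "h \<circ> g \<circ> h' = id"
    proof (rule Suc.hyps(1))
      show "m = length (fst (w, z))" using Suc(2) y by simp
      show "h \<circ> g \<circ> h' \<in> perms" using hE Suc.prems(1) by (intro perms_comp)
      show "ph (\<not> e) (act (inv r) x) \<in> X" using ph_closed[OF True] S_X by blast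
      show "(w, z) \<in> points" using w by (simp add: points_def)
      have hinj: "h' (h u) = u" for u using fun_cong[OF hh(2), of u] by simp
      show "(w, z) \<noteq> ([], ph (\<not> e) (act (inv r) x))"
        using hx hy Suc.prems(4) hinj by metis
      show "(h \<circ> g \<circ> h') ([], ph (\<not> e) (act (inv r) x)) = ([], ph (\<not> e) (act (inv r) x))"
        using hinj[of "([], x)"] hx Suc.prems(5) by simp
      show "(h \<circ> g \<circ> h') (w, z) = (w, z)"
        using hinj[of y] hy Suc.prems(6) by simp
    qed
    then show ?thesis using conj_id hh by blast
  next
    case False
    obtain W k where W: "reduced W" "k \<in> carrier K" "g = word_perm W \<circ> elem_perm k"
      using perms_reduced_word[OF Suc.prems(1)] by blast
    show ?thesis
    proof (cases "W = []")
      case True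
      then have g: "g = elem_perm k" using W by simp
      have kx: "act k x = x" using Suc.prems(2,5) g by (simp add: elem_perm_base)
      have "elem_perm k y = ((coset_rep (dom (\<not> e)) (k \<otimes> r), e) # fst
        (elem_move (th (\<not> e) (inv (coset_rep (dom (\<not> e)) (k \<otimes> r)) \<otimes> k \<otimes> r)) w z), 
        snd (elem_move (th (\<not> e) (inv (coset_rep (dom (\<not> e)) (k \<otimes> r)) \<otimes> k \<otimes> r)) w z))"
        using Suc.prems(3) y by (simp add: elem_perm_def Let_def)
      then have kr: "coset_rep (dom (\<not> e)) (k \<otimes> r) = r" using Suc.prems(6) g y by simp
      define c where "c = inv r \<otimes> k \<otimes> r"
      have c: "c \<in> dom (\<not> e)" using coset_remainder[OF W(2) r(1), of "\<not> e"] kr by (simp add: c_def)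
      have "act c (act (inv r) x) = act (c \<otimes> inv r) x"
        using act_mult dom_carrier[OF c] r Suc.prems(2) by simp
      also have "c \<otimes> inv r = inv r \<otimes> k" using W r by (simp add: c_def m_assoc)
      also have "act (inv r \<otimes> k) x = act (inv r) x" using act_mult r W kx Suc.prems(2) by simp
      finally have "c = \<one>" using dom_free[OF c act_closed[of "inv r" x]] r Suc.prems(2) by simp
      then have "r \<otimes> c \<otimes> inv r = \<one>" using r by simp
      then have "k = \<one>" using W r by (simp add: c_def m_assoc)
      then show ?thesis using g elem_perm_one by simp
    next
      case ne: False
      define e' where "e' = snd (last W)"
      have kx: "act k x \<in> S e'"
        using fixes_base[OF W(1,2) Suc.prems(2)] Suc.prems(5) W(3) ne by (simp add: e'_def)
      define V where "V = W @ (k \<otimes> r, e) # w"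
      have sw: "word_perm w ([], z) = (w, z)" using word_perm_normal[OF w(1)] by blast
      have "g y = word_perm W (elem_perm k (elem_perm r (letter_perm e (word_perm w ([], z)))))"
        unfolding W(3) sw yP comp_apply ..
      then have gy: "g y = word_perm V ([], z)"
        unfolding V_def word_perm_append word_perm.simps elem_perm_mult[OF W(2) r(1)] comp_apply .
      have redy: "reduced ((r, e) # w)" using word_perm_normal[OF oky] by blast
      have np: "\<not> (e = (\<not> e') \<and> k \<otimes> r \<in> dom e')"
      proof
        assume *: "e = (\<not> e') \<and> k \<otimes> r \<in> dom e'"
        have "act (k \<otimes> r) (act (inv r) x) = act k x"
          using act_mult W(2) r Suc.prems(2) act_closed act_cancel by simp
        then have "act (inv r) x \<in> S e'"
          using S_act_iff[of "k \<otimes> r" e' "act (inv r) x"] * kx act_closed r Suc.prems(2) by simp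
        then show False using False * by simp
      qed
      have "reduced V" unfolding V_def reduced_append using W redy np by (auto simp: e'_def)
      moreover have "z \<in> X" "z \<notin> S (snd (last V))"
      proof -
        have "z \<in> X" "z \<notin> S (snd (last ((r, e) # w)))" using word_perm_normal[OF oky] by blast+
        moreover have "snd (last V) = snd (last ((r, e) # w))" by (simp add: V_def)
        ultimately show "z \<in> X" "z \<notin> S (snd (last V))" by simp_all
      qed
      ultimately have "length (fst (g y)) = length V"
        using reduced_length[of V z] gy by simp
      then have "length V = length (fst y)" using Suc.prems(6) by simp
      then show ?thesis using y ne by (simp add: V_def)
    qed
  qed
qed

lemma points_reach:
  assumes "y \<in> points"
  obtains h h' x where "h \<in> perms" "h' \<in> perms" "h \<circ> h' = id" "h' \<circ> h = id" "x \<in> X" "y = h ([], x)" "h =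
    word_perm (fst y)"
proof -
  have o: "normal_pt (fst y) (snd y)" using assms by (auto simp: points_def)
  note s = word_perm_normal[OF o]
  have "word_perm (fst y) \<in> perms" using s perms_word_perm by blast
  with perms_inverse obtain h' where "h' \<in> perms" "h' \<circ> word_perm (fst y) = id" "word_perm (fst y) \<circ> h'
    = id" by blast
  then show thesis using that[of "word_perm (fst y)" h' "snd y"] s \<open>word_perm (fst y) \<in> perms\<close> by auto
qed

text \<open>
  Every point is a translate of a point of \<open>X\<close>, so one of the two fixed points may be
  moved to \<open>X\<close>.
\<close>

theorem perms_two_fixed:
  assumes "g \<in> perms" "x \<in> points" "y \<in> points" "x \<noteq> y" "g x = x" "g y = y"
  shows "g = id"
proof -
  obtain h h' z where h: "h \<in> perms" "h' \<in> perms" "h \<circ> h' = id" "h' \<circ> h = id" "z \<in> X" "x = h ([], z)"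
    using points_reach[OF assms(2)] by metis
  have i: "h' (h u) = u" "h (h' u) = u" for u
    using fun_cong[OF h(3), of u] fun_cong[OF h(4), of u] by simp_all
  have "h' \<circ> g \<circ> h = id"
  proof (rule two_fixed_base_left)
    show "h' \<circ> g \<circ> h \<in> perms" using h assms(1) by (intro perms_comp)
    show "z \<in> X" by fact
    show "h' y \<in> points" using perms_points h(2) assms(3) by simp
    show "h' y \<noteq> ([], z)" using i h(6) assms(4) by metis
    show "(h' \<circ> g \<circ> h) ([], z) = ([], z)" using assms(5) h(6) i by simp
    show "(h' \<circ> g \<circ> h) (h' y) = h' y" using assms(6) i by simp
  qed
  then show ?thesis using conj_id h by blast
qed

text \<open>
  The square of an involution is the identity, so a nonempty reduced word for it has a
  pinch at the seam of its square. Conjugating by that seam removes two letters. The fixed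
  point is moved but remains in \<open>X\<close>, because the letter used is the first that acts on it.
\<close>

lemma base_involution:
  assumes noinv: "\<And>k x. k \<in> carrier K \<Longrightarrow> k \<otimes> k = \<one> \<Longrightarrow> x \<in> X \<Longrightarrow> act k x = x \<Longrightarrow> k = \<one>"
    and "reduced W" "k \<in> carrier K" "g = word_perm W \<circ> elem_perm k" "x \<in> X" "g ([], x) = ([], x)" "g \<circ> g
      = id"
  shows "g = id"
  using assms(2-)
proof (induction "length W" arbitrary: W k g x rule: less_induct)
  case less
  note k = less.prems(2)
  show ?case
  proof (cases W)
    case Nil
    then have g: "g = elem_perm k" using less.prems by simp
    then have "elem_perm (k \<otimes> k) = id" using less.prems by (simp add: elem_perm_mult)
    then have "k \<otimes> k = \<one>" using k elem_perm_inj[of "k \<otimes> k"] by simp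
    moreover have "act k x = x" using less.prems g by (simp add: elem_perm_base)
    ultimately have "k = \<one>" using noinv k less.prems(4) by blast
    then show ?thesis using g elem_perm_one by simp
  next
    case (Cons a V)
    obtain k1 e1 where a: "a = (k1, e1)" by (cases a)
    define e where "e = snd (last W)"
    have kx: "act k x \<in> S e" using fixes_base[OF less.prems(1,2,4)] less.prems(3,5) Cons
      by (simp add: e_def)
    have k1: "k1 \<in> carrier K" using less.prems(1) Cons a by simp
    have gg: "g \<circ> g = word_perm (W @ (k \<otimes> k1, e1) # V) \<circ> elem_perm k"
      unfolding less.prems(3) Cons a using elem_perm_mult[OF k k1]
        by (simp add: word_perm_append comp_assoc)
    have "\<not> reduced (W @ (k \<otimes> k1, e1) # V)"
    proof
      assume "reduced (W @ (k \<otimes> k1, e1) # V)"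
      from reduced_not_id[OF this _ k] gg less.prems(6) show False by simp
    qed
    then have pin: "e1 = (\<not> e)" "k \<otimes> k1 \<in> dom e"
      using less.prems(1) Cons a k k1 by (auto simp: reduced_append pinch_append e_def)
    have "V \<noteq> []" using pin e_def Cons a by auto
    then obtain U b where U: "V = U @ [b]" by (metis rev_exhaust)
    obtain k2 where b: "b = (k2, e)" using e_def Cons U by (cases b) auto
    define c where "c = th e (k \<otimes> k1)"
    have c: "c \<in> carrier K" using th_closed[OF pin(2)] dom_carrier by (auto simp: c_def)
    have k2: "k2 \<in> carrier K" "reduced U" using less.prems(1) Cons a U b by (auto simp: reduced_append)
    define h h' where "h = letter_perm e \<circ> elem_perm k" and "h' = elem_perm (inv k) \<circ> letter_perm (\<not> e)"
    have hh: "h \<circ> h' = id" "h' \<circ> h = id"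
      unfolding h_def h'_def using comp_inverse letter_perm_inv letter_perm_inv' elem_perm_inv[OF k]
        by blast+
    have "h \<circ> g \<circ> h' = letter_perm e \<circ> (elem_perm k \<circ> elem_perm k1) \<circ> letter_perm e1 \<circ> word_perm U \<circ>
      elem_perm k2 \<circ> (letter_perm e \<circ> (elem_perm k \<circ> elem_perm (inv k)) \<circ> letter_perm (\<not> e))"
      unfolding h_def h'_def less.prems(3) Cons a U b
        by (simp only: word_perm_append word_perm.simps comp_assoc id_comp)
    also have "\<dots> = (letter_perm e \<circ> elem_perm (k \<otimes> k1)) \<circ> letter_perm (\<not> e) \<circ> word_perm U \<circ> elem_perm
      k2"
      using elem_perm_inv[OF k] letter_perm_inv'[of e] elem_perm_mult[OF k k1] pin
        by (simp add: comp_assoc)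
    also have "\<dots> = elem_perm c \<circ> (letter_perm e \<circ> letter_perm (\<not> e)) \<circ> word_perm U \<circ> elem_perm k2"
      unfolding letter_perm_elem_perm[OF pin(2)] c_def by (simp only: comp_assoc)
    finally have conj: "h \<circ> g \<circ> h' = elem_perm c \<circ> word_perm U \<circ> elem_perm k2"
      by (simp add: letter_perm_inv')
    obtain U' k2' where U': "reduced U'" "k2' \<in> carrier K" "elem_perm c \<circ> word_perm U \<circ> elem_perm k2 =
      word_perm U' \<circ> elem_perm k2'" "length U' = length U"
    proof (cases U)
      case Nil
      then show thesis using that[of "[]" "c \<otimes> k2"] c k2 by (simp add: elem_perm_mult)
    next
      case (Cons d U1)
      obtain m e' where d: "d = (m, e')" by (cases d)
      show thesis using that[of "(c \<otimes> m, e') # U1" k2] c k2 Cons d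
        by (simp add: elem_perm_mult comp_assoc)
    qed
    have "h \<circ> g \<circ> h' = id"
    proof (rule less.hyps[OF _ U'(1,2)])
      show "length U' < length W" using Cons U U'(4) by simp
      show "h \<circ> g \<circ> h' = word_perm U' \<circ> elem_perm k2'" using conj U' by simp
      show "ph e (act k x) \<in> X" using ph_closed[OF kx] S_X by blast
      have hx: "h ([], x) = ([], ph e (act k x))" using kx less.prems(4)
        by (simp add: h_def elem_perm_base letter_perm_base)
      have "h' (h ([], x)) = ([], x)" using fun_cong[OF hh(2), of "([], x)"] by simp
      then show "(h \<circ> g \<circ> h') ([], ph e (act k x)) = ([], ph e (act k x))"
        using hx less.prems(5) by simp
      have "(h \<circ> g \<circ> h') \<circ> (h \<circ> g \<circ> h') = h \<circ> g \<circ> (h' \<circ> h) \<circ> g \<circ> h'" by (simp only: comp_assoc)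
      also have "\<dots> = h \<circ> (g \<circ> g) \<circ> h'" unfolding hh by (simp only: comp_id comp_assoc)
      also have "\<dots> = id" unfolding less.prems(6) using hh by simp
      finally show "(h \<circ> g \<circ> h') \<circ> (h \<circ> g \<circ> h') = id" .
    qed
    then show ?thesis using conj_id hh by blast
  qed
qed

theorem perms_involution:
  assumes noinv: "\<And>k x. k \<in> carrier K \<Longrightarrow> k \<otimes> k = \<one> \<Longrightarrow> x \<in> X \<Longrightarrow> act k x = x \<Longrightarrow> k = \<one>"
    and g: "g \<in> perms" "g \<circ> g = id" and x: "x \<in> points" "g x = x"
  shows "g = id"
proof -
  obtain h h' z where h: "h \<in> perms" "h' \<in> perms" "h \<circ> h' = id" "h' \<circ> h = id" "z \<in> X" "x = h ([], z)"
    using points_reach[OF x(1)] by metis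
  have "h' \<circ> g \<circ> h \<in> perms" using h g by (intro perms_comp)
  then obtain W k where W: "reduced W" "k \<in> carrier K" "h' \<circ> g \<circ> h = word_perm W \<circ> elem_perm k"
    using perms_reduced_word by blast
  have "h' \<circ> g \<circ> h = id"
  proof (rule base_involution[OF noinv W h(5)])
    have "h' (h ([], z)) = ([], z)" using fun_cong[OF h(4), of "([], z)"] by simp
    then show "(h' \<circ> g \<circ> h) ([], z) = ([], z)" using x h(6) by simp
    have "(h' \<circ> g \<circ> h) \<circ> (h' \<circ> g \<circ> h) = h' \<circ> g \<circ> (h \<circ> h') \<circ> g \<circ> h" by (simp only: comp_assoc)
    also have "\<dots> = h' \<circ> (g \<circ> g) \<circ> h" unfolding h by (simp only: comp_id comp_assoc)
    also have "\<dots> = id" unfolding g using h by simp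
    finally show "(h' \<circ> g \<circ> h) \<circ> (h' \<circ> g \<circ> h) = id" .
  qed
  then show ?thesis using conj_id h by blast
qed

lemma length_letter_perm: "length (fst y) \<le> length (fst (letter_perm e y)) + 1" "length
  (fst (letter_perm e y)) \<le> length (fst y) + 1"
  by (auto simp: letter_perm_def letter_move.simps)

lemma length_word_perm:
  "length (fst y) \<le> length (fst (word_perm W y)) + length W \<and>
    length (fst (word_perm W y)) \<le> length (fst y) + length W"
proof (induction W)
  case (Cons a W)
  obtain k e where a: "a = (k, e)" by (cases a)
  show ?case using Cons length_letter_perm[where e = e and y = "word_perm W y"]
    by (simp add: a length_elem_perm)
qed simp

lemma word_perm_power: "word_perm W ^^ j = word_perm (concat (replicate j W))"
  by (induction j) (auto simp: word_perm_append)

lemma reduced_power: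
  assumes "reduced (W @ W)" 
  shows "reduced (concat (replicate j W))"
proof (induction j)
  case (Suc j)
  then show ?case using assms by (cases j) (auto simp: reduced_append pinch_append)
qed simp

text \<open>
  If the letter is prescribed on no point, then point stabilisers are conjugate into \<open>K\<close>,
  so the powers of an element that fixes a point move a base point by a bounded distance.
  The powers of a cyclically reduced word move it by a distance proportional to the
  exponent.
\<close>

theorem cyclically_reduced_free:
  assumes S: "\<And>e. S e = {}" and W: "reduced (W @ W)" "W \<noteq> []" and y: "y \<in> points" and j: "j > 0"
  shows "(word_perm W ^^ j) y \<noteq> y"
proof
  assume fxd: "(word_perm W ^^ j) y = y"
  obtain h h' x where h: "h \<in> perms" "h' \<in> perms" "h \<circ> h' = id" "h' \<circ> h = id" "x \<in> X" "y = h ([], x)" "h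
    = word_perm (fst y)"
    using points_reach[OF y] by metis
  have i: "h' (h u) = u" "h (h' u) = u" for u
    using fun_cong[OF h(3), of u] fun_cong[OF h(4), of u] by simp_all
  define l where "l = length (fst y)"
  \<comment> \<open>The bound is \<open>2 l\<close>: one passage along the conjugating word in each direction.\<close>
  define m where "m = 2 * l + 1"
  define V where "V = concat (replicate (j * m) W)"
  have V: "reduced V" unfolding V_def using W(1) by (rule reduced_power)
  have sV: "word_perm V = (word_perm W ^^ j) ^^ m"
    by (simp add: V_def word_perm_power[symmetric] funpow_mult)
  have fixV: "word_perm V y = y"
    unfolding sV by (induction m) (auto simp: fxd)
  have zE: "h' \<circ> word_perm V \<circ> h \<in> perms" using h perms_word_perm[OF V] by (intro perms_comp)
  then obtain U k where U: "reduced U" "k \<in> carrier K" "h' \<circ> word_perm V \<circ> h = word_perm U \<circ> elem_perm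
    k"
    using perms_reduced_word by blast
  have "(h' \<circ> word_perm V \<circ> h) ([], x) = ([], x)" using fixV h(6) i by simp
  then have "U = []" using fixes_base[OF U(1,2) h(5)] U(3) S by auto
  then have z: "h' (word_perm V (h u)) = elem_perm k u" for u using fun_cong[OF U(3), of u] by simp
  have "word_perm V ([], x) = h (elem_perm k (h' ([], x)))" using z[of "h' ([], x)"] i by metis
  moreover have "length (fst (h' ([], x))) \<le> l"
    using length_word_perm[of "h' ([], x)" "fst y"] h(7) i(2)[of "([], x)"] by (simp add: l_def)
  ultimately have "length (fst (word_perm V ([], x))) \<le> 2 * l"
    using length_word_perm[where W = "fst y" and y = "elem_perm k (h' ([], x))"] h(7)
      by (simp add: l_def length_elem_perm)
  moreover have "length (fst (word_perm V ([], x))) = length V"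
    using reduced_length[OF V h(5)] S by auto
  moreover have "length V = j * m * length W" by (simp add: V_def length_concat sum_list_replicate)
  moreover have "m \<le> j * m * length W" using j W(2) by (cases j; cases W) auto
  ultimately show False by (simp add: m_def)
qed

section \<open>The extension as a group\<close>

definition ext :: "(('a \<times> bool) list \<times> 'x \<Rightarrow> ('a \<times> bool) list \<times> 'x) monoid" where
  "ext = \<lparr>carrier = perms, monoid.mult = (\<circ>), one = id\<rparr>"

definition perm_hom where "perm_hom g = (THE z. evaluates_to g z)"

lemma ext_simps [simp]: "carrier ext = perms" "x \<otimes>\<^bsub>ext\<^esub> y = x \<circ> y" "\<one>\<^bsub>ext\<^esub> = id"
  by (simp_all add: ext_def)

lemma group_ext: "group ext"
  by (rule groupI) (use perms_inverse in \<open>auto simp: perms_comp perms_id comp_assoc\<close>)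

lemma perm_hom_eq: "evaluates_to g z \<Longrightarrow> perm_hom g = z"
  unfolding perm_hom_def using evaluates_to_unique by blast

lemma perm_hom_hom: "perm_hom \<in> hom ext H"
proof (rule homI)
  fix x assume "x \<in> carrier ext"
  then show "perm_hom x \<in> carrier H" using perm_hom_eq evaluates_to_carrier by (auto simp: perms_def)
next
  fix x y assume "x \<in> carrier ext" "y \<in> carrier ext"
  then obtain z w where "evaluates_to x z" "evaluates_to y w" by (auto simp: perms_def)
  then show "perm_hom (x \<otimes>\<^bsub>ext\<^esub> y) = perm_hom x \<otimes>\<^bsub>H\<^esub> perm_hom y"
    using evaluates_to_comp perm_hom_eq by (metis ext_simps(2))
qed

lemma perm_hom_elem_perm: "k \<in> carrier K \<Longrightarrow> perm_hom (elem_perm k) = p k"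
  using evaluates_to_base perm_hom_eq by blast

lemma perm_hom_letter_perm: "perm_hom (letter_perm e) = \<one>\<^bsub>H\<^esub>"
  using evaluates_to_letter perm_hom_eq by blast

lemma elem_perm_hom: "elem_perm \<in> hom K ext"
  by (rule homI) (simp_all add: perms_elem_perm elem_perm_mult)

lemma elem_perm_inj_on: "inj_on elem_perm (carrier K)"
proof (rule inj_onI)
  fix k l assume kl: "k \<in> carrier K" "l \<in> carrier K" "elem_perm k = elem_perm l"
  then have "elem_perm (inv k \<otimes> l) = id" using elem_perm_inv[of l] elem_perm_mult[of "inv k" l]
    elem_perm_inv[of k] by simp
  then have "inv k \<otimes> l = \<one>" using kl elem_perm_inj by simp
  then show "k = l" using kl by (metis inv_equality inv_inv inv_closed)
qed

lemma countable_perms: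
  assumes "countable (carrier K)"
  shows "countable perms"
proof -
  let ?W = "lists (carrier K \<times> (UNIV :: bool set))"
  have c: "countable (?W \<times> carrier K)" using assms by (intro countable_SIGMA countable_lists) auto
  have "reduced W \<Longrightarrow> W \<in> ?W" for W by (induction W) auto
  note lists = this
  have "perms \<subseteq> (\<lambda>(W, k). word_perm W \<circ> elem_perm k) ` (?W \<times> carrier K)"
  proof
    fix g assume "g \<in> perms"
    then obtain W k where W: "reduced W" "k \<in> carrier K" "g = word_perm W \<circ> elem_perm k"
      by (rule perms_reduced_word)
    have "(W, k) \<in> ?W \<times> carrier K" using lists[OF W(1)] W(2) by blast
    moreover have "g = (\<lambda>(W, k). word_perm W \<circ> elem_perm k) (W, k)" by (simp only: case_prod_conv W(3))
    ultimately show "g \<in> (\<lambda>(W, k). word_perm W \<circ> elem_perm k) ` (?W \<times> carrier K)"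
      by (rule rev_image_eqI)
  qed
  then show ?thesis by (rule countable_subset[OF _ countable_image[OF c]])
qed

end

section \<open>Malnormal subgroups and the action on their cosets\<close>

definition (in group) cosets :: "'a set \<Rightarrow> 'a set" where
  "cosets A = {x \<in> carrier G. coset_rep A x = x}"

definition (in group) coset_act :: "'a set \<Rightarrow> 'a \<Rightarrow> 'a \<Rightarrow> 'a" where
  "coset_act A k x = coset_rep A (k \<otimes> x)"

text \<open>
  The situation that every stage of the construction satisfies. Malnormality of \<open>A\<close> says
  that pairs of distinct cosets have trivial stabilisers; absence of involutions in \<open>A\<close>
  says that involutions move every coset. Transitivity on pairs of cosets and simplicity
  of the kernel of \<open>p\<close> are achieved in the limit.
\<close>

locale admissible = group K + H: group H for K :: "'a monoid" (structure) and H :: "'h monoid" +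
  fixes A :: "'a set" and t :: 'a and p :: "'a \<Rightarrow> 'h"
  assumes A_subgroup: "subgroup A K"
    and A_malnormal: "g \<in> carrier K \<Longrightarrow> g \<notin> A \<Longrightarrow> a \<in> A \<Longrightarrow> g \<otimes> a \<otimes> inv g \<in> A \<Longrightarrow> a = \<one>"
    and A_involution: "a \<in> A \<Longrightarrow> a \<otimes> a = \<one> \<Longrightarrow> a = \<one>"
    and t_closed: "t \<in> carrier K" and t_A: "t \<notin> A" and t_t: "t \<otimes> t = \<one>"
    and p_hom: "p \<in> hom K H" and p_surj: "p ` carrier K = carrier H"
begin

abbreviation "X \<equiv> cosets A"
abbreviation "act \<equiv> coset_act A"

lemma X_carrier: "x \<in> X \<Longrightarrow> x \<in> carrier K" by (simp add: cosets_def)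

lemma coset_rep_X: "k \<in> carrier K \<Longrightarrow> coset_rep A k \<in> X"
  by (simp add: cosets_def coset_rep_closed coset_rep_coset_rep A_subgroup)

lemma one_X: "\<one> \<in> X"
  using coset_rep_eq_one_iff[OF A_subgroup] subgroup.one_closed[OF A_subgroup] by (simp add: cosets_def)

lemma act_coset_rep: "k \<in> carrier K \<Longrightarrow> l \<in> carrier K \<Longrightarrow> act k (coset_rep A l) = coset_rep A (k \<otimes> l)"
  by (simp add: coset_act_def coset_rep_mult_coset_rep A_subgroup)

lemma act_X: "k \<in> carrier K \<Longrightarrow> x \<in> X \<Longrightarrow> act k x \<in> X"
  by (simp add: coset_act_def X_carrier coset_rep_X)

lemma act_one: "x \<in> X \<Longrightarrow> act \<one> x = x"
  by (simp add: coset_act_def cosets_def)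

lemma act_mult:
  assumes "k \<in> carrier K" "l \<in> carrier K" "x \<in> X"
  shows "act (k \<otimes> l) x = act k (act l x)"
  using assms X_carrier act_coset_rep[of k "l \<otimes> x"] by (simp add: coset_act_def m_assoc)

lemma act_inj:
  assumes "k \<in> carrier K" "x \<in> X" "y \<in> X" "act k x = act k y"
  shows "x = y"
  using assms act_mult[of "inv k" k x] act_mult[of "inv k" k y] act_one by simp

lemma act_fixes_iff:
  assumes "k \<in> carrier K" "x \<in> X"
  shows "act k x = x \<longleftrightarrow> inv x \<otimes> k \<otimes> x \<in> A"
proof -
  have x: "x \<in> carrier K" "coset_rep A x = x" using assms by (auto simp: cosets_def)
  have "act k x = x \<longleftrightarrow> coset_rep A x = coset_rep A (k \<otimes> x)" using x by (auto simp: coset_act_def)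
  then show ?thesis using coset_rep_eq_iff[OF A_subgroup, of x "k \<otimes> x"] x assms by (simp add: m_assoc)
qed

lemma act_two_fixed:
  assumes k: "k \<in> carrier K" and x: "x \<in> X" "y \<in> X" "x \<noteq> y" and fx: "act k x = x" "act k y = y"
  shows "k = \<one>"
proof -
  have xy: "x \<in> carrier K" "y \<in> carrier K" using x X_carrier by auto
  define g where "g = inv x \<otimes> y"
  define a where "a = inv y \<otimes> k \<otimes> y"
  have a: "a \<in> A" using act_fixes_iff[OF k x(2)] fx by (simp add: a_def)
  have "coset_rep A x \<noteq> coset_rep A y" using x by (auto simp: cosets_def)
  then have g: "g \<notin> A" "g \<in> carrier K" using coset_rep_eq_iff[OF A_subgroup xy] xy
    by (simp_all add: g_def)
  have "g \<otimes> a \<otimes> inv g = inv x \<otimes> k \<otimes> x"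
    using xy k by (simp add: g_def a_def inv_mult_group m_assoc)
  then have "g \<otimes> a \<otimes> inv g \<in> A" using act_fixes_iff[OF k x(1)] fx by simp
  then have "a = \<one>" using A_malnormal g a by blast
  then have "y \<otimes> a \<otimes> inv y = \<one>" using xy by simp
  then show ?thesis using xy k by (simp add: a_def m_assoc)
qed

lemma act_involution:
  assumes k: "k \<in> carrier K" "k \<otimes> k = \<one>" and x: "x \<in> X" "act k x = x"
  shows "k = \<one>"
proof -
  have xK: "x \<in> carrier K" using x X_carrier by auto
  define a where "a = inv x \<otimes> k \<otimes> x"
  have a: "a \<in> A" using act_fixes_iff[OF k(1) x(1)] x by (simp add: a_def)
  have "k \<otimes> (k \<otimes> x) = x" using k xK by (simp flip: m_assoc)
  then have "a \<otimes> a = \<one>" using xK k(1) by (simp add: a_def m_assoc)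
  then have "a = \<one>" using A_involution a by blast
  then have "x \<otimes> a \<otimes> inv x = \<one>" using xK by simp
  then show ?thesis using xK k(1) by (simp add: a_def m_assoc)
qed

lemma coset_rep_t: "coset_rep A t \<in> X" "coset_rep A t \<noteq> \<one>"
  using coset_rep_X t_closed coset_rep_eq_one_iff[OF A_subgroup] t_A by auto

text \<open>
  For the action on cosets, only the conditions that concern the letter itself are left to
  be checked.
\<close>

lemma partial_letter_overI:
  fixes dom :: "bool \<Rightarrow> 'a set" and S :: "bool \<Rightarrow> 'a set"
  assumes "\<And>e. subgroup (dom e) K"
    and "\<And>c e. c \<in> dom e \<Longrightarrow> th e c \<in> dom (\<not> e)"
    and "\<And>c d e. c \<in> dom e \<Longrightarrow> d \<in> dom e \<Longrightarrow> th e (c \<otimes> d) = th e c \<otimes> th e d"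
    and "\<And>c e. c \<in> dom e \<Longrightarrow> th (\<not> e) (th e c) = c"
    and "\<And>c e x. c \<in> dom e \<Longrightarrow> x \<in> X \<Longrightarrow> act c x = x \<Longrightarrow> c = \<one>"
    and "\<And>e. S e \<subseteq> X"
    and "\<And>c e x. c \<in> dom e \<Longrightarrow> x \<in> S e \<Longrightarrow> act c x \<in> S e"
    and "\<And>e x. x \<in> S e \<Longrightarrow> ph e x \<in> S (\<not> e)"
    and "\<And>e x. x \<in> S e \<Longrightarrow> ph (\<not> e) (ph e x) = x"
    and "\<And>c e x. c \<in> dom e \<Longrightarrow> x \<in> S e \<Longrightarrow> ph e (act c x) = act (th e c) (ph e x)"
    and "\<And>e. \<exists>x\<in>X. x \<notin> S e"
    and "\<And>k x y. k \<in> carrier K \<Longrightarrow> x \<in> S True \<Longrightarrow> y \<in> S True \<Longrightarrow> x \<noteq> y \<Longrightarrow>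
      act k x \<in> S False \<Longrightarrow> act k y \<notin> S False"
    and "\<And>k x y. k \<in> carrier K \<Longrightarrow> x \<in> S True \<Longrightarrow> y \<in> S True \<Longrightarrow> x \<noteq> y \<Longrightarrow>
      act k x \<in> S True \<Longrightarrow> act k y \<in> S True \<Longrightarrow> k \<in> dom True"
    and "\<And>c e. c \<in> dom e \<Longrightarrow> p (th e c) = p c"
  shows "partial_letter_over K X act dom th S ph H p"
proof -
  have two: "\<exists>x\<in>X. \<exists>y\<in>X. x \<noteq> y" using one_X coset_rep_t by metis
  show ?thesis
    by (intro partial_letter_over.intro partial_letter.intro partial_letter_axioms.intro
      partial_letter_over_axioms.intro is_group H.is_group)
      (fact act_one act_mult two act_X act_two_fixed assms p_hom)+
qed

text \<open>
  With the stabiliser of the old base point as the new subgroup, malnormality is the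
  statement that only the unit fixes two points, and the condition on involutions is that
  none of them fixes a point.
\<close>

lemma admissible_ext:
  fixes dom :: "bool \<Rightarrow> 'a set" and S :: "bool \<Rightarrow> 'a set"
  assumes "partial_letter_over K X act dom th S ph H p"
  defines "L \<equiv> partial_letter_over.ext K X act dom th S ph H p"
    and "\<iota> \<equiv> partial_letter_over.elem_perm K X act dom th S"
  shows "admissible L H {g \<in> carrier L. g ([], \<one>) = ([], \<one>)} (\<iota> t)
    (partial_letter_over.perm_hom K X act dom th S ph H p)"
proof -
  interpret partial_letter_over K X act dom th S ph H p by fact
  let ?A = "{g \<in> carrier L. g ([], \<one>) = ([], \<one>)}"
  interpret L: group L unfolding L_def by (rule group_ext)
  have L: "carrier L = perms" "x \<otimes>\<^bsub>L\<^esub> y = x \<circ> y" "\<one>\<^bsub>L\<^esub> = id" for x y by (simp_all add: L_def)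
  have P1: "([], \<one>) \<in> points" using one_X by (rule base_points)
  have inv1: "(inv\<^bsub>L\<^esub> g) (g y) = y" "g ((inv\<^bsub>L\<^esub> g) y) = y" if "g \<in> carrier L" for g y
    using fun_cong[OF L.l_inv[OF that, unfolded L], of y]
      fun_cong[OF L.r_inv[OF that, unfolded L], of y]
    by simp_all
  have sub: "subgroup ?A L"
  proof (rule L.subgroupI)
    show "?A \<noteq> {}" using L.one_closed L(3) by auto
    show "inv\<^bsub>L\<^esub> a \<in> ?A" if "a \<in> ?A" for a
    proof -
      have "(inv\<^bsub>L\<^esub> a) (a ([], \<one>)) = ([], \<one>)" using that inv1 by blast
      then show ?thesis using that by simp
    qed
    show "a \<otimes>\<^bsub>L\<^esub> b \<in> ?A" if "a \<in> ?A" "b \<in> ?A" for a b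
      using that L.m_closed[of a b] by (simp add: L)
  qed auto
  show ?thesis
  proof (intro admissible.intro admissible_axioms.intro L.is_group H.is_group sub)
    fix g a assume g: "g \<in> carrier L" "g \<notin> ?A" "a \<in> ?A" "g \<otimes>\<^bsub>L\<^esub> a \<otimes>\<^bsub>L\<^esub> inv\<^bsub>L\<^esub> g \<in> ?A"
    define y where "y = (inv\<^bsub>L\<^esub> g) ([], \<one>)"
    have gE: "g \<in> perms" "inv\<^bsub>L\<^esub> g \<in> perms" using g L.inv_closed[of g] by (simp_all add: L)
    have "y \<noteq> ([], \<one>)" using g inv1[OF g(1)] unfolding y_def
      by (metis (mono_tags, lifting) mem_Collect_eq)
    moreover have "a y = y"
    proof -
      have "g (a y) = ([], \<one>)" using g(4) by (simp add: L y_def)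
      then show ?thesis using inv1(1)[OF g(1), of "a y"] by (simp add: y_def)
    qed
    moreover have "y \<in> points" using perms_points gE P1 by (simp add: y_def)
    ultimately show "a = \<one>\<^bsub>L\<^esub>" using perms_two_fixed[of a "([], \<one>)" y] g(3) P1 by (auto simp: L)
  next
    fix a assume a: "a \<in> ?A" "a \<otimes>\<^bsub>L\<^esub> a = \<one>\<^bsub>L\<^esub>"
    show "a = \<one>\<^bsub>L\<^esub>"
      unfolding L by (rule perms_involution[OF act_involution _ _ P1]) (use a in \<open>auto simp: L\<close>)
  next
    show "\<iota> t \<in> carrier L" unfolding \<iota>_def L by (rule perms_elem_perm) (rule t_closed)
    show "\<iota> t \<notin> ?A"
    proof -
      have "\<iota> t ([], \<one>) = ([], coset_rep A t)" unfolding \<iota>_def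
        using elem_perm_base[OF one_X, of t] t_closed by (simp add: coset_act_def)
      then show ?thesis using coset_rep_t by auto
    qed
    show "\<iota> t \<otimes>\<^bsub>L\<^esub> \<iota> t = \<one>\<^bsub>L\<^esub>"
      unfolding L \<iota>_def using elem_perm_mult[OF t_closed t_closed] t_t elem_perm_one by simp
    show "perm_hom \<in> hom L H" unfolding L_def by (rule perm_hom_hom)
    show "perm_hom ` carrier L = carrier H"
    proof
      show "perm_hom ` carrier L \<subseteq> carrier H" using \<open>perm_hom \<in> hom L H\<close> by (auto simp: hom_def)
      have "p k \<in> perm_hom ` carrier L" if "k \<in> carrier K" for k
        using perm_hom_elem_perm[OF that] perms_elem_perm[OF that] unfolding L by (metis imageI)
      then have "p ` carrier K \<subseteq> perm_hom ` carrier L" by blast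
      then show "carrier H \<subseteq> perm_hom ` carrier L" unfolding p_surj .
    qed
  qed
qed

end

section \<open>Extensions inside the natural numbers\<close>

text \<open>
  The extension lives on permutations of normal forms. It is copied back to the natural
  numbers so that the construction can be iterated without changing types.
\<close>

lemma admissible_iso:
  assumes "admissible L H B s q" and K: "group K" and \<nu>: "\<nu> \<in> iso L K"
    and q: "\<And>x. x \<in> carrier L \<Longrightarrow> q' (\<nu> x) = q x"
  shows "admissible K H (\<nu> ` B) (\<nu> s) q'"
proof -
  interpret L: admissible L H B s q by fact
  interpret K: group K by fact
  interpret nu: group_hom L K \<nu>
    using \<nu> by (unfold_locales) (auto simp: iso_def)
  have bij: "\<nu> ` carrier L = carrier K" and inj: "inj_on \<nu> (carrier L)"
    using \<nu> by (auto simp: iso_def bij_betw_def)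
  have BL: "B \<subseteq> carrier L" using L.A_subgroup by (rule subgroup.subset)
  have mem: "\<nu> x \<in> \<nu> ` B \<longleftrightarrow> x \<in> B" if "x \<in> carrier L" for x
    using inj_on_image_mem_iff[OF inj that BL] .
  have eq1: "\<nu> x = \<one>\<^bsub>K\<^esub> \<longleftrightarrow> x = \<one>\<^bsub>L\<^esub>" if "x \<in> carrier L" for x
    using inj_on_eq_iff[OF inj that L.one_closed] nu.hom_one by simp
  show ?thesis
  proof (intro admissible.intro admissible_axioms.intro K L.H.is_group)
    show "subgroup (\<nu> ` B) K" using nu.subgroup_img_is_subgroup[OF L.A_subgroup] .
  next
    fix g a assume g: "g \<in> carrier K" "g \<notin> \<nu> ` B" "a \<in> \<nu> ` B" "g \<otimes>\<^bsub>K\<^esub> a \<otimes>\<^bsub>K\<^esub> inv\<^bsub>K\<^esub> g \<in> \<nu> ` B"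
    obtain x where x: "x \<in> carrier L" "g = \<nu> x" using g(1) bij by auto
    obtain y where y: "y \<in> B" "a = \<nu> y" using g(3) by auto
    note xy = x y
    then have yL: "y \<in> carrier L" using BL by auto
    have "\<nu> (x \<otimes>\<^bsub>L\<^esub> y \<otimes>\<^bsub>L\<^esub> inv\<^bsub>L\<^esub> x) \<in> \<nu> ` B" using g(4) xy yL by simp
    moreover have "x \<otimes>\<^bsub>L\<^esub> y \<otimes>\<^bsub>L\<^esub> inv\<^bsub>L\<^esub> x \<in> carrier L" using xy yL by simp
    ultimately have "x \<otimes>\<^bsub>L\<^esub> y \<otimes>\<^bsub>L\<^esub> inv\<^bsub>L\<^esub> x \<in> B" using mem by blast
    then have "y = \<one>\<^bsub>L\<^esub>" using L.A_malnormal[of x y] xy g(2) by auto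
    then show "a = \<one>\<^bsub>K\<^esub>" using xy by simp
  next
    fix a assume a: "a \<in> \<nu> ` B" "a \<otimes>\<^bsub>K\<^esub> a = \<one>\<^bsub>K\<^esub>"
    then obtain y where y: "y \<in> B" "a = \<nu> y" by auto
    then have yL: "y \<in> carrier L" using BL by auto
    have "\<nu> (y \<otimes>\<^bsub>L\<^esub> y) = \<one>\<^bsub>K\<^esub>" using a y yL by simp
    then have "y \<otimes>\<^bsub>L\<^esub> y = \<one>\<^bsub>L\<^esub>" using eq1[of "y \<otimes>\<^bsub>L\<^esub> y"] yL by blast
    then show "a = \<one>\<^bsub>K\<^esub>" using L.A_involution[OF y(1)] y(2) nu.hom_one by simp
  next
    show "\<nu> s \<in> carrier K" "\<nu> s \<notin> \<nu> ` B" using L.t_closed L.t_A mem by auto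
    show "\<nu> s \<otimes>\<^bsub>K\<^esub> \<nu> s = \<one>\<^bsub>K\<^esub>" using L.t_closed L.t_t nu.hom_mult[of s s] by simp
    show "q' \<in> hom K H"
    proof (rule homI)
      fix x assume "x \<in> carrier K"
      then obtain y where "y \<in> carrier L" "x = \<nu> y" using bij by auto
      then show "q' x \<in> carrier H" using q L.p_hom by (auto simp: hom_def)
    next
      fix x y assume "x \<in> carrier K" "y \<in> carrier K"
      then obtain u v where uv: "u \<in> carrier L" "x = \<nu> u" "v \<in> carrier L" "y = \<nu> v"
        unfolding bij[symmetric] by blast
      have "q' (\<nu> (u \<otimes>\<^bsub>L\<^esub> v)) = q u \<otimes>\<^bsub>H\<^esub> q v"
        using uv q[of "u \<otimes>\<^bsub>L\<^esub> v"] hom_mult[OF L.p_hom, of u v] L.m_closed[of u v] by (metis (no_types))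
      then show "q' (x \<otimes>\<^bsub>K\<^esub> y) = q' x \<otimes>\<^bsub>H\<^esub> q' y" using uv q by simp
    qed
    show "q' ` carrier K = carrier H"
      unfolding bij[symmetric] L.p_surj[symmetric] image_image using q by auto
  qed
qed

definition extends :: "nat monoid \<Rightarrow> nat set \<Rightarrow> (nat \<Rightarrow> 'h) \<Rightarrow> nat monoid \<Rightarrow> nat set \<Rightarrow> (nat \<Rightarrow> 'h) \<Rightarrow> bool"
  where
  "extends K A p K' A' p' \<longleftrightarrow> carrier K \<subseteq> carrier K' \<and> A \<subseteq> A' \<and>
     (\<forall>x\<in>carrier K. \<forall>y\<in>carrier K. x \<otimes>\<^bsub>K'\<^esub> y = x \<otimes>\<^bsub>K\<^esub> y) \<and> (\<forall>x\<in>carrier K. p' x = p x)"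

text \<open>
  New elements are given numbers from every second unused place. The other half of the
  unused places remains free for later stages.
\<close>

lemma injection_with_room:
  fixes C :: "nat set" and D :: "'b set"
  assumes \<iota>: "inj_on \<iota> C" and sub: "\<iota> ` C \<subseteq> D" and D: "countable D" and C: "infinite (- C)"
  shows "\<exists>\<nu>. inj_on \<nu> D \<and> (\<forall>k\<in>C. \<nu> (\<iota> k) = k) \<and> infinite (- \<nu> ` D)"
proof -
  define u where "u = enumerate (- C)"
  have u: "u n \<notin> C" "u n = u m \<longleftrightarrow> n = m" for n m
    using enumerate_in_set[OF C, of n] strict_mono_eq[OF strict_mono_enumerate[OF C]]
      by (auto simp: u_def)
  define \<nu> where "\<nu> x = (if x \<in> \<iota> ` C then inv_into C \<iota> x else u (2 * to_nat_on D x))" for x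
  have 1: "\<nu> (\<iota> k) = k" if "k \<in> C" for k using that \<iota> by (simp add: \<nu>_def)
  have 2: "\<nu> x = u (2 * to_nat_on D x)" if "x \<notin> \<iota> ` C" for x using that by (simp add: \<nu>_def)
  have "inj_on \<nu> D"
  proof (rule inj_onI)
    fix x y assume xy: "x \<in> D" "y \<in> D" "\<nu> x = \<nu> y"
    consider (both) "x \<in> \<iota> ` C" "y \<in> \<iota> ` C" | (left) "x \<in> \<iota> ` C" "y \<notin> \<iota> ` C"
      | (right) "x \<notin> \<iota> ` C" "y \<in> \<iota> ` C" | (none) "x \<notin> \<iota> ` C" "y \<notin> \<iota> ` C" by blast
    then show "x = y"
    proof cases
      case both
      then show ?thesis using xy(3) 1 by auto
    next
      case left
      then have "\<nu> x \<in> C" using 1 by auto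
      then show ?thesis using xy(3) 2[OF left(2)] u(1) by metis
    next
      case right
      then have "\<nu> y \<in> C" using 1 by auto
      then show ?thesis using xy(3) 2[OF right(1)] u(1) by metis
    next
      case none
      then have "to_nat_on D x = to_nat_on D y" using xy(3) 2 u(2) by simp
      then show ?thesis using inj_on_to_nat_on[OF D] xy by (simp add: inj_on_eq_iff)
    qed
  qed
  moreover have "infinite (- \<nu> ` D)"
  proof -
    have "range (\<lambda>n. u (2 * n + 1)) \<subseteq> - \<nu> ` D"
    proof -
      have "\<nu> x \<noteq> u (2 * n + 1)" for x n
      proof (cases "x \<in> \<iota> ` C")
        case True
        then have "\<nu> x \<in> C" using 1 by auto
        then show ?thesis using u(1)[of "2 * n + 1"] by metis
      next
        case False
        have "2 * to_nat_on D x \<noteq> 2 * n + 1" by presburger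
        then show ?thesis using 2[OF False] u(2) by simp
      qed
      then have "u (2 * n + 1) \<notin> \<nu> ` D" for n by (metis imageE)
      then show ?thesis by (simp add: image_subset_iff)
    qed
    moreover have "infinite (range (\<lambda>n. u (2 * n + 1)))"
      by (rule range_inj_infinite) (auto simp: inj_on_def u)
    ultimately show ?thesis using infinite_super by blast
  qed
  ultimately show ?thesis using 1 by blast
qed

lemma transport_to_nat:
  assumes adm: "admissible K H A t p" and room: "infinite (- carrier K)"
    and L: "admissible L H B (\<iota> t) q" "countable (carrier L)"
    and \<iota>: "\<iota> \<in> hom K L" "inj_on \<iota> (carrier K)" "\<iota> ` A \<subseteq> B" "\<And>k. k \<in> carrier K \<Longrightarrow> q (\<iota> k) = p k"
  shows "\<exists>K' p' \<nu>. admissible K' H (\<nu> ` B) t p' \<and> infinite (- carrier K') \<and>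
    extends K A p K' (\<nu> ` B) p' \<and> \<nu> \<in> iso L K' \<and> (\<forall>k\<in>carrier K. \<nu> (\<iota> k) = k) \<and>
    (\<forall>x\<in>carrier L. p' (\<nu> x) = q x)"
proof -
  interpret K: admissible K H A t p by fact
  interpret L: admissible L H B "\<iota> t" q by fact
  have \<iota>L: "\<iota> ` carrier K \<subseteq> carrier L" using \<iota>(1) by (auto simp: hom_def)
  obtain \<nu> where \<nu>: "inj_on \<nu> (carrier L)" "\<And>k. k \<in> carrier K \<Longrightarrow> \<nu> (\<iota> k) = k"
    "infinite (- \<nu> ` carrier L)"
    using injection_with_room[OF \<iota>(2) \<iota>L L(2) room] by blast
  define K' where "K' = image_group \<nu> L"
  have gK: "group K'" unfolding K'_def using L.inj_imp_image_group_is_group[OF \<nu>(1)] .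
  have iso: "\<nu> \<in> iso L K'" unfolding K'_def using inj_imp_image_group_iso[OF \<nu>(1)] .
  define p' where "p' = q \<circ> inv_into (carrier L) \<nu>"
  have p': "p' (\<nu> x) = q x" if "x \<in> carrier L" for x using that \<nu>(1) by (simp add: p'_def)
  have adm': "admissible K' H (\<nu> ` B) t p'"
    using admissible_iso[OF L(1) gK iso p'] \<nu>(2)[OF K.t_closed] by simp
  have cK: "carrier K' = \<nu> ` carrier L" by (simp add: K'_def image_group_def)
  have sub: "carrier K \<subseteq> carrier K'"
  proof
    fix k assume "k \<in> carrier K"
    then show "k \<in> carrier K'" unfolding cK using \<nu>(2) \<iota>L by (metis image_eqI image_subset_iff)
  qed
  moreover have "A \<subseteq> \<nu> ` B"
  proof
    fix a assume a: "a \<in> A"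
    then have "\<nu> (\<iota> a) = a" using \<nu>(2) K.A_subgroup subgroup.mem_carrier by metis
    then show "a \<in> \<nu> ` B" using a \<iota>(3) by (metis image_eqI image_subset_iff)
  qed
  moreover have "x \<otimes>\<^bsub>K'\<^esub> y = x \<otimes>\<^bsub>K\<^esub> y" if "x \<in> carrier K" "y \<in> carrier K" for x y
  proof -
    have "\<nu> (\<iota> x \<otimes>\<^bsub>L\<^esub> \<iota> y) = \<nu> (\<iota> x) \<otimes>\<^bsub>K'\<^esub> \<nu> (\<iota> y)"
      using iso hom_mult[of \<nu> L K'] imageI[OF that(1), of \<iota>] imageI[OF that(2), of \<iota>] \<iota>L
      by (auto simp: iso_def)
    moreover have "\<iota> x \<otimes>\<^bsub>L\<^esub> \<iota> y = \<iota> (x \<otimes>\<^bsub>K\<^esub> y)" using \<iota>(1) that by (simp add: hom_def)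
    ultimately show ?thesis using \<nu>(2) that by simp
  qed
  moreover have "p' x = p x" if "x \<in> carrier K" for x
  proof -
    have "p' (\<nu> (\<iota> x)) = q (\<iota> x)" using p' that \<iota>L by blast
    then show ?thesis using \<nu>(2) \<iota>(4) that by simp
  qed
  ultimately have "extends K A p K' (\<nu> ` B) p'" by (simp add: extends_def)
  then show ?thesis using adm' \<nu>(2,3) iso p' cK by metis
qed

text \<open>
  Everything later stages need to know about adjoining a letter \<open>f\<close>: it has value \<open>\<one>\<close>, it
  conjugates and moves cosets as prescribed, and, when no coset was prescribed, the words
  \<open>k f l f\<^bsup>-1\<^esup>\<close> that are cyclically reduced have no power that fixes a coset.
\<close>

theorem letter_extension:
  fixes dom :: "bool \<Rightarrow> nat set" and S :: "bool \<Rightarrow> nat set"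
  assumes adm: "admissible K H A t p" and room: "infinite (- carrier K)"
    and letter: "partial_letter_over K (group.cosets K A) (group.coset_act K A) dom th S ph H p"
  obtains K' A' p' f where "admissible K' H A' t p'" and "infinite (- carrier K')"
    and "extends K A p K' A' p'" and "f \<in> carrier K'" and "p' f = \<one>\<^bsub>H\<^esub>"
    and "\<And>c. c \<in> dom True \<Longrightarrow> f \<otimes>\<^bsub>K'\<^esub> c = th True c \<otimes>\<^bsub>K'\<^esub> f"
    and "\<And>k l. k \<in> carrier K \<Longrightarrow> l \<in> carrier K \<Longrightarrow> group.coset_rep K A k \<in> S True \<Longrightarrow>
       ph True (group.coset_rep K A k) = group.coset_rep K A l \<Longrightarrow> \<exists>a\<in>A'. f \<otimes>\<^bsub>K'\<^esub> k = l \<otimes>\<^bsub>K'\<^esub> a"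
    and "\<And>k l j y a. \<forall>e. S e = {} \<Longrightarrow> k \<in> carrier K \<Longrightarrow> l \<in> carrier K \<Longrightarrow> k \<notin> dom False \<Longrightarrow>
       l \<notin> dom True \<Longrightarrow> j > 0 \<Longrightarrow> y \<in> carrier K' \<Longrightarrow> a \<in> A' \<Longrightarrow>
       (k \<otimes>\<^bsub>K'\<^esub> f \<otimes>\<^bsub>K'\<^esub> l \<otimes>\<^bsub>K'\<^esub> inv\<^bsub>K'\<^esub> f) [^]\<^bsub>K'\<^esub> (j::nat) \<otimes>\<^bsub>K'\<^esub> y \<noteq> y \<otimes>\<^bsub>K'\<^esub> a"
proof -
  interpret K: admissible K H A t p by fact
  interpret partial_letter_over K "K.X" "K.act" dom th S ph H p by fact
  define B where "B = {g \<in> carrier ext. g ([], \<one>\<^bsub>K\<^esub>) = ([], \<one>\<^bsub>K\<^esub>)}"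
  have B: "g \<in> B \<longleftrightarrow> g \<in> perms \<and> g ([], \<one>\<^bsub>K\<^esub>) = ([], \<one>\<^bsub>K\<^esub>)" for g by (simp add: B_def)
  have AK: "a \<in> A \<Longrightarrow> a \<in> carrier K" for a using K.A_subgroup subgroup.mem_carrier by metis
  have admL: "admissible ext H B (elem_perm t) perm_hom"
    using K.admissible_ext[OF letter] by (simp add: B_def)
  have AB: "elem_perm ` A \<subseteq> B"
  proof
    fix g assume "g \<in> elem_perm ` A"
    then obtain a where a: "a \<in> A" "g = elem_perm a" by auto
    then have "K.act a \<one>\<^bsub>K\<^esub> = \<one>\<^bsub>K\<^esub>"
      using AK K.coset_rep_eq_one_iff[OF K.A_subgroup] by (simp add: K.coset_act_def)
    then show "g \<in> B" using a elem_perm_base[OF K.one_X, of a] AK by (simp add: B perms_elem_perm)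
  qed
  have cE: "countable (carrier ext)" using countable_perms by simp
  obtain K' p' \<nu> where K': "admissible K' H (\<nu> ` B) t p'" "infinite (- carrier K')"
    "extends K A p K' (\<nu> ` B) p'" "\<nu> \<in> iso ext K'" "\<And>k. k \<in> carrier K \<Longrightarrow> \<nu> (elem_perm k) = k"
    "\<And>x. x \<in> perms \<Longrightarrow> p' (\<nu> x) = perm_hom x"
    using transport_to_nat[where \<iota> = elem_perm, OF adm room admL cE elem_perm_hom elem_perm_inj_on AB
      perm_hom_elem_perm] by auto
  interpret K': admissible K' H "\<nu> ` B" t p' by fact
  interpret L: group ext by (rule group_ext)
  interpret nu: group_hom ext K' \<nu> using K'(4) by unfold_locales (auto simp: iso_def)
  have nm: "\<nu> (x \<circ> y) = \<nu> x \<otimes>\<^bsub>K'\<^esub> \<nu> y" if "x \<in> perms" "y \<in> perms" for x y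
    using nu.hom_mult[of x y] that by simp
  have inj: "\<nu> x = \<nu> y \<longleftrightarrow> x = y" if "x \<in> perms" "y \<in> perms" for x y
    using K'(4) that by (auto simp: iso_def bij_betw_def inj_on_def)
  have invf: "inv\<^bsub>ext\<^esub> (letter_perm True) = letter_perm False"
    by (rule L.inv_equality) (use letter_perm_inv[of True] in \<open>simp_all add: perms_letter_perm\<close>)
  define f where "f = \<nu> (letter_perm True)"
  have fc: "f \<in> carrier K'" unfolding f_def using nu.hom_closed[of "letter_perm True"] perms_letter_perm
    by simp
  have "p' f = \<one>\<^bsub>H\<^esub>" unfolding f_def using K'(6)[OF perms_letter_perm] perm_hom_letter_perm by simp
  moreover have "f \<otimes>\<^bsub>K'\<^esub> c = th True c \<otimes>\<^bsub>K'\<^esub> f" if c: "c \<in> dom True" for c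
  proof -
    have cK: "c \<in> carrier K" "th True c \<in> carrier K" using c th_closed[OF c] dom_carrier by blast+
    have "\<nu> (letter_perm True \<circ> elem_perm c) = \<nu> (elem_perm (th True c) \<circ> letter_perm True)"
      using letter_perm_elem_perm[OF c] by simp
    then show ?thesis using nm perms_letter_perm perms_elem_perm cK K'(5) by (simp add: f_def)
  qed
  moreover have "\<exists>a\<in>\<nu> ` B. f \<otimes>\<^bsub>K'\<^esub> k = l \<otimes>\<^bsub>K'\<^esub> a"
    if kl: "k \<in> carrier K" "l \<in> carrier K" "K.coset_rep A k \<in> S True" "ph True (K.coset_rep A k) =
      K.coset_rep A l" for k l
  proof -
    define b where "b = elem_perm (inv\<^bsub>K\<^esub> l) \<circ> letter_perm True \<circ> elem_perm k"
    have bE: "b \<in> perms" unfolding b_def using kl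
      by (intro perms_comp perms_elem_perm perms_letter_perm) auto
    have "b ([], \<one>\<^bsub>K\<^esub>) = ([], K.act (inv\<^bsub>K\<^esub> l) (K.coset_rep A l))"
      using kl K.coset_rep_X by (simp add: b_def elem_perm_base K.one_X K.coset_act_def
        letter_perm_base)
    also have "K.act (inv\<^bsub>K\<^esub> l) (K.coset_rep A l) = K.coset_rep A \<one>\<^bsub>K\<^esub>" using kl
      by (simp add: K.act_coset_rep)
    also have "\<dots> = \<one>\<^bsub>K\<^esub>" using K.one_X by (simp add: K.cosets_def)
    finally have "b \<in> B" using bE by (simp add: B)
    moreover have "elem_perm l \<circ> b = letter_perm True \<circ> elem_perm k"
      using elem_perm_inv[OF kl(2)] by (simp add: b_def flip: comp_assoc)
    then have "\<nu> (elem_perm l \<circ> b) = \<nu> (letter_perm True \<circ> elem_perm k)" by simp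
    then have "f \<otimes>\<^bsub>K'\<^esub> k = l \<otimes>\<^bsub>K'\<^esub> \<nu> b" using nm perms_letter_perm perms_elem_perm kl K'(5) bE
      by (simp add: f_def)
    ultimately show ?thesis by blast
  qed
  moreover have "(k \<otimes>\<^bsub>K'\<^esub> f \<otimes>\<^bsub>K'\<^esub> l \<otimes>\<^bsub>K'\<^esub> inv\<^bsub>K'\<^esub> f) [^]\<^bsub>K'\<^esub> (j::nat) \<otimes>\<^bsub>K'\<^esub> y \<noteq> y \<otimes>\<^bsub>K'\<^esub> a"
    if S: "\<forall>e. S e = {}" and kl: "k \<in> carrier K" "l \<in> carrier K" "k \<notin> dom False" "l \<notin> dom True"
      and j: "j > 0" and y: "y \<in> carrier K'" and a: "a \<in> \<nu> ` B" for k l j y a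
  proof
    assume eq: "(k \<otimes>\<^bsub>K'\<^esub> f \<otimes>\<^bsub>K'\<^esub> l \<otimes>\<^bsub>K'\<^esub> inv\<^bsub>K'\<^esub> f) [^]\<^bsub>K'\<^esub> (j::nat) \<otimes>\<^bsub>K'\<^esub> y = y \<otimes>\<^bsub>K'\<^esub> a"
    define W where "W = [(k, True), (l, False)]"
    have W: "reduced (W @ W)" "W \<noteq> []" using kl by (auto simp: W_def)
    have sW: "word_perm W = elem_perm k \<circ> letter_perm True \<circ> elem_perm l \<circ> letter_perm False"
      by (simp add: W_def comp_assoc)
    have WE: "word_perm W \<in> perms" using W reduced_append perms_word_perm by blast
    obtain v where v: "v \<in> perms" "y = \<nu> v" using y K'(4) by (auto simp: iso_def bij_betw_def)
    obtain b where b: "b \<in> B" "a = \<nu> b" using a by auto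
    have "\<nu> (letter_perm False) = inv\<^bsub>K'\<^esub> f" unfolding f_def invf[symmetric] using perms_letter_perm
      by simp
    then have "k \<otimes>\<^bsub>K'\<^esub> f \<otimes>\<^bsub>K'\<^esub> l \<otimes>\<^bsub>K'\<^esub> inv\<^bsub>K'\<^esub> f = \<nu> (word_perm W)"
      unfolding sW using kl K'(5) by (simp add: nm perms_comp perms_elem_perm perms_letter_perm f_def)
    moreover have "word_perm W [^]\<^bsub>ext\<^esub> n = word_perm W ^^ n" for n :: nat
    proof (induction n)
      case (Suc n)
      then show ?case using funpow_Suc_right[of n "word_perm W"] by simp
    qed simp
    moreover have "\<nu> (word_perm W) [^]\<^bsub>K'\<^esub> j = \<nu> (word_perm W [^]\<^bsub>ext\<^esub> j)"
      using nu.hom_nat_pow[of "word_perm W" j] WE by simp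
    moreover have pE: "word_perm W [^]\<^bsub>ext\<^esub> j \<in> perms" using L.nat_pow_closed[of "word_perm W" j] WE
      by simp
    ultimately have "\<nu> (word_perm W ^^ j \<circ> v) = \<nu> (v \<circ> b)" using eq v b nm B by simp
    then have "word_perm W ^^ j \<circ> v = v \<circ> b"
      using inj[of "word_perm W ^^ j \<circ> v" "v \<circ> b"] pE \<open>\<And>n. word_perm W [^]\<^bsub>ext\<^esub> n = word_perm W ^^ n\<close> v
        b B perms_comp by simp
    then have "(word_perm W ^^ j \<circ> v) ([], \<one>\<^bsub>K\<^esub>) = v ([], \<one>\<^bsub>K\<^esub>)" using b B by simp
    moreover have "v ([], \<one>\<^bsub>K\<^esub>) \<in> points" using perms_points[OF v(1)] base_points[OF K.one_X] by simp
    ultimately show False using cyclically_reduced_free[OF S[rule_format] W _ j, of "v ([], \<one>\<^bsub>K\<^esub>)"]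
      by simp
  qed
  ultimately show thesis using that[OF K'(1-3) fc] by blast
qed

lemma extends_refl: "extends K A p K A p"
  by (simp add: extends_def)

lemma extends_trans:
  assumes "extends K A p K' A' p'" "extends K' A' p' K'' A'' p''"
  shows "extends K A p K'' A'' p''"
  using assms unfolding extends_def by (auto simp: subset_iff)

lemma extends_one:
  assumes "extends K A p K' A' p'" "group K" "group K'"
  shows "\<one>\<^bsub>K'\<^esub> = \<one>\<^bsub>K\<^esub>"
proof -
  interpret K: group K by fact
  interpret K': group K' by fact
  have "\<one>\<^bsub>K\<^esub> \<in> carrier K'" "\<one>\<^bsub>K\<^esub> \<otimes>\<^bsub>K'\<^esub> \<one>\<^bsub>K\<^esub> = \<one>\<^bsub>K\<^esub>" using assms(1) by (auto simp: extends_def)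
  then show ?thesis by simp
qed

lemma extends_inv:
  assumes "extends K A p K' A' p'" "group K" "group K'" "x \<in> carrier K"
  shows "inv\<^bsub>K'\<^esub> x = inv\<^bsub>K\<^esub> x"
proof -
  interpret K: group K by fact
  interpret K': group K' by fact
  have "inv\<^bsub>K\<^esub> x \<otimes>\<^bsub>K'\<^esub> x = \<one>\<^bsub>K'\<^esub>" "x \<in> carrier K'" "inv\<^bsub>K\<^esub> x \<in> carrier K'"
    using assms(1,4) extends_one[OF assms(1-3)] K.inv_closed[OF assms(4)] by (auto simp: extends_def)
  then show ?thesis by (rule K'.inv_equality)
qed

context admissible
begin

lemma p_one': "p \<one> = \<one>\<^bsub>H\<^esub>"
  using hom_one[OF p_hom is_group H.is_group] .

text \<open>
  This is how the oddness of the index enters: all involutions lie in the kernel of \<open>p\<close>,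
  so a letter may conjugate any one of them to any other.
\<close>

lemma p_involution:
  assumes "\<And>h. h \<in> carrier H \<Longrightarrow> h \<otimes>\<^bsub>H\<^esub> h = \<one>\<^bsub>H\<^esub> \<Longrightarrow> h = \<one>\<^bsub>H\<^esub>" "s \<in> carrier K" "s \<otimes> s = \<one>"
  shows "p s = \<one>\<^bsub>H\<^esub>"
  using assms p_hom p_one' by (metis hom_in_carrier hom_mult)

section \<open>Three letters\<close>

text \<open>
  A letter that fixes the coset \<open>A\<close> and maps the coset \<open>q True\<close> to \<open>q False\<close>. If an
  involution \<open>d True\<close> swaps \<open>A\<close> and \<open>q True\<close>, then the letter has to conjugate it to the
  involution \<open>d False\<close> that swaps \<open>A\<close> and \<open>q False\<close>. The choice \<open>d = (\<lambda>e. \<one>)\<close> covers the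
  case of a pair that nothing swaps.
\<close>

lemma pair_letter:
  assumes q: "\<And>e. q e \<in> X" "\<And>e. q e \<noteq> \<one>"
    and d: "\<And>e. d e \<in> carrier K" "\<And>e. d e \<otimes> d e = \<one>" "\<And>e. p (d e) = \<one>\<^bsub>H\<^esub>"
    and d1: "\<And>e. d e = \<one> \<Longrightarrow> d (\<not> e) = \<one>"
    and flip: "\<And>e. d e \<noteq> \<one> \<Longrightarrow> act (d e) \<one> = q e \<and> act (d e) (q e) = \<one>"
    and cross: "\<And>k. k \<in> carrier K \<Longrightarrow> act k \<one> = \<one> \<Longrightarrow> act k (q True) \<noteq> q False"
      "\<And>k. k \<in> carrier K \<Longrightarrow> act k \<one> = q False \<Longrightarrow> act k (q True) \<noteq> \<one>"
    and stab: "\<And>k. k \<in> carrier K \<Longrightarrow> act k \<one> = q True \<Longrightarrow> act k (q True) = \<one> \<Longrightarrow> k = d True"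
  shows "partial_letter_over K X act (\<lambda>e. {\<one>, d e}) (\<lambda>e c. if c = \<one> then \<one> else d (\<not> e))
    (\<lambda>e. {\<one>, q e}) (\<lambda>e x. if x = \<one> then \<one> else q (\<not> e)) H p"
proof (rule partial_letter_overI)
  note a1 = act_one
  fix e
  have invd: "inv (d e) = d e" using d inv_equality by blast
  show "subgroup {\<one>, d e} K" using d invd by (intro subgroupI) auto
  show "\<exists>x\<in>X. x \<notin> {\<one>, q e}"
  proof (intro bexI)
    have "q True \<noteq> q False" using cross(1)[of \<one>] a1 one_X q by auto
    then show "q (\<not> e) \<notin> {\<one>, q e}" using q by (cases e) auto
  qed (rule q)
  fix c assume c: "c \<in> {\<one>, d e}"
  show "p (if c = \<one> then \<one> else d (\<not> e)) = p c" using c d p_one' by auto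
  show "(if c = \<one> then \<one> else d (\<not> e)) \<in> {\<one>, d (\<not> e)}" by auto
  show "(if (if c = \<one> then \<one> else d (\<not> e)) = \<one> then \<one> else d (\<not> \<not> e)) = c"
    using c d1[of "\<not> e"] by auto
  show "c = \<one>" if "x \<in> X" "act c x = x" for x
    using act_involution[of c x] that c d by auto
  show "(if c \<otimes> d' = \<one> then \<one> else d (\<not> e)) = (if c = \<one> then \<one> else d (\<not> e)) \<otimes>
    (if d' = \<one> then \<one> else d (\<not> e))"
    if "d' \<in> {\<one>, d e}" for d' using c that d by auto
  fix x assume x: "x \<in> {\<one>, q e}"
  show "act c x \<in> {\<one>, q e}" using x c flip[of e] a1 one_X q by (cases "d e = \<one>") auto
  show "(if act c x = \<one> then \<one> else q (\<not> e)) = act (if c = \<one> then \<one> else d (\<not> e))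
    (if x = \<one> then \<one> else q (\<not> e))"
  proof (cases "d e = \<one>")
    case True
    then show ?thesis using x c a1 one_X q by auto
  next
    case False
    moreover from False have "d (\<not> e) \<noteq> \<one>" using d1[of "\<not> e"] by auto
    ultimately show ?thesis using x c flip[of e] flip[of "\<not> e"] a1 one_X q(1) q(2)[of e] q(2)[of "\<not> e"]
      by (cases "x = \<one>") auto
  qed
next
  fix e x assume x: "x \<in> {\<one>, q e}"
  then show "(if x = \<one> then \<one> else q (\<not> e)) \<in> {\<one>, q (\<not> e)}" by auto
  show "(if (if x = \<one> then \<one> else q (\<not> e)) = \<one> then \<one> else q (\<not> \<not> e)) = x" using x q by auto
next
  fix k x y assume k: "k \<in> carrier K" and xy: "x \<in> {\<one>, q True}" "y \<in> {\<one>, q True}" "x \<noteq> y"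
  have ne: "act k x \<noteq> act k y"
  proof
    assume *: "act k x = act k y"
    have "x \<in> X" "y \<in> X" using xy q one_X by auto
    then show False using act_inj[OF k] * xy by blast
  qed
  show "act k y \<notin> {\<one>, q False}" if "act k x \<in> {\<one>, q False}"
    using that ne xy cross k by auto
  show "k \<in> {\<one>, d True}" if "act k x \<in> {\<one>, q True}" "act k y \<in> {\<one>, q True}"
  proof -
    have "(act k \<one> = \<one> \<and> act k (q True) = q True) \<or> (act k \<one> = q True \<and> act k (q True) = \<one>)"
      using that ne xy by auto
    then show ?thesis using act_two_fixed[OF k one_X q(1)[of True]] q(2)[of True] stab[OF k] by auto
  qed
qed (use q one_X in auto)

text \<open>
  An element no positive power of which lies in a conjugate of \<open>A\<close>, that is, fixes a
  coset. In particular its order is infinite.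
\<close>

definition free_elt :: "'a \<Rightarrow> bool" where
  "free_elt u \<longleftrightarrow> u \<in> carrier K \<and> (\<forall>j>0. \<forall>y\<in>carrier K. \<forall>a\<in>A. u [^] (j::nat) \<otimes> y \<noteq> y \<otimes> a)"

lemma free_elt_int_pow:
  assumes u: "free_elt u" and x: "x \<in> X" and fx: "act (u [^] (i::int)) x = x"
  shows "i = 0"
proof (rule ccontr)
  assume i: "i \<noteq> 0"
  have uK: "u \<in> carrier K" using u by (simp add: free_elt_def)
  have xK: "x \<in> carrier K" using x X_carrier by auto
  define c where "c = u [^] i"
  have cK: "c \<in> carrier K" using uK by (simp add: c_def)
  define a where "a = inv x \<otimes> c \<otimes> x"
  have a: "a \<in> A" using act_fixes_iff[OF cK x] fx by (simp add: a_def c_def)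
  then have ia: "inv a \<in> A" using A_subgroup subgroup.m_inv_closed by metis
  show False
  proof (cases "i > 0")
    case True
    then obtain j where j: "i = int j" "j > 0" using pos_int_cases by blast
    have "u [^] j \<otimes> x = x \<otimes> a" using uK xK j cK by (simp add: a_def c_def int_pow_int m_assoc)
    then show False using u j xK a by (auto simp: free_elt_def)
  next
    case False
    then obtain j where j: "i = - int j" "j > 0" using i
      by (metis linorder_neqE_linordered_idom neg_int_cases)
    have c: "inv c = u [^] j" using uK j by (simp add: c_def int_pow_neg int_pow_int)
    have "inv a = inv x \<otimes> inv c \<otimes> x" using xK cK by (simp add: a_def inv_mult_group m_assoc)
    then have "u [^] j \<otimes> x = x \<otimes> inv a" using uK xK c by (simp add: m_assoc)
    then show False using u j xK ia by (auto simp: free_elt_def)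
  qed
qed

lemma free_elt_inj:
  assumes u: "free_elt u"
  shows "inj (\<lambda>i::int. u [^] i)"
proof (rule injI)
  fix i j :: int assume e: "u [^] i = u [^] j"
  have uK: "u \<in> carrier K" using u by (simp add: free_elt_def)
  have "u [^] (i - j) = \<one>" using uK e by (simp add: int_pow_diff)
  then have "act (u [^] (i - j)) \<one> = \<one>" using one_X by (simp add: coset_act_def cosets_def)
  then have "i - j = 0" using free_elt_int_pow[OF u one_X] by blast
  then show "i = j" by simp
qed

text \<open>
  Two elements whose powers fix no coset can be made conjugate without identifying any
  cosets: the infinite cyclic groups that they generate act freely, which is all that is
  asked of associated subgroups when no coset is prescribed.
\<close>

lemma conj_letter:
  assumes u: "\<And>e. free_elt (u e)" "\<And>e. p (u e) = \<one>\<^bsub>H\<^esub>"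
  shows "partial_letter_over K X act (\<lambda>e. range (\<lambda>i::int. u e [^] i))
    (\<lambda>e c. u (\<not> e) [^] (inv_into UNIV (\<lambda>i::int. u e [^] i) c)) (\<lambda>e. {}) (\<lambda>e x. x) H p"
proof -
  have uK: "u e \<in> carrier K" for e using u by (simp add: free_elt_def)
  have iv [simp]: "inv_into UNIV (\<lambda>i::int. u e [^] i) (u e [^] i) = i" for e and i :: int
    using inv_f_f[OF free_elt_inj[OF u(1)]] by blast
  have pu: "p (u e [^] i) = \<one>\<^bsub>H\<^esub>" for e and i :: int
  proof -
    interpret hm: group_hom K H p using p_hom by unfold_locales
    show ?thesis using hm.hom_int_pow[OF uK, of e i] u by simp
  qed
  show ?thesis
  proof (rule partial_letter_overI)
    fix e
    show "subgroup (range (\<lambda>i::int. u e [^] i)) K"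
    proof (rule subgroupI)
      fix a b assume "a \<in> range (\<lambda>i::int. u e [^] i)" "b \<in> range (\<lambda>i::int. u e [^] i)"
      then obtain i j :: int where "a = u e [^] i" "b = u e [^] j" by blast
      then have "a \<otimes> b = u e [^] (i + j)" using uK by (simp add: int_pow_mult)
      then show "a \<otimes> b \<in> range (\<lambda>i::int. u e [^] i)" by blast
    next
      fix a assume "a \<in> range (\<lambda>i::int. u e [^] i)"
      then obtain i :: int where "a = u e [^] i" by blast
      then have "inv a = u e [^] (- i)" using uK by (simp add: int_pow_neg)
      then show "inv a \<in> range (\<lambda>i::int. u e [^] i)" by blast
    qed (use uK in auto)
    show "\<exists>x\<in>X. x \<notin> {}" using one_X by auto
    fix c assume "c \<in> range (\<lambda>i::int. u e [^] i)"
    then obtain i :: int where c: "c = u e [^] i" by blast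
    show "u (\<not> e) [^] inv_into UNIV (\<lambda>i::int. u e [^] i) c \<in> range (\<lambda>i::int. u (\<not> e) [^] i)" by blast
    show "u (\<not> \<not> e) [^] inv_into UNIV (\<lambda>i::int. u (\<not> e) [^] i)
      (u (\<not> e) [^] inv_into UNIV (\<lambda>i::int. u e [^] i) c) = c"
      unfolding c iv by simp
    show "p (u (\<not> e) [^] inv_into UNIV (\<lambda>i::int. u e [^] i) c) = p c" unfolding c pu ..
    show "c = \<one>" if "x \<in> X" "act c x = x" for x
      using free_elt_int_pow[OF u(1) that(1)] that(2) c by fastforce
    fix d assume "d \<in> range (\<lambda>i::int. u e [^] i)"
    then obtain j :: int where d: "d = u e [^] j" by blast
    have *: "c \<otimes> d = u e [^] (i + j)" using c d uK by (simp add: int_pow_mult)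
    show "u (\<not> e) [^] inv_into UNIV (\<lambda>i::int. u e [^] i) (c \<otimes> d) =
      u (\<not> e) [^] inv_into UNIV (\<lambda>i::int. u e [^] i) c \<otimes> u (\<not> e) [^] inv_into UNIV (\<lambda>i::int. u e [^] i)
        d"
      unfolding * unfolding c d iv by (simp add: int_pow_mult uK)
  qed auto
qed

lemma free_letter: "partial_letter_over K X act (\<lambda>e. {\<one>}) (\<lambda>e c. c) (\<lambda>e. {}) (\<lambda>e x. x) H p"
proof (rule partial_letter_overI)
  show "subgroup {\<one>} K" using triv_subgroup .
qed (use one_X in auto)

end

text \<open>
  The element \<open>v\<close> enters \<open>A t A\<close> as soon as some element of the point stabiliser moves the
  coset of \<open>v\<close> to the coset of \<open>t\<close>. The letter of \<open>pair_letter\<close> does so. Since \<open>t\<close> swaps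
  the base coset with its own coset, the letter must respect an involution that swaps the
  base coset with that of \<open>v\<close>, should there be one.
\<close>

theorem double_coset_extension:
  assumes adm: "admissible K H A t p" and room: "infinite (- carrier K)"
    and H2: "\<And>h. h \<in> carrier H \<Longrightarrow> h \<otimes>\<^bsub>H\<^esub> h = \<one>\<^bsub>H\<^esub> \<Longrightarrow> h = \<one>\<^bsub>H\<^esub>"
    and v: "v \<in> carrier K" "v \<notin> A"
  shows "\<exists>K' A' p'. admissible K' H A' t p' \<and> infinite (- carrier K') \<and> extends K A p K' A' p' \<and>
    (\<exists>a\<in>A'. \<exists>b\<in>A'. a \<otimes>\<^bsub>K'\<^esub> v = t \<otimes>\<^bsub>K'\<^esub> b)"
proof (cases "\<exists>a\<in>A. \<exists>b\<in>A. a \<otimes>\<^bsub>K\<^esub> v = t \<otimes>\<^bsub>K\<^esub> b")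
  case True
  then show ?thesis using adm room extends_refl by blast
next
  case False
  interpret K: admissible K H A t p by fact
  define q where "q e = K.coset_rep A (if e then v else t)" for e
  have q: "q e \<in> K.X" "q e \<noteq> \<one>\<^bsub>K\<^esub>" for e
    using v K.coset_rep_X K.coset_rep_t K.coset_rep_eq_one_iff[OF K.A_subgroup] by (auto simp: q_def)
  have a1: "K.act k \<one>\<^bsub>K\<^esub> = K.coset_rep A k" if "k \<in> carrier K" for k using that
    by (simp add: K.coset_act_def)
  have cross1: "K.act k (q True) \<noteq> q False" if k: "k \<in> carrier K" "K.act k \<one>\<^bsub>K\<^esub> = \<one>\<^bsub>K\<^esub>" for k
  proof
    assume *: "K.act k (q True) = q False"
    have k_in: "k \<in> A" using k a1 K.coset_rep_eq_one_iff[OF K.A_subgroup] by simp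
    have "K.coset_rep A t = K.coset_rep A (k \<otimes>\<^bsub>K\<^esub> v)"
      using * k v K.act_coset_rep[of k v] by (simp add: q_def)
    then have "inv\<^bsub>K\<^esub> t \<otimes>\<^bsub>K\<^esub> (k \<otimes>\<^bsub>K\<^esub> v) \<in> A"
      using K.coset_rep_eq_iff[OF K.A_subgroup] K.t_closed k v by simp
    moreover have "k \<otimes>\<^bsub>K\<^esub> v = t \<otimes>\<^bsub>K\<^esub> (inv\<^bsub>K\<^esub> t \<otimes>\<^bsub>K\<^esub> (k \<otimes>\<^bsub>K\<^esub> v))" using K.t_closed k v by simp
    ultimately show False using False k_in by blast
  qed
  have actt: "K.act t (q False) = \<one>\<^bsub>K\<^esub>" "K.act t \<one>\<^bsub>K\<^esub> = q False"
    using K.act_coset_rep[of t t] K.t_closed K.t_t K.one_X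
      by (simp_all add: q_def K.coset_act_def K.cosets_def)
  note am = K.act_mult
  have cross2: "K.act k (q True) \<noteq> \<one>\<^bsub>K\<^esub>" if k: "k \<in> carrier K" "K.act k \<one>\<^bsub>K\<^esub> = q False" for k
  proof
    assume "K.act k (q True) = \<one>\<^bsub>K\<^esub>"
    then have "K.act (t \<otimes>\<^bsub>K\<^esub> k) (q True) = q False" "K.act (t \<otimes>\<^bsub>K\<^esub> k) \<one>\<^bsub>K\<^esub> = \<one>\<^bsub>K\<^esub>"
      using am[OF K.t_closed k(1)] k actt q K.one_X by auto
    then show False using cross1[of "t \<otimes>\<^bsub>K\<^esub> k"] K.t_closed k by auto
  qed
  have flip_unique: "k = l"
    if "k \<in> carrier K" "K.act k \<one>\<^bsub>K\<^esub> = q True" "K.act k (q True) = \<one>\<^bsub>K\<^esub>"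
       "l \<in> carrier K" "K.act l \<one>\<^bsub>K\<^esub> = q True" "K.act l (q True) = \<one>\<^bsub>K\<^esub>" "l \<otimes>\<^bsub>K\<^esub> l = \<one>\<^bsub>K\<^esub>" for k l
  proof -
    have "l \<otimes>\<^bsub>K\<^esub> k = \<one>\<^bsub>K\<^esub>"
      by (rule K.act_two_fixed[OF _ K.one_X q(1)[of True] q(2)[symmetric]])
        (use that am K.one_X q in auto)
    then show "k = l" using that by (metis K.inv_equality K.inv_inv K.inv_closed)
  qed
  have "\<exists>dom th. partial_letter_over K K.X K.act dom th
    (\<lambda>e. {\<one>\<^bsub>K\<^esub>, q e}) (\<lambda>e x. if x = \<one>\<^bsub>K\<^esub> then \<one>\<^bsub>K\<^esub> else q (\<not> e)) H p"
  proof (cases "\<exists>s\<in>carrier K. K.act s \<one>\<^bsub>K\<^esub> = q True \<and> K.act s (q True) = \<one>\<^bsub>K\<^esub>")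
    case True
    then obtain s where s: "s \<in> carrier K" "K.act s \<one>\<^bsub>K\<^esub> = q True" "K.act s (q True) = \<one>\<^bsub>K\<^esub>" by blast
    have ss: "s \<otimes>\<^bsub>K\<^esub> s = \<one>\<^bsub>K\<^esub>"
      by (rule K.act_two_fixed[OF _ K.one_X q(1)[of True] q(2)[symmetric]])
        (use s am K.one_X q in auto)
    have "s \<noteq> \<one>\<^bsub>K\<^esub>" using s(2) a1[OF K.one_closed] K.one_X q(2)[of True] by (auto simp: K.cosets_def)
    moreover have "t \<noteq> \<one>\<^bsub>K\<^esub>" using K.t_A subgroup.one_closed[OF K.A_subgroup] by auto
    moreover define d where "d e = (if e then s else t)" for e
    ultimately have dne: "d e \<noteq> \<one>\<^bsub>K\<^esub>" for e by simp
    have d: "d e \<in> carrier K" "d e \<otimes>\<^bsub>K\<^esub> d e = \<one>\<^bsub>K\<^esub>" for e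
      using s ss K.t_closed K.t_t by (simp_all add: d_def)
    have flip: "K.act (d e) \<one>\<^bsub>K\<^esub> = q e \<and> K.act (d e) (q e) = \<one>\<^bsub>K\<^esub>" for e
      using s actt by (cases e) (simp_all add: d_def)
    have stab: "k = d True" if "k \<in> carrier K" "K.act k \<one>\<^bsub>K\<^esub> = q True" "K.act k (q True) = \<one>\<^bsub>K\<^esub>" for k
      using flip_unique[OF that, of "d True"] d flip[of True] by blast
    have "partial_letter_over K K.X K.act (\<lambda>e. {\<one>\<^bsub>K\<^esub>, d e})
      (\<lambda>e c. if c = \<one>\<^bsub>K\<^esub> then \<one>\<^bsub>K\<^esub> else d (\<not> e))
      (\<lambda>e. {\<one>\<^bsub>K\<^esub>, q e}) (\<lambda>e x. if x = \<one>\<^bsub>K\<^esub> then \<one>\<^bsub>K\<^esub> else q (\<not> e)) H p"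
      by (rule K.pair_letter[OF q d K.p_involution[OF H2 d] _ flip cross1 cross2 stab])
        (use dne in auto)
    then show ?thesis by blast
  next
    case nf: False
    have "partial_letter_over K K.X K.act (\<lambda>e. {\<one>\<^bsub>K\<^esub>, \<one>\<^bsub>K\<^esub>})
      (\<lambda>e c. if c = \<one>\<^bsub>K\<^esub> then \<one>\<^bsub>K\<^esub> else \<one>\<^bsub>K\<^esub>)
      (\<lambda>e. {\<one>\<^bsub>K\<^esub>, q e}) (\<lambda>e x. if x = \<one>\<^bsub>K\<^esub> then \<one>\<^bsub>K\<^esub> else q (\<not> e)) H p"
      by (rule K.pair_letter[where d = "\<lambda>e. \<one>\<^bsub>K\<^esub>", OF q _ _ _ _ _ cross1 cross2])
        (use nf K.p_one' in auto)
    then show ?thesis by blast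
  qed
  then obtain dom th where pl: "partial_letter_over K K.X K.act dom th
    (\<lambda>e. {\<one>\<^bsub>K\<^esub>, q e}) (\<lambda>e x. if x = \<one>\<^bsub>K\<^esub> then \<one>\<^bsub>K\<^esub> else q (\<not> e)) H p" by blast
  obtain K' A' p' f where K': "admissible K' H A' t p'" "infinite (- carrier K')" "extends K A p K' A'
    p'"
    "f \<in> carrier K'"
    "\<And>k l. k \<in> carrier K \<Longrightarrow> l \<in> carrier K \<Longrightarrow> K.coset_rep A k \<in> {\<one>\<^bsub>K\<^esub>, q True} \<Longrightarrow>
      (if K.coset_rep A k = \<one>\<^bsub>K\<^esub> then \<one>\<^bsub>K\<^esub> else q (\<not> True)) = K.coset_rep A l \<Longrightarrow>
        \<exists>a\<in>A'. f \<otimes>\<^bsub>K'\<^esub> k = l \<otimes>\<^bsub>K'\<^esub> a"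
    by (rule letter_extension[OF adm room pl]) (rule that)
  interpret K': admissible K' H A' t p' by fact
  have rep1: "K.coset_rep A \<one>\<^bsub>K\<^esub> = \<one>\<^bsub>K\<^esub>" using K.one_X by (simp add: K.cosets_def)
  have "\<exists>a\<in>A'. f \<otimes>\<^bsub>K'\<^esub> \<one>\<^bsub>K\<^esub> = \<one>\<^bsub>K\<^esub> \<otimes>\<^bsub>K'\<^esub> a" by (rule K'(5)) (simp_all add: rep1)
  then have "f \<in> A'" using extends_one[OF K'(3) K.is_group K'.is_group, symmetric] K'(4)
      subgroup.mem_carrier[OF K'.A_subgroup] by auto
  moreover have "\<exists>a\<in>A'. f \<otimes>\<^bsub>K'\<^esub> v = t \<otimes>\<^bsub>K'\<^esub> a"
    by (rule K'(5)) (use v K.t_closed q(2)[of True] in \<open>simp_all add: q_def\<close>)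
  ultimately show ?thesis using K'(1-3) by blast
qed

text \<open>
  Let \<open>b\<close> be a new free letter. Then \<open>u = h b h\<^bsup>-1\<^esup> b\<^bsup>-1\<^esup>\<close> and \<open>g u = (g h) b h\<^bsup>-1\<^esup> b\<^bsup>-1\<^esup>\<close>
  are both cyclically reduced, the latter because \<open>g h\<close> is nontrivial, so a further letter
  \<open>f\<close> may conjugate one to the other. As \<open>u\<close> lies in the normal closure of \<open>h\<close>, so does \<open>g
  = f u f\<^bsup>-1\<^esup> u\<^bsup>-1\<^esup>\<close>, and the conjugating elements lie in the kernel.
\<close>

theorem normal_closure_extension:
  assumes adm: "admissible K H A t p" and room: "infinite (- carrier K)"
    and h: "h \<in> carrier K" "h \<noteq> \<one>\<^bsub>K\<^esub>" "p h = \<one>\<^bsub>H\<^esub>" and g: "g \<in> carrier K" "p g = \<one>\<^bsub>H\<^esub>"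
    and gh: "g \<otimes>\<^bsub>K\<^esub> h \<noteq> \<one>\<^bsub>K\<^esub>"
  shows "\<exists>K' A' p'. admissible K' H A' t p' \<and> infinite (- carrier K') \<and> extends K A p K' A' p' \<and>
    (\<exists>b\<in>carrier K'. \<exists>f\<in>carrier K'. p' b = \<one>\<^bsub>H\<^esub> \<and> p' f = \<one>\<^bsub>H\<^esub> \<and>
      f \<otimes>\<^bsub>K'\<^esub> (h \<otimes>\<^bsub>K'\<^esub> b \<otimes>\<^bsub>K'\<^esub> inv\<^bsub>K'\<^esub> h \<otimes>\<^bsub>K'\<^esub> inv\<^bsub>K'\<^esub> b) =
      g \<otimes>\<^bsub>K'\<^esub> (h \<otimes>\<^bsub>K'\<^esub> b \<otimes>\<^bsub>K'\<^esub> inv\<^bsub>K'\<^esub> h \<otimes>\<^bsub>K'\<^esub> inv\<^bsub>K'\<^esub> b) \<otimes>\<^bsub>K'\<^esub> f)"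
proof -
  interpret K: admissible K H A t p by fact
  obtain K1 A1 p1 b where K1: "admissible K1 H A1 t p1" "infinite (- carrier K1)" "extends K A p K1 A1
    p1"
    "b \<in> carrier K1" "p1 b = \<one>\<^bsub>H\<^esub>"
    and free: "\<And>k l j y a. \<forall>e::bool. ({}::nat set) = {} \<Longrightarrow> k \<in> carrier K \<Longrightarrow> l \<in> carrier K \<Longrightarrow> k \<notin> {\<one>\<^bsub>K\<^esub>} \<Longrightarrow>
      l \<notin> {\<one>\<^bsub>K\<^esub>} \<Longrightarrow> 0 < j \<Longrightarrow>
      y \<in> carrier K1 \<Longrightarrow> a \<in> A1 \<Longrightarrow>
      (k \<otimes>\<^bsub>K1\<^esub> b \<otimes>\<^bsub>K1\<^esub> l \<otimes>\<^bsub>K1\<^esub> inv\<^bsub>K1\<^esub> b) [^]\<^bsub>K1\<^esub> (j::nat) \<otimes>\<^bsub>K1\<^esub> y \<noteq> y \<otimes>\<^bsub>K1\<^esub> a"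
    by (rule letter_extension[OF adm room K.free_letter]) (rule that)
  interpret K1: admissible K1 H A1 t p1 by fact
  interpret hm: group_hom K1 H p1 using K1.p_hom by unfold_locales
  have cK: "x \<in> carrier K1" if "x \<in> carrier K" for x using that K1(3) by (auto simp: extends_def)
  have iv: "inv\<^bsub>K1\<^esub> h = inv\<^bsub>K\<^esub> h" using extends_inv[OF K1(3) K.is_group K1.is_group h(1)] .
  have pp: "p1 x = p x" if "x \<in> carrier K" for x using that K1(3) by (auto simp: extends_def)
  \<comment> \<open>The commutator of \<open>h\<close> and \<open>b\<close> is \<open>w h\<close>, and its product with \<open>g\<close> is \<open>w (g h)\<close>.\<close>
  define w where "w k = k \<otimes>\<^bsub>K1\<^esub> b \<otimes>\<^bsub>K1\<^esub> inv\<^bsub>K1\<^esub> h \<otimes>\<^bsub>K1\<^esub> inv\<^bsub>K1\<^esub> b" for k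
  have w: "K1.free_elt (w k)" if "k \<in> carrier K" "k \<noteq> \<one>\<^bsub>K\<^esub>" for k
    using free[OF allI[OF refl], of k "inv\<^bsub>K\<^esub> h"] that h cK[OF that(1)] cK[OF K.inv_closed[OF h(1)]]
      K1(4)
    by (auto simp: K1.free_elt_def w_def iv)
  have word_hom: "p1 (w k) = \<one>\<^bsub>H\<^esub>" if "k \<in> carrier K" "p k = \<one>\<^bsub>H\<^esub>" for k
    using that cK h K1(4,5) pp by (simp add: w_def)
  have gh': "g \<otimes>\<^bsub>K1\<^esub> h = g \<otimes>\<^bsub>K\<^esub> h" using K1(3) g h by (auto simp: extends_def)
  have pgh: "p (g \<otimes>\<^bsub>K\<^esub> h) = \<one>\<^bsub>H\<^esub>" using g h hom_mult[OF K.p_hom] by simp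
  define u where "u e = w (if e then h else g \<otimes>\<^bsub>K\<^esub> h)" for e
  have u: "K1.free_elt (u e)" "p1 (u e) = \<one>\<^bsub>H\<^esub>" for e
    using w[OF h(1,2)] w[OF _ gh] word_hom[OF h(1,3)] word_hom[OF _ pgh] h g by (simp_all add: u_def)
  obtain K' A' p' f where K': "admissible K' H A' t p'" "infinite (- carrier K')" "extends K1 A1 p1 K'
    A' p'"
    "f \<in> carrier K'" "p' f = \<one>\<^bsub>H\<^esub>"
    "\<And>c. c \<in> range (\<lambda>i::int. u True [^]\<^bsub>K1\<^esub> i) \<Longrightarrow>
      f \<otimes>\<^bsub>K'\<^esub> c = (u (\<not> True) [^]\<^bsub>K1\<^esub> (inv_into UNIV (\<lambda>i::int. u True [^]\<^bsub>K1\<^esub> i) c)) \<otimes>\<^bsub>K'\<^esub> f"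
    by (rule letter_extension[OF K1(1,2) K1.conj_letter[of u, OF u]]) (rule that)
  interpret K': admissible K' H A' t p' by fact
  have uK: "u e \<in> carrier K1" for e using u by (simp add: K1.free_elt_def)
  have pow1: "x [^]\<^bsub>K1\<^esub> (1::int) = x" if "x \<in> carrier K1" for x using that by simp
  have "inv_into UNIV (\<lambda>i::int. u True [^]\<^bsub>K1\<^esub> i) (u True [^]\<^bsub>K1\<^esub> (1::int)) = 1"
    using inv_f_f[OF K1.free_elt_inj[OF u(1)]] by blast
  moreover have "u True [^]\<^bsub>K1\<^esub> (1::int) \<in> range (\<lambda>i::int. u True [^]\<^bsub>K1\<^esub> i)" by blast
  ultimately have conj: "f \<otimes>\<^bsub>K'\<^esub> u True = u False \<otimes>\<^bsub>K'\<^esub> f"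
    using K'(6)[of "u True [^]\<^bsub>K1\<^esub> (1::int)"] uK pow1 by simp
  have mult: "x \<otimes>\<^bsub>K1\<^esub> y = x \<otimes>\<^bsub>K'\<^esub> y" if "x \<in> carrier K1" "y \<in> carrier K1" for x y
    using that K'(3) by (auto simp: extends_def)
  have inv: "inv\<^bsub>K1\<^esub> x = inv\<^bsub>K'\<^esub> x" if "x \<in> carrier K1" for x
    using extends_inv[OF K'(3) K1.is_group K'.is_group that] by simp
  have c': "x \<in> carrier K'" if "x \<in> carrier K1" for x using that K'(3) by (auto simp: extends_def)
  have 1: "u True = h \<otimes>\<^bsub>K'\<^esub> b \<otimes>\<^bsub>K'\<^esub> inv\<^bsub>K'\<^esub> h \<otimes>\<^bsub>K'\<^esub> inv\<^bsub>K'\<^esub> b"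
    using cK[OF h(1)] K1(4) by (simp add: u_def w_def flip: mult inv)
  have "u False = g \<otimes>\<^bsub>K1\<^esub> u True"
    using cK[OF h(1)] cK[OF g(1)] K1(4) by (simp add: u_def w_def gh'[symmetric] K1.m_assoc)
  then have 2: "u False = g \<otimes>\<^bsub>K'\<^esub> u True" using mult cK[OF g(1)] uK by simp
  have "p' b = \<one>\<^bsub>H\<^esub>" using K'(3) K1(4,5) by (auto simp: extends_def)
  then have "\<exists>b\<in>carrier K'. \<exists>f\<in>carrier K'. p' b = \<one>\<^bsub>H\<^esub> \<and> p' f = \<one>\<^bsub>H\<^esub> \<and>
      f \<otimes>\<^bsub>K'\<^esub> (h \<otimes>\<^bsub>K'\<^esub> b \<otimes>\<^bsub>K'\<^esub> inv\<^bsub>K'\<^esub> h \<otimes>\<^bsub>K'\<^esub> inv\<^bsub>K'\<^esub> b) =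
      g \<otimes>\<^bsub>K'\<^esub> (h \<otimes>\<^bsub>K'\<^esub> b \<otimes>\<^bsub>K'\<^esub> inv\<^bsub>K'\<^esub> h \<otimes>\<^bsub>K'\<^esub> inv\<^bsub>K'\<^esub> b) \<otimes>\<^bsub>K'\<^esub> f"
    using conj K'(4,5) c'[OF K1(4)] unfolding 2 unfolding 1 by blast
  then show ?thesis using K'(1,2) extends_trans[OF K1(3) K'(3)] by blast
qed

section \<open>The limit of the construction\<close>

definition dcoset :: "nat monoid \<Rightarrow> nat set \<Rightarrow> nat \<Rightarrow> nat \<Rightarrow> bool" where
  "dcoset K A t v \<longleftrightarrow> (\<exists>a\<in>A. \<exists>b\<in>A. a \<otimes>\<^bsub>K\<^esub> v = t \<otimes>\<^bsub>K\<^esub> b)"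

text \<open>
  A certificate that \<open>g\<close> lies in the normal closure of \<open>h\<close> in the kernel of \<open>p\<close>. It is an
  equation between finitely many elements and therefore survives in every extension.
\<close>

definition conj_commutator :: "nat monoid \<Rightarrow> ('h, 'i) monoid_scheme \<Rightarrow> (nat \<Rightarrow> 'h) \<Rightarrow> nat \<Rightarrow> nat \<Rightarrow> bool"
  where
  "conj_commutator K H p h g \<longleftrightarrow> (\<exists>b\<in>carrier K. \<exists>f\<in>carrier K. p b = \<one>\<^bsub>H\<^esub> \<and> p f = \<one>\<^bsub>H\<^esub> \<and>
      f \<otimes>\<^bsub>K\<^esub> (h \<otimes>\<^bsub>K\<^esub> b \<otimes>\<^bsub>K\<^esub> inv\<^bsub>K\<^esub> h \<otimes>\<^bsub>K\<^esub> inv\<^bsub>K\<^esub> b) =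
      g \<otimes>\<^bsub>K\<^esub> (h \<otimes>\<^bsub>K\<^esub> b \<otimes>\<^bsub>K\<^esub> inv\<^bsub>K\<^esub> h \<otimes>\<^bsub>K\<^esub> inv\<^bsub>K\<^esub> b) \<otimes>\<^bsub>K\<^esub> f)"

lemma dcoset_extends:
  assumes "admissible K H A t p" "extends K A p K' A' p'" "v \<in> carrier K" "dcoset K A t v"
  shows "dcoset K' A' t v"
proof -
  interpret K: admissible K H A t p by fact
  obtain a b where ab: "a \<in> A" "b \<in> A" "a \<otimes>\<^bsub>K\<^esub> v = t \<otimes>\<^bsub>K\<^esub> b" using assms(4) by (auto simp: dcoset_def)
  then have "a \<in> carrier K" "b \<in> carrier K" using K.A_subgroup subgroup.mem_carrier by metis+
  then have "a \<otimes>\<^bsub>K'\<^esub> v = t \<otimes>\<^bsub>K'\<^esub> b" using assms(2,3) ab K.t_closed by (simp add: extends_def)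
  moreover have "a \<in> A'" "b \<in> A'" using ab assms(2) by (auto simp: extends_def)
  ultimately show ?thesis by (auto simp: dcoset_def)
qed

lemma conj_commutator_extends:
  assumes K: "group K" "group K'" and e: "extends K A p K' A' p'"
    and hg: "h \<in> carrier K" "g \<in> carrier K" and c: "conj_commutator K H p h g"
  shows "conj_commutator K' H p' h g"
proof -
  interpret K: group K by fact
  obtain b f where bf: "b \<in> carrier K" "f \<in> carrier K" "p b = \<one>\<^bsub>H\<^esub>" "p f = \<one>\<^bsub>H\<^esub>"
    "f \<otimes>\<^bsub>K\<^esub> (h \<otimes>\<^bsub>K\<^esub> b \<otimes>\<^bsub>K\<^esub> inv\<^bsub>K\<^esub> h \<otimes>\<^bsub>K\<^esub> inv\<^bsub>K\<^esub> b) =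
      g \<otimes>\<^bsub>K\<^esub> (h \<otimes>\<^bsub>K\<^esub> b \<otimes>\<^bsub>K\<^esub> inv\<^bsub>K\<^esub> h \<otimes>\<^bsub>K\<^esub> inv\<^bsub>K\<^esub> b) \<otimes>\<^bsub>K\<^esub> f"
    using c by (auto simp: conj_commutator_def)
  have mult: "x \<otimes>\<^bsub>K'\<^esub> y = x \<otimes>\<^bsub>K\<^esub> y" if "x \<in> carrier K" "y \<in> carrier K" for x y
    using e that by (simp add: extends_def)
  have inv: "inv\<^bsub>K'\<^esub> x = inv\<^bsub>K\<^esub> x" if "x \<in> carrier K" for x
    using extends_inv[OF e K that] .
  have "p' b = \<one>\<^bsub>H\<^esub>" "p' f = \<one>\<^bsub>H\<^esub>" "b \<in> carrier K'" "f \<in> carrier K'"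
    using e bf by (auto simp: extends_def)
  then show ?thesis unfolding conj_commutator_def using bf hg
    by (intro bexI[of _ b] bexI[of _ f]) (simp_all add: mult inv)
qed

lemma step_extension:
  assumes adm: "admissible K H A t p" and room: "infinite (- carrier K)"
    and H2: "\<And>h. h \<in> carrier H \<Longrightarrow> h \<otimes>\<^bsub>H\<^esub> h = \<one>\<^bsub>H\<^esub> \<Longrightarrow> h = \<one>\<^bsub>H\<^esub>"
  shows "\<exists>K' A' p'. admissible K' H A' t p' \<and> infinite (- carrier K') \<and> extends K A p K' A' p' \<and>
    (x \<in> carrier K \<longrightarrow> x \<notin> A \<longrightarrow> dcoset K' A' t x) \<and>
    (x \<in> carrier K \<longrightarrow> y \<in> carrier K \<longrightarrow> x \<noteq> \<one>\<^bsub>K\<^esub> \<longrightarrow> p x = \<one>\<^bsub>H\<^esub> \<longrightarrow> p y = \<one>\<^bsub>H\<^esub> \<longrightarrow>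
      y \<otimes>\<^bsub>K\<^esub> x \<noteq> \<one>\<^bsub>K\<^esub> \<longrightarrow> conj_commutator K' H p' x y)"
proof -
  interpret K: admissible K H A t p by fact
  have "\<exists>K1 A1 p1. admissible K1 H A1 t p1 \<and> infinite (- carrier K1) \<and> extends K A p K1 A1 p1 \<and>
    (x \<in> carrier K \<longrightarrow> x \<notin> A \<longrightarrow> dcoset K1 A1 t x)"
  proof (cases "x \<in> carrier K \<and> x \<notin> A")
    case True
    then show ?thesis using double_coset_extension[OF adm room H2, of x] unfolding dcoset_def by blast
  next
    case False
    then show ?thesis using adm room extends_refl by blast
  qed
  then obtain K1 A1 p1 where K1: "admissible K1 H A1 t p1" "infinite (- carrier K1)" "extends K A p K1
    A1 p1"
    "x \<in> carrier K \<longrightarrow> x \<notin> A \<longrightarrow> dcoset K1 A1 t x" by blast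
  interpret K1: admissible K1 H A1 t p1 by fact
  show ?thesis
  proof (cases "x \<in> carrier K \<and> y \<in> carrier K \<and> x \<noteq> \<one>\<^bsub>K\<^esub> \<and> p x = \<one>\<^bsub>H\<^esub> \<and> p y = \<one>\<^bsub>H\<^esub> \<and> y \<otimes>\<^bsub>K\<^esub> x \<noteq> \<one>\<^bsub>K\<^esub>")
    case False
    then show ?thesis using K1 by blast
  next
    case True
    have one: "\<one>\<^bsub>K1\<^esub> = \<one>\<^bsub>K\<^esub>" using extends_one[OF K1(3) K.is_group K1.is_group] .
    have "x \<in> carrier K1" "y \<in> carrier K1" "x \<noteq> \<one>\<^bsub>K1\<^esub>" "p1 x = \<one>\<^bsub>H\<^esub>" "p1 y = \<one>\<^bsub>H\<^esub>" "y \<otimes>\<^bsub>K1\<^esub> x \<noteq> \<one>\<^bsub>K1\<^esub>"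
      using True K1(3) unfolding one by (auto simp: extends_def)
    then obtain K2 A2 p2 where K2: "admissible K2 H A2 t p2" "infinite (- carrier K2)" "extends K1 A1 p1
      K2 A2 p2"
      "conj_commutator K2 H p2 x y"
      using normal_closure_extension[OF K1(1,2), of x y] unfolding conj_commutator_def by blast
    have "x \<in> carrier K \<longrightarrow> x \<notin> A \<longrightarrow> dcoset K2 A2 t x"
      using K1(4) dcoset_extends[OF K1(1) K2(3) \<open>x \<in> carrier K1\<close>] by blast
    then show ?thesis using K2 extends_trans[OF K1(3) K2(3)] by blast
  qed
qed

text \<open>
  All conditions on an admissible group involve finitely many elements at a time, hence
  pass to unions. The product of two elements is computed at the first stage that contains
  both.
\<close>

lemma union_of_chain:
  fixes K :: "nat \<Rightarrow> nat monoid"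
  assumes adm: "\<And>i. admissible (K i) H (A i) t (p i)"
    and ext: "\<And>i. extends (K i) (A i) (p i) (K (Suc i)) (A (Suc i)) (p (Suc i))"
  obtains G B q where "admissible G H B t q" and "\<And>i. extends (K i) (A i) (p i) G B q"
    and "carrier G = (\<Union>i. carrier (K i))" and "B = (\<Union>i. A i)"
proof -
  have mono: "extends (K i) (A i) (p i) (K j) (A j) (p j)" if "i \<le> j" for i j
    using that
  proof (induction j rule: dec_induct)
    case base
    show ?case by (rule extends_refl)
  next
    case (step j)
    from extends_trans[OF step(3) ext] show ?case .
  qed
  note ex = mono[unfolded extends_def]
  define st where "st x = (LEAST i. x \<in> carrier (K i))" for x
  have st: "x \<in> carrier (K (st x))" if "x \<in> carrier (K i)" for x i
    unfolding st_def using that by (rule LeastI)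
  have st_le: "st x \<le> i" if "x \<in> carrier (K i)" for x i
    unfolding st_def using that by (rule Least_le)
  define G where "G = \<lparr>carrier = (\<Union>i. carrier (K i)), monoid.mult =
    (\<lambda>x y. x \<otimes>\<^bsub>K (max (st x) (st y))\<^esub> y),
    one = \<one>\<^bsub>K 0\<^esub>\<rparr>"
  define B where "B = (\<Union>i. A i)"
  define q where "q x = p (st x) x" for x
  interpret A: admissible "K i" H "A i" t "p i" for i by (rule adm)
  have cG: "carrier G = (\<Union>i. carrier (K i))" by (simp add: G_def)
  have mG: "x \<otimes>\<^bsub>G\<^esub> y = x \<otimes>\<^bsub>K i\<^esub> y" if "x \<in> carrier (K i)" "y \<in> carrier (K i)" for x y i
  proof -
    let ?m = "max (st x) (st y)"
    have "?m \<le> i" using that st_le by simp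
    moreover have "x \<in> carrier (K ?m)" "y \<in> carrier (K ?m)"
      using ex[of "st x" ?m] ex[of "st y" ?m] st that by auto
    ultimately have "x \<otimes>\<^bsub>K i\<^esub> y = x \<otimes>\<^bsub>K ?m\<^esub> y" using ex by blast
    then show ?thesis by (simp add: G_def)
  qed
  have oG: "\<one>\<^bsub>G\<^esub> = \<one>\<^bsub>K i\<^esub>" for i
    using extends_one[OF mono[of 0 i] A.is_group A.is_group] by (simp add: G_def)
  have qG: "q x = p i x" if "x \<in> carrier (K i)" for x i
    using ex[OF st_le[OF that]] st[OF that] by (simp add: q_def)
  have in_K: "x \<in> carrier (K j)" if "x \<in> carrier (K i)" "i \<le> j" for x i j
    using ex[OF that(2)] that by auto
  have in_A: "x \<in> A j" if "x \<in> A i" "i \<le> j" for x i j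
    using ex[OF that(2)] that by auto
  have AK: "x \<in> carrier (K i)" if "x \<in> A i" for x i using that A.A_subgroup subgroup.mem_carrier
    by metis
  have gG: "group G"
  proof (rule groupI)
    show "\<one>\<^bsub>G\<^esub> \<in> carrier G" using A.one_closed[of 0] oG[of 0] cG by auto
  next
    fix x y assume "x \<in> carrier G" "y \<in> carrier G"
    then obtain i j where ij: "x \<in> carrier (K i)" "y \<in> carrier (K j)" by (auto simp: cG)
    then have "x \<in> carrier (K (max i j))" "y \<in> carrier (K (max i j))" using in_K by auto
    then have "x \<otimes>\<^bsub>G\<^esub> y \<in> carrier (K (max i j))" using mG A.m_closed by simp
    then show "x \<otimes>\<^bsub>G\<^esub> y \<in> carrier G" by (auto simp: cG)
  next
    fix x y z assume "x \<in> carrier G" "y \<in> carrier G" "z \<in> carrier G"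
    then obtain i j k where ij: "x \<in> carrier (K i)" "y \<in> carrier (K j)" "z \<in> carrier (K k)"
      by (auto simp: cG)
    define m where "m = max i (max j k)"
    have m: "x \<in> carrier (K m)" "y \<in> carrier (K m)" "z \<in> carrier (K m)"
      using ij in_K unfolding m_def by auto
    then show "x \<otimes>\<^bsub>G\<^esub> y \<otimes>\<^bsub>G\<^esub> z = x \<otimes>\<^bsub>G\<^esub> (y \<otimes>\<^bsub>G\<^esub> z)"
      using mG[of _ m] A.m_closed[of _ m] A.m_assoc[of _ m] by simp
  next
    fix x assume "x \<in> carrier G"
    then obtain i where i: "x \<in> carrier (K i)" by (auto simp: cG)
    then show "\<one>\<^bsub>G\<^esub> \<otimes>\<^bsub>G\<^esub> x = x" using mG[of _ i] oG[of i] by simp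
    have "inv\<^bsub>K i\<^esub> x \<otimes>\<^bsub>G\<^esub> x = \<one>\<^bsub>G\<^esub>" using mG[of _ i] oG[of i] i by simp
    moreover have "inv\<^bsub>K i\<^esub> x \<in> carrier G" using A.inv_closed[OF i] by (auto simp: cG)
    ultimately show "\<exists>y\<in>carrier G. y \<otimes>\<^bsub>G\<^esub> x = \<one>\<^bsub>G\<^esub>" by blast
  qed
  interpret G: group G by (rule gG)
  have extG: "extends (K i) (A i) (p i) G B q" for i
    unfolding extends_def using mG qG by (auto simp: cG B_def)
  have iG: "inv\<^bsub>G\<^esub> x = inv\<^bsub>K i\<^esub> x" if "x \<in> carrier (K i)" for x i
    using extends_inv[OF extG A.is_group gG that] .
  have "admissible G H B t q"
  proof (intro admissible.intro admissible_axioms.intro gG A.H.is_group)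
    show "subgroup B G"
    proof (rule G.subgroupI)
      show "B \<subseteq> carrier G" using AK by (auto simp: B_def cG)
      show "B \<noteq> {}" using subgroup.one_closed[OF A.A_subgroup] by (auto simp: B_def)
    next
      fix a assume "a \<in> B"
      then obtain i where i: "a \<in> A i" by (auto simp: B_def)
      then have "inv\<^bsub>G\<^esub> a \<in> A i" using iG[OF AK] subgroup.m_inv_closed[OF A.A_subgroup] by simp
      then show "inv\<^bsub>G\<^esub> a \<in> B" by (auto simp: B_def)
    next
      fix a b assume "a \<in> B" "b \<in> B"
      then obtain i j where "a \<in> A i" "b \<in> A j" by (auto simp: B_def)
      then have "a \<in> A (max i j)" "b \<in> A (max i j)" using in_A by auto
      then have "a \<otimes>\<^bsub>G\<^esub> b \<in> A (max i j)" using mG[OF AK AK] subgroup.m_closed[OF A.A_subgroup] by simp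
      then show "a \<otimes>\<^bsub>G\<^esub> b \<in> B" by (auto simp: B_def)
    qed
  next
    fix g a assume g: "g \<in> carrier G" "g \<notin> B" "a \<in> B" "g \<otimes>\<^bsub>G\<^esub> a \<otimes>\<^bsub>G\<^esub> inv\<^bsub>G\<^esub> g \<in> B"
    then obtain i j k where ij: "g \<in> carrier (K i)" "a \<in> A j" "g \<otimes>\<^bsub>G\<^esub> a \<otimes>\<^bsub>G\<^esub> inv\<^bsub>G\<^esub> g \<in> A k"
      by (auto simp: cG B_def)
    define m where "m = max i (max j k)"
    have m: "g \<in> carrier (K m)" "a \<in> A m" "g \<otimes>\<^bsub>G\<^esub> a \<otimes>\<^bsub>G\<^esub> inv\<^bsub>G\<^esub> g \<in> A m"
      using in_K[OF ij(1), of m] in_A[OF ij(2), of m] in_A[OF ij(3), of m] unfolding m_def by auto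
    have "g \<otimes>\<^bsub>K m\<^esub> a \<otimes>\<^bsub>K m\<^esub> inv\<^bsub>K m\<^esub> g \<in> A m"
      using m AK[OF m(2)] mG[of _ m] iG[OF m(1)] by simp
    then have "a = \<one>\<^bsub>K m\<^esub>" using A.A_malnormal[OF m(1) _ m(2)] g(2) by (auto simp: B_def)
    then show "a = \<one>\<^bsub>G\<^esub>" using oG by simp
  next
    fix a assume a: "a \<in> B" "a \<otimes>\<^bsub>G\<^esub> a = \<one>\<^bsub>G\<^esub>"
    then obtain i where i: "a \<in> A i" by (auto simp: B_def)
    then have "a \<otimes>\<^bsub>K i\<^esub> a = \<one>\<^bsub>K i\<^esub>" using a mG[OF AK AK] oG[of i] by simp
    then show "a = \<one>\<^bsub>G\<^esub>" using A.A_involution[OF i] oG[of i] by simp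
  next
    show "t \<in> carrier G" using A.t_closed by (auto simp: cG)
    show "t \<notin> B" using A.t_A by (auto simp: B_def)
    show "t \<otimes>\<^bsub>G\<^esub> t = \<one>\<^bsub>G\<^esub>" using mG[OF A.t_closed A.t_closed, of 0] A.t_t[of 0] oG[of 0] by simp
    show "q \<in> hom G H"
    proof (rule homI)
      fix x assume "x \<in> carrier G"
      then obtain i where "x \<in> carrier (K i)" by (auto simp: cG)
      then show "q x \<in> carrier H" using qG hom_in_carrier[OF A.p_hom] by simp
    next
      fix x y assume "x \<in> carrier G" "y \<in> carrier G"
      then obtain i j where ij: "x \<in> carrier (K i)" "y \<in> carrier (K j)" by (auto simp: cG)
      define m where "m = max i j"
      have m: "x \<in> carrier (K m)" "y \<in> carrier (K m)" using ij in_K unfolding m_def by auto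
      then show "q (x \<otimes>\<^bsub>G\<^esub> y) = q x \<otimes>\<^bsub>H\<^esub> q y"
        using qG[of _ m] mG[of _ m] A.m_closed[of _ m] hom_mult[OF A.p_hom] by simp
    qed
    have "q ` carrier G \<supseteq> p 0 ` carrier (K 0)"
    proof
      fix z assume "z \<in> p 0 ` carrier (K 0)"
      then obtain x where x: "x \<in> carrier (K 0)" "z = p 0 x" by blast
      then have "x \<in> carrier G" "z = q x" using qG[of x 0] by (auto simp: cG)
      then show "z \<in> q ` carrier G" by blast
    qed
    then show "q ` carrier G = carrier H" using \<open>q \<in> hom G H\<close> A.p_surj[of 0] by (auto simp: hom_def)
  qed
  then show thesis using that extG cG B_def by blast
qed

text \<open>
  At stage \<open>i\<close> the pair of numbers coded in the first component of \<open>i\<close> is treated. Each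
  pair occurs at infinitely many stages, thus also at one where both numbers already
  belong to the group.
\<close>

theorem closed_extension:
  assumes adm: "admissible K H A t p" and room: "infinite (- carrier K)"
    and H2: "\<And>h. h \<in> carrier H \<Longrightarrow> h \<otimes>\<^bsub>H\<^esub> h = \<one>\<^bsub>H\<^esub> \<Longrightarrow> h = \<one>\<^bsub>H\<^esub>"
  obtains G B q where "admissible G H B t q"
    and "\<And>v. v \<in> carrier G \<Longrightarrow> v \<notin> B \<Longrightarrow> dcoset G B t v"
    and "\<And>h g. h \<in> carrier G \<Longrightarrow> g \<in> carrier G \<Longrightarrow> h \<noteq> \<one>\<^bsub>G\<^esub> \<Longrightarrow> q h = \<one>\<^bsub>H\<^esub> \<Longrightarrow> q g = \<one>\<^bsub>H\<^esub> \<Longrightarrow>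
      g \<otimes>\<^bsub>G\<^esub> h \<noteq> \<one>\<^bsub>G\<^esub> \<Longrightarrow> conj_commutator G H q h g"
proof -
  define x y where "x i = fst (prod_decode (fst (prod_decode i)))"
    and "y i = snd (prod_decode (fst (prod_decode i)))" for i
  define good where "good s \<longleftrightarrow> (case s of (K, A, p) \<Rightarrow> admissible K H A t p \<and> infinite (- carrier K))"
    for s
  define step where "step i s s' \<longleftrightarrow> (case s of (K, A, p) \<Rightarrow> case s' of (K', A', p') \<Rightarrow>
    extends K A p K' A' p' \<and>
    (x i \<in> carrier K \<longrightarrow> x i \<notin> A \<longrightarrow> dcoset K' A' t (x i)) \<and>
    (x i \<in> carrier K \<longrightarrow> y i \<in> carrier K \<longrightarrow> x i \<noteq> \<one>\<^bsub>K\<^esub> \<longrightarrow> p (x i) = \<one>\<^bsub>H\<^esub> \<longrightarrow> p (y i) = \<one>\<^bsub>H\<^esub> \<longrightarrow>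
      y i \<otimes>\<^bsub>K\<^esub> x i \<noteq> \<one>\<^bsub>K\<^esub> \<longrightarrow> conj_commutator K' H p' (x i) (y i)))" for i s s'
  have "\<exists>\<sigma>. \<forall>i. good (\<sigma> i) \<and> step i (\<sigma> i) (\<sigma> (Suc i))"
  proof (rule dependent_nat_choice)
    show "\<exists>s. good s" using adm room by (auto simp: good_def)
    fix s i assume "good s"
    then obtain K A p where s: "s = (K, A, p)" "admissible K H A t p" "infinite (- carrier K)"
      by (auto simp: good_def split: prod.splits)
    from step_extension[OF s(2,3) H2, of "x i" "y i"] show "\<exists>s'. good s' \<and> step i s s'"
      unfolding good_def step_def s(1) by fastforce
  qed
  then obtain \<sigma> where \<sigma>: "\<And>i. good (\<sigma> i)" "\<And>i. step i (\<sigma> i) (\<sigma> (Suc i))" by blast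
  define K A p where "K i = fst (\<sigma> i)" and "A i = fst (snd (\<sigma> i))" and "p i = snd (snd (\<sigma> i))" for i
  have \<sigma>': "\<sigma> i = (K i, A i, p i)" for i by (simp add: K_def A_def p_def)
  have admi: "admissible (K i) H (A i) t (p i)" for i using \<sigma>(1)[of i] by (simp add: good_def \<sigma>')
  have exti: "extends (K i) (A i) (p i) (K (Suc i)) (A (Suc i)) (p (Suc i))" for i
    using \<sigma>(2)[of i] by (simp add: step_def \<sigma>')
  obtain G B q where G: "admissible G H B t q" "\<And>i. extends (K i) (A i) (p i) G B q"
    "carrier G = (\<Union>i. carrier (K i))" "B = (\<Union>i. A i)"
    by (rule union_of_chain[where K = K and A = A and p = p and t = t
      and H = H, OF admi exti]) (rule that)
  interpret Ki: admissible "K i" H "A i" t "p i" for i by (rule admi)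
  interpret G: admissible G H B t q by (rule G)
  have mono: "carrier (K i) \<subseteq> carrier (K j)" if "i \<le> j" for i j
  proof -
    have "carrier (K i) \<subseteq> carrier (K (Suc i))" for i using exti[of i] by (simp add: extends_def)
    then show ?thesis using that by (rule lift_Suc_mono_le[of "\<lambda>i. carrier (K i)"])
  qed
  have stage: "\<exists>i. v \<in> carrier (K i) \<and> w \<in> carrier (K i) \<and> x i = v \<and> y i = w"
    if vw: "v \<in> carrier G" "w \<in> carrier G" for v w
  proof -
    obtain i j where ij: "v \<in> carrier (K i)" "w \<in> carrier (K j)" using vw G(3) by auto
    \<comment> \<open>The second component only serves to make the stage late enough.\<close>
    define k where "k = prod_encode (prod_encode (v, w), max i j)"
    have "max i j \<le> k" unfolding k_def by (rule le_prod_encode_2)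
    then have "v \<in> carrier (K k)" "w \<in> carrier (K k)" using ij mono[of i k] mono[of j k] by auto
    moreover have "x k = v" "y k = w" by (simp_all add: x_def y_def k_def)
    ultimately show ?thesis by blast
  qed
  show thesis
  proof (rule that[OF G(1)])
    fix v assume v: "v \<in> carrier G" "v \<notin> B"
    obtain i where i: "v \<in> carrier (K i)" "x i = v" using stage[OF v(1) v(1)] by blast
    have "dcoset (K (Suc i)) (A (Suc i)) t v"
      using \<sigma>(2)[of i] i v(2) G(4) by (auto simp: step_def \<sigma>')
    moreover have "v \<in> carrier (K (Suc i))" using mono[of i "Suc i"] i by auto
    ultimately show "dcoset G B t v" using dcoset_extends[OF admi G(2)] by blast
  next
    fix h g assume hg: "h \<in> carrier G" "g \<in> carrier G" "h \<noteq> \<one>\<^bsub>G\<^esub>" "q h = \<one>\<^bsub>H\<^esub>" "q g = \<one>\<^bsub>H\<^esub>" "g \<otimes>\<^bsub>G\<^esub> h \<noteq>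
      \<one>\<^bsub>G\<^esub>"
    obtain i where i: "h \<in> carrier (K i)" "g \<in> carrier (K i)" "x i = h" "y i = g"
      using stage[OF hg(1,2)] by blast
    have one: "\<one>\<^bsub>G\<^esub> = \<one>\<^bsub>K i\<^esub>" using extends_one[OF G(2) Ki.is_group G.is_group] .
    have "h \<noteq> \<one>\<^bsub>K i\<^esub>" "p i h = \<one>\<^bsub>H\<^esub>" "p i g = \<one>\<^bsub>H\<^esub>" "g \<otimes>\<^bsub>K i\<^esub> h \<noteq> \<one>\<^bsub>K i\<^esub>"
      using hg i G(2)[of i] unfolding one by (auto simp: extends_def)
    then have "conj_commutator (K (Suc i)) H (p (Suc i)) h g"
      using \<sigma>(2)[of i] i by (simp add: step_def \<sigma>')
    moreover have "h \<in> carrier (K (Suc i))" "g \<in> carrier (K (Suc i))" using mono[of i "Suc i"] i by auto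
    ultimately show "conj_commutator G H q h g"
      using conj_commutator_extends[OF Ki.is_group G.is_group G(2)] by blast
  qed
qed

section \<open>Sharp 2-transitivity and simplicity\<close>

text \<open>
  With \<open>K = A \<union> A t A\<close> the stabiliser \<open>A\<close> of the base coset is transitive on all the other
  cosets, so the action is 2-transitive; pair stabilisers are trivial.
\<close>

lemma (in admissible) sharply_2_transitive:
  assumes dc: "\<And>v. v \<in> carrier K \<Longrightarrow> v \<notin> A \<Longrightarrow> \<exists>a\<in>A. \<exists>b\<in>A. a \<otimes> v = t \<otimes> b"
  shows "sharply_2_transitive_action K X (\<lambda>g. \<lambda>x\<in>X. act g x)"
proof -
  let ?\<phi> = "\<lambda>g. \<lambda>x\<in>X. act g x"
  have cancel: "act (inv g) (act g x) = x" "act g (act (inv g) x) = x" if "g \<in> carrier K" "x \<in> X"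
    for g x
    using that act_mult[of "inv g" g x] act_mult[of g "inv g" x] act_one by simp_all
  have bij: "?\<phi> g \<in> Bij X" if g: "g \<in> carrier K" for g
  proof -
    have "bij_betw (act g) X X"
      by (rule bij_betwI[where g = "act (inv g)"]) (use g act_X cancel in auto)
    then show ?thesis by (simp add: Bij_def bij_betw_restrict_eq)
  qed
  have "group_hom K (BijGroup X) ?\<phi>"
  proof (intro group_hom.intro group_hom_axioms.intro is_group group_BijGroup homI)
    show "?\<phi> g \<in> carrier (BijGroup X)" if "g \<in> carrier K" for g
      using bij that by (simp add: BijGroup_def)
    show "?\<phi> (g \<otimes> h) = ?\<phi> g \<otimes>\<^bsub>BijGroup X\<^esub> ?\<phi> h" if "g \<in> carrier K" "h \<in> carrier K" for g h
      using that bij by (auto simp: BijGroup_def compose_def act_mult act_X fun_eq_iff)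
  qed
  then have ga: "group_action K X ?\<phi>" by (simp add: group_action_def)
  have base: "\<exists>g\<in>carrier K. act g \<one> = x1 \<and> act g (coset_rep A t) = x2" if x: "x1 \<in> X" "x2 \<in> X" "x1 \<noteq> x2"
    for x1 x2
  proof -
    have xK: "x1 \<in> carrier K" "x2 \<in> carrier K" and r: "coset_rep A x1 = x1" "coset_rep A x2 = x2"
      using x by (auto simp: cosets_def)
    define v where "v = inv x1 \<otimes> x2"
    have "v \<notin> A" using coset_rep_eq_iff[OF A_subgroup xK] r x(3) by (simp add: v_def)
    then obtain a b where ab: "a \<in> A" "b \<in> A" "a \<otimes> v = t \<otimes> b" using dc[of v] xK by (auto simp: v_def)
    have abK: "a \<in> carrier K" "b \<in> carrier K" using ab A_subgroup subgroup.mem_carrier by metis+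
    have ia: "inv a \<in> A" "inv b \<in> A" using ab A_subgroup subgroup.m_inv_closed by metis+
    define g where "g = x1 \<otimes> inv a"
    have g: "g \<in> carrier K" using xK abK by (simp add: g_def)
    have vK: "v \<in> carrier K" using xK by (simp add: v_def)
    have 1: "act g \<one> = x1"
      using coset_rep_mult_right[OF A_subgroup xK(1) ia(1)] r abK xK by (simp add: coset_act_def g_def)
    have "t = a \<otimes> v \<otimes> inv b" using ab(3) abK t_closed by (simp add: m_assoc)
    then have "g \<otimes> t = x2 \<otimes> inv b" using abK xK vK
      by (simp add: g_def m_assoc) (simp add: v_def m_assoc)
    then have "act g (coset_rep A t) = x2"
      using act_coset_rep[OF g t_closed] coset_rep_mult_right[OF A_subgroup xK(2) ia(2)] r by simp
    then show ?thesis using 1 g by blast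
  qed
  have unique: "\<exists>!g. g \<in> carrier K \<and> ?\<phi> g x1 = y1 \<and> ?\<phi> g x2 = y2"
    if x: "x1 \<in> X" "x2 \<in> X" "y1 \<in> X" "y2 \<in> X" "x1 \<noteq> x2" "y1 \<noteq> y2" for x1 x2 y1 y2
  proof -
    obtain g where g: "g \<in> carrier K" "act g \<one> = x1" "act g (coset_rep A t) = x2" using base x by metis
    obtain h where h: "h \<in> carrier K" "act h \<one> = y1" "act h (coset_rep A t) = y2" using base x by metis
    have ig: "act (inv g) x1 = \<one>" "act (inv g) x2 = coset_rep A t"
      using g cancel(1)[OF g(1) one_X] cancel(1)[OF g(1) coset_rep_t(1)] by simp_all
    have "act (h \<otimes> inv g) x1 = y1" "act (h \<otimes> inv g) x2 = y2"
      using act_mult[OF h(1) inv_closed[OF g(1)]] x ig h by simp_all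
    moreover have "k = l" if "k \<in> carrier K" "l \<in> carrier K" "act k x1 = y1" "act k x2 = y2" "act l x1 =
      y1" "act l x2 = y2" for k l
    proof -
      have "act (inv l \<otimes> k) x1 = x1" "act (inv l \<otimes> k) x2 = x2"
        using that act_mult[of "inv l" k] x cancel(1)[OF that(2) x(1)] cancel(1)[OF that(2) x(2)]
          by simp_all
      then have "inv l \<otimes> k = \<one>" using act_two_fixed[of "inv l \<otimes> k" x1 x2] that x by simp
      then show ?thesis using that by (metis inv_equality inv_inv inv_closed)
    qed
    ultimately show ?thesis using x g h by (intro ex1I[of _ "h \<otimes> inv g"]) auto
  qed
  have "\<exists>x\<in>X. \<exists>y\<in>X. x \<noteq> y"
    using coset_rep_t(2) by (intro bexI[OF _ coset_rep_t(1)] bexI[OF _ one_X])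
  with ga show ?thesis
    unfolding sharply_2_transitive_action_def by (intro conjI ballI impI unique)
qed

text \<open>
  The equation writes \<open>g\<close> as a product of conjugates of \<open>h\<close> and its inverse by elements of
  the kernel. It is not available for \<open>g = h\<^bsup>-1\<^esup>\<close>, which lies in the normal closure of \<open>h\<close>
  anyway. The kernel is not trivial because the involution \<open>t\<close> belongs to it.
\<close>

lemma (in admissible) kernel_simple:
  assumes H2: "\<And>h. h \<in> carrier H \<Longrightarrow> h \<otimes>\<^bsub>H\<^esub> h = \<one>\<^bsub>H\<^esub> \<Longrightarrow> h = \<one>\<^bsub>H\<^esub>"
    and cc: "\<And>h g. h \<in> carrier K \<Longrightarrow> g \<in> carrier K \<Longrightarrow> h \<noteq> \<one> \<Longrightarrow> p h = \<one>\<^bsub>H\<^esub> \<Longrightarrow> p g = \<one>\<^bsub>H\<^esub> \<Longrightarrow>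
      g \<otimes> h \<noteq> \<one> \<Longrightarrow> \<exists>b\<in>carrier K. \<exists>f\<in>carrier K. p b = \<one>\<^bsub>H\<^esub> \<and> p f = \<one>\<^bsub>H\<^esub> \<and>
        f \<otimes> (h \<otimes> b \<otimes> inv h \<otimes> inv b) = g \<otimes> (h \<otimes> b \<otimes> inv h \<otimes> inv b) \<otimes> f"
  shows "is_simple (K\<lparr>carrier := kernel K H p\<rparr>)"
proof -
  interpret hm: group_hom K H p using p_hom by unfold_locales
  let ?N = "kernel K H p" and ?KN = "K\<lparr>carrier := kernel K H p\<rparr>"
  have N: "subgroup ?N K" by (rule hm.subgroup_kernel)
  interpret N: group ?KN by (rule subgroup.subgroup_is_group[OF N is_group])
  have "t \<in> ?N" using p_involution[OF H2 t_closed t_t] t_closed by (simp add: kernel_def)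
  moreover have "t \<noteq> \<one>" using t_A subgroup.one_closed[OF A_subgroup] by auto
  ultimately have nontriv: "carrier ?KN \<noteq> {\<one>\<^bsub>?KN\<^esub>}" by auto
  have "M = carrier ?KN" if M: "M \<lhd> ?KN" "M \<noteq> {\<one>\<^bsub>?KN\<^esub>}" for M
  proof -
    interpret M: normal M ?KN by fact
    have MN: "M \<subseteq> ?N" using M.subset by simp
    have inv: "inv\<^bsub>?KN\<^esub> x = inv x" if "x \<in> ?N" for x
      using m_inv_consistent[OF N that] .
    have MK: "x \<in> carrier K" if "x \<in> M" for x using that MN by (auto simp: kernel_def)
    have mm: "x \<otimes> y \<in> M" if "x \<in> M" "y \<in> M" for x y using M.m_closed[OF that] by simp
    have mi: "inv x \<in> M" if "x \<in> M" for x
      using M.m_inv_closed[OF that] unfolding inv[OF subsetD[OF MN that]] .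
    have mc: "b \<otimes> x \<otimes> inv b \<in> M" if "b \<in> ?N" "x \<in> M" for b x
      using M.inv_op_closed2[of b x] that inv by simp
    have "\<one> \<in> M" using M.one_closed by simp
    then obtain h where h: "h \<in> M" "h \<noteq> \<one>" using M(2) by auto
    have "?N \<subseteq> M"
    proof
      fix g assume g: "g \<in> ?N"
      then have gK: "g \<in> carrier K" "p g = \<one>\<^bsub>H\<^esub>" by (auto simp: kernel_def)
      have hK: "h \<in> carrier K" "p h = \<one>\<^bsub>H\<^esub>" using h MN by (auto simp: kernel_def)
      show "g \<in> M"
      proof (cases "g \<otimes> h = \<one>")
        case True
        then have "g = inv h" using gK hK inv_equality by simp
        then show ?thesis using mi h by simp
      next
        case False
        define u where "u b = h \<otimes> b \<otimes> inv h \<otimes> inv b" for b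
        obtain b f where bf: "b \<in> carrier K" "f \<in> carrier K" "p b = \<one>\<^bsub>H\<^esub>" "p f = \<one>\<^bsub>H\<^esub>"
          "f \<otimes> u b = g \<otimes> u b \<otimes> f"
          using cc[OF hK(1) gK(1) h(2) hK(2) gK(2) False] unfolding u_def by blast
        have bN: "b \<in> ?N" "f \<in> ?N" using bf by (auto simp: kernel_def)
        have u: "u b \<in> M"
          using mm[OF h(1) mc[OF bN(1) mi[OF h(1)]]] hK bf by (simp add: u_def m_assoc)
        have uK: "u b \<in> carrier K" using MK[OF u] .
        have "f \<otimes> u b \<otimes> inv f \<otimes> inv (u b) \<in> M" using mm[OF mc[OF bN(2) u] mi[OF u]] .
        also have "f \<otimes> u b \<otimes> inv f \<otimes> inv (u b) = g"
          unfolding bf(5) using bf(2) uK gK by (simp add: m_assoc)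
        finally show ?thesis .
      qed
    qed
    then show ?thesis using MN by auto
  qed
  then show ?thesis unfolding is_simple_def using N.is_group nontriv by blast
qed

text \<open>
  The construction starts from the direct product of \<open>H\<close> with a group of order two, acting
  on itself: \<open>A\<close> is trivial, \<open>t\<close> is the involution of the first factor and \<open>p\<close> is the
  projection onto \<open>H\<close>.
\<close>

lemma initial_admissible:
  fixes H :: "'h monoid"
  assumes "group H" "finite (carrier H)"
  shows "\<exists>K A t p. admissible (K :: nat monoid) H A t p \<and> infinite (- carrier K)"
proof -
  interpret H: group H by fact
  let ?L = "integer_mod_group 2 \<times>\<times> H"
  interpret L: group ?L by (intro DirProd_group group_integer_mod_group H.is_group)
  have cL: "carrier ?L = {0, 1} \<times> carrier H" by (auto simp: DirProd_def carrier_integer_mod_group)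
  have adm: "admissible ?L H {\<one>\<^bsub>?L\<^esub>} (1, \<one>\<^bsub>H\<^esub>) snd"
  proof (intro admissible.intro admissible_axioms.intro L.is_group H.is_group L.triv_subgroup)
    show "snd \<in> hom ?L H" by (rule homI) (auto simp: cL)
    show "snd ` carrier ?L = carrier H" unfolding cL by force
  qed (auto simp: cL)
  have fin: "finite (carrier ?L)" unfolding cL using assms(2) by simp
  then obtain \<nu> :: "int \<times> 'h \<Rightarrow> nat" where \<nu>: "inj_on \<nu> (carrier ?L)"
    using countable_finite countable_def by metis
  define K where "K = image_group \<nu> ?L"
  have "group K" unfolding K_def using L.inj_imp_image_group_is_group[OF \<nu>] .
  moreover have "\<nu> \<in> iso ?L K" unfolding K_def using inj_imp_image_group_iso[OF \<nu>] .
  ultimately have "admissible K H (\<nu> ` {\<one>\<^bsub>?L\<^esub>}) (\<nu> (1, \<one>\<^bsub>H\<^esub>)) (snd \<circ> inv_into (carrier ?L) \<nu>)"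
    by (rule admissible_iso[OF adm]) (simp only: comp_apply inv_into_f_f[OF \<nu>])
  moreover have "infinite (- carrier K)" using fin by (simp add: K_def image_group_def)
  ultimately show ?thesis by blast
qed

theorem theorem1p5:
  fixes n :: nat
  assumes "odd n" and "n \<ge> 1"
  shows "\<exists>(G :: nat monoid) N.
           sharply_2_transitive_group G \<and>
           N \<lhd> G \<and>
           card (rcosets\<^bsub>G\<^esub> N) = n \<and>
           is_simple (G\<lparr>carrier := N\<rparr>)"
proof -
  let ?H = "integer_mod_group n"
  have cH: "carrier ?H = {0..<int n}" using assms by (simp add: carrier_integer_mod_group)
  have H2: "h = \<one>\<^bsub>?H\<^esub>" if "h \<in> carrier ?H" "h \<otimes>\<^bsub>?H\<^esub> h = \<one>\<^bsub>?H\<^esub>" for h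
  proof -
    have "int n dvd 2 * h" using that by (simp add: dvd_eq_mod_eq_0)
    moreover have "coprime (int n) 2" using assms by simp
    ultimately have "int n dvd h" by (simp add: coprime_dvd_mult_right_iff)
    then have "\<not> 0 < h" using that(1) cH zdvd_not_zless[of h "int n"] by auto
    then show ?thesis using that(1) cH by auto
  qed
  obtain K A t p where K: "admissible (K :: nat monoid) ?H A t p" "infinite (- carrier K)"
    using initial_admissible[of ?H] cH by auto
  obtain G B q where G: "admissible G ?H B t q"
    "\<And>v. v \<in> carrier G \<Longrightarrow> v \<notin> B \<Longrightarrow> dcoset G B t v"
    "\<And>h g. h \<in> carrier G \<Longrightarrow> g \<in> carrier G \<Longrightarrow> h \<noteq> \<one>\<^bsub>G\<^esub> \<Longrightarrow> q h = \<one>\<^bsub>?H\<^esub> \<Longrightarrow> q g = \<one>\<^bsub>?H\<^esub> \<Longrightarrow>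
      g \<otimes>\<^bsub>G\<^esub> h \<noteq> \<one>\<^bsub>G\<^esub> \<Longrightarrow> conj_commutator G ?H q h g"
    by (rule closed_extension[OF K], rule H2, assumption, assumption, rule that)
  interpret G: admissible G ?H B t q by (rule G)
  interpret hm: group_hom G ?H q using G.p_hom by unfold_locales
  let ?N = "kernel G ?H q"
  have "sharply_2_transitive_group G"
    using G.sharply_2_transitive G(2) unfolding dcoset_def by (intro sharply_2_transitive_groupI) blast
  moreover have "?N \<lhd> G" by (rule hm.normal_kernel)
  moreover have "card (rcosets\<^bsub>G\<^esub> ?N) = n"
  proof -
    have "(\<lambda>Y. the_elem (q ` Y)) \<in> iso (G Mod ?N) ?H" using hm.FactGroup_iso_set G.p_surj by blast
    then have "card (carrier (G Mod ?N)) = card (carrier ?H)"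
      by (auto simp: iso_def intro: bij_betw_same_card)
    then show ?thesis by (simp add: FactGroup_def cH)
  qed
  moreover have "is_simple (G\<lparr>carrier := ?N\<rparr>)"
    by (rule G.kernel_simple[OF H2]) (use G(3) in \<open>auto simp: conj_commutator_def\<close>)
  ultimately show ?thesis by blast
qed

end
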